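(* Let $0 < \alpha < (\sqrt{5}-1)/2$ and let $n_k = 2^k$ for every integer $k \geq 1$. Then there exist - a sequence $(a_n)_{n\in\mathbb{Z}}$ in $]0,1[$ with $a_{n+1}<a_n$ for all $n \in \mathbb{Z}$, $a_n\to 0$ as $n\to+\infty$ and $a_n\to 1$ as $n\to-\infty$; - for each integer $k\ge 1$, points $b_k,u_k,v_k,c_k$ with $a_{n_k+1}<b_k<u_k<v_k<c_k<a_{n_k}$; - two diffeomorphisms $f,g:[0,1]\to[0,1]$ of class $C^{1+\alpha}$; such that (1) $f(a_{n+1})=a_n$ for all $n\in\mathbb{Z}$; (2) $g$ is the identity on $[a_{n+1},a_n]$ for every $n\in\mathbb{Z}$ with $n\notin\{n_k : k\ge 1\}$; (3) for every $k\ge1$, $g$ is the identity on $[a_{n_k+1},b_k]\cup[c_k,a_{n_k}]$, $g(u_k)=v_k$, and $g$ has no fixed point in $]b_k,c_k[$; (4) for every $k\ge 1$, $f^{\,n_{k+1}-n_k}(u_{k+1})=b_k$ and $f^{\,n_{k+1}-n_k}(v_{k+1})=c_k$; and the codimension-one foliation obtained by suspending the action on $[0,1]$ of the group generated by $f$ and $g$ (which is transversely of class $C^{1+\alpha}$) does not have the LMS property.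
   Context: A diffeomorphism of $[0,1]$ is of class $C^{1+\alpha}$ if it is a $C^1$ diffeomorphism whose derivative is Hölder continuous of exponent $\alpha$. The symbol $f^m$ denotes the $m$-th iterate of $f$, and $]x,y[$ denotes an open interval. LMS property (existence of local minimal sets): a foliated manifold with foliation $F$ has the LMS property if, for every open saturated set $W$ (saturated means a union of leaves) and every leaf $L\subset W$, the relative closure $\overline{L}\cap W$ contains a minimal set of the restricted foliation $F|_W$. A minimal set of $F|_W$ is a nonempty saturated subset of $W$ that is closed in $W$ and contains no proper nonempty subset with these properties. Suspension: let $\Sigma$ be a closed orientable surface of genus $2$ with universal cover $\tilde\Sigma$, and let $\rho:\pi_1(\Sigma)\to \mathrm{Homeo}([0,1])$ be the homomorphism obtained by composing a surjection of $\pi_1(\Sigma)$ onto the free group on two generators with the map sending these generators to $f$ and $g$. The suspension is the compact manifold $(\tilde\Sigma\times[0,1])/\pi_1(\Sigma)$ (quotient by the diagonal action, by deck transformations on $\tilde\Sigma$ and by $\rho$ on $[0,1]$), with the codimension-one foliation whose leaves are the images of the sets $\tilde\Sigma\times\{x\}$, $x\in[0,1]$. Open saturated sets correspond to open subsets of $[0,1]$ invariant under the group $\Gamma=\langle f,g\rangle$, and leaves correspond to $\Gamma$-orbits. Consequently, failure of the LMS property means that there exist a $\Gamma$-invariant set $W\subset[0,1]$, open in $[0,1]$, and a point $x\in W$ such that $\overline{\Gamma x}\cap W$ contains no minimal nonempty $\Gamma$-invariant subset that is closed in $W$. *)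

theory Defs
  imports "HOL-Analysis.Analysis" "HOL-Algebra.Bij" "HOL-Algebra.Generated_Groups"
begin

section \<open>Diffeomorphisms of class \<open>C\<^sup>1\<^sup>+\<^sup>\<alpha>\<close>\<close>

text \<open>Derivatives are taken within \<open>S\<close>, hence one-sided at the endpoints of an interval; values
  of functions outside \<open>S\<close> play no role.\<close>

definition C1_on :: "real set \<Rightarrow> (real \<Rightarrow> real) \<Rightarrow> bool" where
  "C1_on S f \<longleftrightarrow>
     (\<exists>f'. (\<forall>x\<in>S. (f has_real_derivative f' x) (at x within S)) \<and> continuous_on S f')"

definition C1_diffeo_on :: "real set \<Rightarrow> (real \<Rightarrow> real) \<Rightarrow> bool" where
  "C1_diffeo_on S f \<longleftrightarrow> bij_betw f S S \<and> C1_on S f \<and> C1_on S (inv_into S f)"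

definition holder_on :: "real \<Rightarrow> real set \<Rightarrow> (real \<Rightarrow> real) \<Rightarrow> bool" where
  "holder_on \<alpha> S h \<longleftrightarrow> (\<exists>C. \<forall>x\<in>S. \<forall>y\<in>S. \<bar>h x - h y\<bar> \<le> C * \<bar>x - y\<bar> powr \<alpha>)"

definition C1_holder_diffeo_on :: "real \<Rightarrow> real set \<Rightarrow> (real \<Rightarrow> real) \<Rightarrow> bool" where
  "C1_holder_diffeo_on \<alpha> S f \<longleftrightarrow> C1_diffeo_on S f \<and>
     (\<exists>f'. (\<forall>x\<in>S. (f has_real_derivative f' x) (at x within S)) \<and> holder_on \<alpha> S f')"

section \<open>Local minimal sets\<close>

text \<open>A foliated space enters only through its topology \<open>X\<close> and its set of leaves \<open>L\<close>, a partition
  of the underlying set. For a saturated open \<open>W\<close>, the leaves of the restricted foliation are the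
  leaves contained in \<open>W\<close>.\<close>

definition saturated :: "'a set set \<Rightarrow> 'a set \<Rightarrow> bool" where
  "saturated L A \<longleftrightarrow> (\<exists>L'\<subseteq>L. A = \<Union>L')"

definition closed_saturated_in :: "'a topology \<Rightarrow> 'a set set \<Rightarrow> 'a set \<Rightarrow> 'a set \<Rightarrow> bool" where
  "closed_saturated_in X L W K \<longleftrightarrow>
     K \<noteq> {} \<and> saturated L K \<and> closedin (subtopology X W) K"

definition minimal_set_in :: "'a topology \<Rightarrow> 'a set set \<Rightarrow> 'a set \<Rightarrow> 'a set \<Rightarrow> bool" where
  "minimal_set_in X L W K \<longleftrightarrow>
     closed_saturated_in X L W K \<and> (\<forall>K'. K' \<subset> K \<longrightarrow> \<not> closed_saturated_in X L W K')"

definition LMS_property :: "'a topology \<Rightarrow> 'a set set \<Rightarrow> bool" where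
  "LMS_property X L \<longleftrightarrow>
     (\<forall>W. openin X W \<and> saturated L W \<longrightarrow>
        (\<forall>l\<in>L. l \<subseteq> W \<longrightarrow> (\<exists>K. minimal_set_in X L W K \<and> K \<subseteq> X closure_of l \<inter> W)))"

section \<open>Groups of homeomorphisms\<close>

text \<open>As in \<^const>\<open>BijGroup\<close>, group elements are extensional functions and the product is
  composition \<open>g \<circ> f\<close>, so that these groups act from the left.\<close>

definition homeo_group :: "'a topology \<Rightarrow> ('a \<Rightarrow> 'a) monoid" where
  "homeo_group X =
     (BijGroup (topspace X))\<lparr>carrier := {h \<in> Bij (topspace X). homeomorphic_map X X h}\<rparr>"

definition orbits :: "('a \<Rightarrow> 'a) set \<Rightarrow> 'a set \<Rightarrow> 'a set set" where
  "orbits H S = {(\<lambda>h. h x) ` H |x. x \<in> S}"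

abbreviation unit_interval :: "real topology" where
  "unit_interval \<equiv> top_of_set {0..1}"

section \<open>Free groups on two generators\<close>

text \<open>A letter \<open>(i, e)\<close> stands for \<open>s\<close> (\<open>i\<close> false) or \<open>t\<close> (\<open>i\<close> true), inverted if \<open>e\<close> is true.\<close>

fun letter_val :: "('g, 'x) monoid_scheme \<Rightarrow> 'g \<Rightarrow> 'g \<Rightarrow> bool \<times> bool \<Rightarrow> 'g" where
  "letter_val G s t (i, e) = (let x = (if i then t else s) in if e then inv\<^bsub>G\<^esub> x else x)"

definition word_val :: "('g, 'x) monoid_scheme \<Rightarrow> 'g \<Rightarrow> 'g \<Rightarrow> (bool \<times> bool) list \<Rightarrow> 'g" where
  "word_val G s t w = foldr (\<lambda>l x. letter_val G s t l \<otimes>\<^bsub>G\<^esub> x) w \<one>\<^bsub>G\<^esub>"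

definition reduced_word :: "(bool \<times> bool) list \<Rightarrow> bool" where
  "reduced_word w \<longleftrightarrow> successively (\<lambda>l l'. \<not> (fst l = fst l' \<and> snd l \<noteq> snd l')) w"

definition free_group_on :: "('g, 'x) monoid_scheme \<Rightarrow> 'g \<Rightarrow> 'g \<Rightarrow> bool" where
  "free_group_on G s t \<longleftrightarrow>
     group G \<and> s \<in> carrier G \<and> t \<in> carrier G \<and> generate G {s, t} = carrier G \<and>
     (\<forall>w. reduced_word w \<and> w \<noteq> [] \<longrightarrow> word_val G s t w \<noteq> \<one>\<^bsub>G\<^esub>)"

section \<open>The surface of genus two and its universal cover\<close>

text \<open>The boundary circle of the closed unit disc is divided into eight arcs, the \<open>j\<close>-th one being
  \<open>cis (\<pi>/4 * (j + r))\<close> with \<open>0 \<le> r \<le> 1\<close>. They are glued according to the word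
  \<open>a b a\<inverse> b\<inverse> c d c\<inverse> d\<inverse>\<close>: the arcs \<open>j\<close> and \<open>j + 2\<close> are identified with reversed direction,
  for \<open>j = 0, 1, 4, 5\<close>.\<close>

inductive octagon_glue :: "complex \<Rightarrow> complex \<Rightarrow> bool" where
  "j \<in> {0, 1, 4, 5} \<Longrightarrow> 0 \<le> r \<Longrightarrow> r \<le> 1 \<Longrightarrow>
     octagon_glue (cis (pi / 4 * (j + r))) (cis (pi / 4 * (j + 2 + (1 - r))))"

definition closed_orientable_genus2 :: "'b::topological_space set \<Rightarrow> bool" where
  "closed_orientable_genus2 \<Sigma> \<longleftrightarrow>
     (\<exists>q. quotient_map (top_of_set (cball (0::complex) 1)) (top_of_set \<Sigma>) q \<and>
          (\<forall>x\<in>cball 0 1. \<forall>y\<in>cball 0 1. q x = q y \<longleftrightarrow> equivclp octagon_glue x y))"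

definition universal_cover ::
    "'a::topological_space set \<Rightarrow> ('a \<Rightarrow> 'b::topological_space) \<Rightarrow> 'b set \<Rightarrow> bool" where
  "universal_cover C p \<Sigma> \<longleftrightarrow> covering_space C p \<Sigma> \<and> simply_connected C"

text \<open>For a universal cover this is the fundamental group of the base, with its action on the
  cover.\<close>

definition deck_group ::
    "'a::topological_space set \<Rightarrow> ('a \<Rightarrow> 'b) \<Rightarrow> ('a \<Rightarrow> 'a) monoid" where
  "deck_group C p =
     (homeo_group (top_of_set C))
       \<lparr>carrier := {h \<in> carrier (homeo_group (top_of_set C)). \<forall>z\<in>C. p (h z) = p z}\<rparr>"

section \<open>Suspension\<close>

definition quotient_topology :: "'a topology \<Rightarrow> ('a \<Rightarrow> 'b) \<Rightarrow> 'b topology" where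
  "quotient_topology X q =
     topology (\<lambda>U. U \<subseteq> q ` topspace X \<and> openin X {x \<in> topspace X. q x \<in> U})"

lemma openin_quotient_topology:
  "openin (quotient_topology X q) U \<longleftrightarrow>
     U \<subseteq> q ` topspace X \<and> openin X {x \<in> topspace X. q x \<in> U}"
proof -
  let ?P = "\<lambda>U. U \<subseteq> q ` topspace X \<and> openin X {x \<in> topspace X. q x \<in> U}"
  have "istopology ?P"
    unfolding istopology_def
  proof (intro conjI allI impI; (elim conjE)?)
    fix S T assume S: "openin X {x \<in> topspace X. q x \<in> S}" and T: "openin X {x \<in> topspace X. q x \<in> T}"
    have "{x \<in> topspace X. q x \<in> S \<inter> T} = {x \<in> topspace X. q x \<in> S} \<inter> {x \<in> topspace X. q x \<in> T}"
      by auto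
    then show "openin X {x \<in> topspace X. q x \<in> S \<inter> T}" using S T by auto
  next
    fix \<K> assume K: "\<forall>K\<in>\<K>. ?P K"
    have "{x \<in> topspace X. q x \<in> \<Union>\<K>} = (\<Union>K\<in>\<K>. {x \<in> topspace X. q x \<in> K})" by auto
    then show "openin X {x \<in> topspace X. q x \<in> \<Union>\<K>}" using K by auto
  qed auto
  then show ?thesis unfolding quotient_topology_def by (simp add: topology_inverse')
qed

lemma topspace_quotient_topology [simp]: "topspace (quotient_topology X q) = q ` topspace X"
proof
  show "topspace (quotient_topology X q) \<subseteq> q ` topspace X"
    using openin_topspace[of "quotient_topology X q"] by (simp only: openin_quotient_topology)
  have "{x \<in> topspace X. q x \<in> q ` topspace X} = topspace X" by auto
  then have "openin (quotient_topology X q) (q ` topspace X)"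
    by (simp add: openin_quotient_topology)
  then show "q ` topspace X \<subseteq> topspace (quotient_topology X q)" by (rule openin_subset)
qed

lemma quotient_map_quotient_topology: "quotient_map X (quotient_topology X q) q"
  by (auto simp: quotient_map_def openin_quotient_topology)

text \<open>Here \<open>G\<close> is a group of homeomorphisms of \<open>C\<close>, and \<open>\<rho>\<close> sends its elements to homeomorphisms
  of the unit interval; the points of the suspension are the orbits of the diagonal action.\<close>

definition suspension_proj ::
    "('a \<Rightarrow> 'a) monoid \<Rightarrow> (('a \<Rightarrow> 'a) \<Rightarrow> real \<Rightarrow> real) \<Rightarrow> 'a \<times> real \<Rightarrow> ('a \<times> real) set" where
  "suspension_proj G \<rho> = (\<lambda>(z, x). (\<lambda>\<gamma>. (\<gamma> z, \<rho> \<gamma> x)) ` carrier G)"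

definition suspension ::
    "'a::topological_space set \<Rightarrow> ('a \<Rightarrow> 'a) monoid \<Rightarrow> (('a \<Rightarrow> 'a) \<Rightarrow> real \<Rightarrow> real) \<Rightarrow>
      ('a \<times> real) set topology" where
  "suspension C G \<rho> =
     quotient_topology (prod_topology (top_of_set C) unit_interval) (suspension_proj G \<rho>)"

definition suspension_leaves ::
    "'a::topological_space set \<Rightarrow> ('a \<Rightarrow> 'a) monoid \<Rightarrow> (('a \<Rightarrow> 'a) \<Rightarrow> real \<Rightarrow> real) \<Rightarrow>
      ('a \<times> real) set set set" where
  "suspension_leaves C G \<rho> = {suspension_proj G \<rho> ` (C \<times> {x}) |x. x \<in> {0..1}}"

end

theory Submission
  imports Defs "HOL-Real_Asymp.Real_Asymp"
begin

text \<open>In the coordinate \<open>t = 1 / x\<^sup>2\<close> the map \<open>f\<close> is, near \<open>x = 0\<close>, the translation \<open>t \<mapsto> t - 1\<close>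
  composed with a map that expands a neighbourhood of the midpoint of \<open>[m, m + 1]\<close> by the factor
  \<open>1 + m\<^sup>-\<^sup>1\<^sup>5\<^sup>/\<^sup>1\<^sup>6 / 2\<close>. As \<open>[m, m + 1]\<close> has length about \<open>m\<^sup>-\<^sup>3\<^sup>/\<^sup>2\<close> in the coordinate \<open>x\<close> and
  \<open>3/2 \<cdot> 5/8 = 15/16\<close>, the derivative of \<open>f\<close> is Hoelder of exponent \<open>5/8 > (\<surd>5 - 1) / 2\<close>; and as
  \<open>15/16 < 1\<close>, the iterate \<open>f\<close> to the power \<open>2\<^sup>k\<close> expands \<open>[u\<^sub>k\<^sub>+\<^sub>1, v\<^sub>k\<^sub>+\<^sub>1]\<close> by at least
  \<open>exp (2\<^sup>k\<^sup>/\<^sup>1\<^sup>6 / 16)\<close>. This expansion is strong enough for the interval \<open>[b\<^sub>k, c\<^sub>k]\<close> to be so much longer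
  than \<open>[u\<^sub>k, v\<^sub>k]\<close> that \<open>g\<close> can move \<open>u\<^sub>k\<close> to \<open>v\<^sub>k\<close> with a small Hoelder norm.

  Transported to \<open>]a\<^sub>1, a\<^sub>0[\<close> by powers of \<open>f\<close>, the intervals \<open>[b\<^sub>k, c\<^sub>k]\<close> become an increasing sequence
  of intervals \<open>[B\<^sub>k, D\<^sub>k]\<close>, whose interiors generate the open invariant set \<open>W\<close>,
  and \<open>g\<close> becomes a sequence of maps \<open>\<gamma>\<^sub>k\<close> supported in \<open>[B\<^sub>k, D\<^sub>k]\<close> with
  \<open>\<gamma>\<^sub>k\<^sub>+\<^sub>1 B\<^sub>k = D\<^sub>k\<close>. The orbit of a point of \<open>]B\<^sub>k, D\<^sub>k[\<close> accumulates at \<open>D\<^sub>k\<close>, so a minimal set of \<open>W\<close>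
  would contain \<open>D\<^sub>k\<close> and \<open>D\<^sub>k\<^sub>+\<^sub>1\<close> for some \<open>k\<close>. But the translates of \<open>]B\<^sub>k\<^sub>+\<^sub>1, D\<^sub>k\<^sub>+\<^sub>1[\<close> do not contain
  \<open>D\<^sub>k\<^sub>+\<^sub>1\<close>, so removing them leaves a smaller nonempty closed invariant set.\<close>

section \<open>Diffeomorphisms with Hoelder derivative\<close>

text \<open>In the coordinate \<open>t = 1 / x^p\<close> the interval \<open>[m, m + 1]\<close> has
  length about \<open>m^(-1 - 1/p)\<close> in \<open>x\<close>, so a derivative of Hoelder exponent
  \<alpha> may vary there by about \<open>m^(- \<alpha> (1 + 1/p))\<close>. The \<open>2^k\<close>
  steps of \<open>f\<close> between consecutive levels then expand superpolynomially in
  \<open>2^k\<close> as soon as \<open>\<alpha> (1 + 1/p) < 1\<close>; the choice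
  \<open>p = 2\<close> allows every \<alpha> below 2/3, in particular 5/8. The tension lies in
  \<open>g\<close>. Let \<open>r_k\<close> and \<open>r'_k\<close> be the half-lengths of
  \<open>[b_k, c_k]\<close> and \<open>[u_k, v_k]\<close> in \<open>t\<close>. A bump of height
  about \<open>r'_k\<close> spread over \<open>r_k\<close> has a derivative whose Hoelder constant
  in \<open>x\<close> is about \<open>r'_k * r_k^(-13/8) * (2^k)^(15/16)\<close>, while condition
  (4) forces \<open>r'_(k+1)\<close> to be \<open>r_k\<close> divided by the expansion. So
  \<open>r_k\<close> must not shrink too fast: \<open>- ln r_k\<close> is kept small compared with
  the logarithm of the expansion. Dynamically, the orbit of \<open>D_k\<close> accumulates at
  \<open>D_(k+1)\<close> but the closure of the orbit of \<open>D_(k+1)\<close> in \<open>W\<close>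
  misses \<open>D_k\<close>: orbit closures in \<open>W\<close> shrink strictly forever.\<close>

lemma has_real_derivative_inverse_within:
  fixes f g :: "real \<Rightarrow> real"
  assumes f: "(f has_real_derivative D) (at (g y) within S)" and "D \<noteq> 0"
    and g: "continuous_on T g" "g ` T \<subseteq> S" and fg: "\<And>z. z \<in> T \<Longrightarrow> f (g z) = z" and y: "y \<in> T"
  shows "(g has_real_derivative inverse D) (at y within T)"
proof -
  have lim: "((\<lambda>x. (f x - f (g y)) / (x - g y)) \<longlongrightarrow> D) (at (g y) within S)"
    using f by (simp add: has_field_derivative_iff)
  have "(g \<longlongrightarrow> g y) (at y within T)"
    using g(1) y by (simp add: continuous_on)
  moreover have "eventually (\<lambda>z. g z \<in> S \<and> g z \<noteq> g y) (at y within T)"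
    unfolding eventually_at_filter
  proof (intro always_eventually allI impI)
    fix z assume "z \<noteq> y" "z \<in> T"
    then show "g z \<in> S \<and> g z \<noteq> g y" using g(2) fg[of z] fg[OF y] by auto
  qed
  ultimately have "filterlim g (at (g y) within S) (at y within T)"
    by (simp add: filterlim_at)
  \<comment> \<open>Since \<open>f (g z) = z\<close>, these quotients are the reciprocals of the
    difference quotients of \<open>g\<close>.\<close>
  then have "((\<lambda>z. (f (g z) - f (g y)) / (g z - g y)) \<longlongrightarrow> D) (at y within T)"
    by (rule filterlim_compose[OF lim])
  then have "((\<lambda>z. inverse ((f (g z) - f (g y)) / (g z - g y))) \<longlongrightarrow> inverse D) (at y within T)"
    using \<open>D \<noteq> 0\<close> by (rule tendsto_inverse)
  moreover have "eventually (\<lambda>z. inverse ((f (g z) - f (g y)) / (g z - g y)) = (g z - g y) / (z - y))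
      (at y within T)"
    unfolding eventually_at_filter using fg y by (intro always_eventually allI impI) simp
  ultimately show ?thesis
    unfolding has_field_derivative_iff by (rule Lim_transform_eventually)
qed

lemma holder_on_imp_continuous_on:
  assumes "holder_on \<alpha> S h" "\<alpha> > 0"
  shows "continuous_on S h"
proof -
  obtain C where C: "\<forall>x\<in>S. \<forall>y\<in>S. \<bar>h x - h y\<bar> \<le> C * \<bar>x - y\<bar> powr \<alpha>"
    using assms unfolding holder_on_def by blast
  have "(h \<longlongrightarrow> h x) (at x within S)" if "x \<in> S" for x
  proof -
    have "((\<lambda>y. C * \<bar>y - x\<bar> powr \<alpha>) \<longlongrightarrow> C * \<bar>x - x\<bar> powr \<alpha>) (at x within S)"
      using assms(2) by (intro tendsto_intros) auto
    then have "((\<lambda>y. C * \<bar>y - x\<bar> powr \<alpha>) \<longlongrightarrow> 0) (at x within S)" using assms(2) by simp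
    moreover have "eventually (\<lambda>y. norm (h y - h x) \<le> C * \<bar>y - x\<bar> powr \<alpha>) (at x within S)"
      unfolding eventually_at_filter using C that by (intro always_eventually allI impI) simp
    ultimately have "((\<lambda>y. h y - h x) \<longlongrightarrow> 0) (at x within S)"
      by (rule Lim_null_comparison[rotated])
    then show ?thesis by (simp add: Lim_null[of h])
  qed
  then show ?thesis by (simp add: continuous_on)
qed

lemma holder_onE_nonneg:
  assumes "holder_on \<alpha> S h"
  obtains C where "C \<ge> 0" "\<And>x y. x \<in> S \<Longrightarrow> y \<in> S \<Longrightarrow> \<bar>h x - h y\<bar> \<le> C * \<bar>x - y\<bar> powr \<alpha>"
proof -
  obtain C where C: "\<forall>x\<in>S. \<forall>y\<in>S. \<bar>h x - h y\<bar> \<le> C * \<bar>x - y\<bar> powr \<alpha>"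
    using assms unfolding holder_on_def by blast
  show ?thesis
  proof (rule that[of "max C 0"])
    fix x y assume "x \<in> S" "y \<in> S"
    then have "\<bar>h x - h y\<bar> \<le> C * \<bar>x - y\<bar> powr \<alpha>" using C by blast
    also have "\<dots> \<le> max C 0 * \<bar>x - y\<bar> powr \<alpha>" by (intro mult_right_mono) auto
    finally show "\<bar>h x - h y\<bar> \<le> max C 0 * \<bar>x - y\<bar> powr \<alpha>" .
  qed auto
qed

lemma holder_on_mono_exponent:
  assumes h: "holder_on \<beta> {0..1} h" and "\<alpha> \<le> \<beta>"
  shows "holder_on \<alpha> {0..1} h"
proof -
  obtain C where C: "C \<ge> 0" "\<And>x y. x \<in> {0..1} \<Longrightarrow> y \<in> {0..1} \<Longrightarrow> \<bar>h x - h y\<bar> \<le> C * \<bar>x - y\<bar> powr \<beta>"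
    by (rule holder_onE_nonneg[OF h]) blast
  have "\<bar>h x - h y\<bar> \<le> C * \<bar>x - y\<bar> powr \<alpha>" if xy: "x \<in> {0..1}" "y \<in> {0..1}" for x y
  proof -
    have "\<bar>x - y\<bar> powr \<beta> \<le> \<bar>x - y\<bar> powr \<alpha>" using xy \<open>\<alpha> \<le> \<beta>\<close> by (intro powr_mono') auto
    then show ?thesis using C(2)[OF xy] C(1) by (meson mult_left_mono order_trans)
  qed
  then show ?thesis unfolding holder_on_def by blast
qed

lemma holder_on_lipschitz:
  assumes "0 < \<alpha>" "\<alpha> \<le> 1" "\<And>x y. x \<in> {0..1} \<Longrightarrow> y \<in> {0..1} \<Longrightarrow> \<bar>h x - h y\<bar> \<le> L * \<bar>x - y\<bar>"
  shows "holder_on \<alpha> {0..1} h"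
proof (rule holder_on_mono_exponent[OF _ \<open>\<alpha> \<le> 1\<close>])
  show "holder_on 1 {0..1} h" unfolding holder_on_def
    using assms(3) by (intro exI[of _ L]) auto
qed

lemma holder_on_add:
  assumes f: "holder_on \<alpha> S f" and g: "holder_on \<alpha> S g"
  shows "holder_on \<alpha> S (\<lambda>x. f x + g x)"
proof -
  obtain C where C: "C \<ge> 0" "\<And>x y. x \<in> S \<Longrightarrow> y \<in> S \<Longrightarrow> \<bar>f x - f y\<bar> \<le> C * \<bar>x - y\<bar> powr \<alpha>"
    by (rule holder_onE_nonneg[OF f]) blast
  obtain D where D: "D \<ge> 0" "\<And>x y. x \<in> S \<Longrightarrow> y \<in> S \<Longrightarrow> \<bar>g x - g y\<bar> \<le> D * \<bar>x - y\<bar> powr \<alpha>"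
    by (rule holder_onE_nonneg[OF g]) blast
  have "\<bar>f x + g x - (f y + g y)\<bar> \<le> (C + D) * \<bar>x - y\<bar> powr \<alpha>" if "x \<in> S" "y \<in> S" for x y
    using C(2)[OF that] D(2)[OF that] by (simp add: algebra_simps)
  then show ?thesis unfolding holder_on_def by blast
qed

lemma holder_on_mult:
  assumes f: "holder_on \<alpha> S f" and g: "holder_on \<alpha> S g"
    and A: "\<And>x. x \<in> S \<Longrightarrow> \<bar>f x\<bar> \<le> A" and B: "\<And>x. x \<in> S \<Longrightarrow> \<bar>g x\<bar> \<le> B"
  shows "holder_on \<alpha> S (\<lambda>x. f x * g x)"
proof -
  obtain C where C: "C \<ge> 0" "\<And>x y. x \<in> S \<Longrightarrow> y \<in> S \<Longrightarrow> \<bar>f x - f y\<bar> \<le> C * \<bar>x - y\<bar> powr \<alpha>"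
    by (rule holder_onE_nonneg[OF f]) blast
  obtain D where D: "D \<ge> 0" "\<And>x y. x \<in> S \<Longrightarrow> y \<in> S \<Longrightarrow> \<bar>g x - g y\<bar> \<le> D * \<bar>x - y\<bar> powr \<alpha>"
    by (rule holder_onE_nonneg[OF g]) blast
  have "\<bar>f x * g x - f y * g y\<bar> \<le> (A * D + C * B) * \<bar>x - y\<bar> powr \<alpha>" if "x \<in> S" "y \<in> S" for x y
  proof -
    have "f x * g x - f y * g y = f x * (g x - g y) + (f x - f y) * g y" by (simp add: algebra_simps)
    then have "\<bar>f x * g x - f y * g y\<bar> \<le> \<bar>f x\<bar> * \<bar>g x - g y\<bar> + \<bar>f x - f y\<bar> * \<bar>g y\<bar>"
      by (metis abs_mult abs_triangle_ineq)
    also have "\<dots> \<le> A * (D * \<bar>x - y\<bar> powr \<alpha>) + (C * \<bar>x - y\<bar> powr \<alpha>) * B"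
      using A[OF that(1)] B[OF that(2)] C(2)[OF that] D(2)[OF that] C(1)
      by (intro add_mono mult_mono) auto
    finally show ?thesis by (simp add: algebra_simps)
  qed
  then show ?thesis unfolding holder_on_def by blast
qed

text \<open>Fixed endpoints and a positive derivative give an increasing bijection; compactness
  makes its inverse continuous, and the inverse is then \<open>C^1\<close> because the derivative
  never vanishes.\<close>

lemma C1_holder_diffeo_onI:
  assumes f01: "f 0 = 0" "f 1 = 1"
    and der: "\<And>x. x \<in> {0..1} \<Longrightarrow> (f has_real_derivative f' x) (at x within {0..1})"
    and pos: "\<And>x. x \<in> {0..1} \<Longrightarrow> f' x > 0"
    and hol: "holder_on \<alpha> {0..1} f'" and "\<alpha> > 0"
  shows "C1_holder_diffeo_on \<alpha> {0..1} f" and "strict_mono_on {0..1} f"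
proof -
  have cont: "continuous_on {0..1} f"
    unfolding continuous_on_eq_continuous_within using DERIV_continuous[OF der] by blast
  have less: "f x < f y" if "x \<in> {0..1}" "y \<in> {0..1}" "x < y" for x y
  proof (rule DERIV_pos_imp_increasing_open[OF \<open>x < y\<close>])
    fix z assume z: "x < z" "z < y"
    then have "(f has_real_derivative f' z) (at z)"
      using that der[of z] at_within_Icc_at[of 0 z 1] by auto
    then show "\<exists>y. (f has_real_derivative y) (at z) \<and> 0 < y" using pos[of z] that z by auto
  next
    show "continuous_on {x..y} f" by (rule continuous_on_subset[OF cont]) (use that in auto)
  qed
  then show mono: "strict_mono_on {0..1} f" by (simp add: strict_mono_on_def)
  have inj: "inj_on f {0..1}" using mono by (rule strict_mono_on_imp_inj_on)
  have surj: "f ` {0..1} = {0..1}"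
  proof
    show "f ` {0..1} \<subseteq> {0..1}"
    proof
      fix y assume "y \<in> f ` {0..1}"
      then obtain x where x: "x \<in> {0..1}" "y = f x" by blast
      show "y \<in> {0..1}"
        using strict_mono_on_leD[OF mono, of 0 x] strict_mono_on_leD[OF mono, of x 1] x f01 by simp
    qed
    show "{0..1} \<subseteq> f ` {0..1}"
    proof
      fix y :: real assume "y \<in> {0..1}"
      then obtain x where "0 \<le> x" "x \<le> 1" "f x = y"
        using IVT'[of f 0 y 1] cont f01 by auto
      then show "y \<in> f ` {0..1}" by auto
    qed
  qed
  have bij: "bij_betw f {0..1} {0..1}" using inj surj by (simp add: bij_betw_def)
  have cf': "continuous_on {0..1} f'" by (rule holder_on_imp_continuous_on[OF hol \<open>\<alpha> > 0\<close>])
  let ?g = "inv_into {0..1} f"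
  have fg: "f (?g y) = y" and gm: "?g y \<in> {0..1}" if "y \<in> {0..1}" for y
    using f_inv_into_f[of y f "{0..1}"] inv_into_into[of y f "{0..1}"] that surj by simp_all
  have cg: "continuous_on {0..1} ?g"
  proof -
    have "\<forall>x\<in>{0..1}. ?g (f x) = x" using inv_into_f_f[OF inj] by simp
    from continuous_on_inv[OF cont compact_Icc this] show ?thesis unfolding surj .
  qed
  have img: "?g ` {0..1} \<subseteq> {0..1}" by (rule image_subsetI) (rule gm)
  have dg: "(?g has_real_derivative inverse (f' (?g y))) (at y within {0..1})" if y: "y \<in> {0..1}" for y
  proof -
    have "f' (?g y) \<noteq> 0" using pos[OF gm[OF y]] by linarith
    from has_real_derivative_inverse_within[OF der[OF gm[OF y]] this cg img fg y] show ?thesis .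
  qed
  have "continuous_on {0..1} (\<lambda>y. inverse (f' (?g y)))"
  proof (rule continuous_on_inverse[OF continuous_on_compose2[OF cf' cg img]], rule ballI)
    fix x :: real assume "x \<in> {0..1}"
    from pos[OF gm[OF this]] show "f' (?g x) \<noteq> 0" by linarith
  qed
  then have "C1_on {0..1} ?g" unfolding C1_on_def using dg by (intro exI conjI ballI)
  moreover have "C1_on {0..1} f" unfolding C1_on_def using der cf' by (intro exI conjI ballI)
  ultimately show "C1_holder_diffeo_on \<alpha> {0..1} f"
    unfolding C1_holder_diffeo_on_def C1_diffeo_on_def using bij der hol by (intro conjI exI ballI)
qed

lemma C1_holder_diffeo_on_mono_exponent:
  assumes "C1_holder_diffeo_on \<beta> {0..1} f" "\<alpha> \<le> \<beta>"
  shows "C1_holder_diffeo_on \<alpha> {0..1} f"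
proof -
  obtain f' where "\<forall>x\<in>{0..1}. (f has_real_derivative f' x) (at x within {0..1})"
      and "holder_on \<beta> {0..1} f'" and "C1_diffeo_on {0..1} f"
    using assms(1) unfolding C1_holder_diffeo_on_def by auto
  then show ?thesis
    unfolding C1_holder_diffeo_on_def using holder_on_mono_exponent[OF _ assms(2)]
    by (intro conjI exI[of _ f']) auto
qed

section \<open>Maps of the interval in the coordinate \<open>1 / x\<^sup>2\<close>\<close>

text \<open>The map that reads \<open>t \<mapsto> t + w t\<close> in the coordinate \<open>t = 1 / x\<^sup>2\<close>; at \<open>x = 0\<close> the junk value
  \<open>1 / 0 = 0\<close> is harmless because of the factor \<open>x\<close>.\<close>

definition twist :: "(real \<Rightarrow> real) \<Rightarrow> real \<Rightarrow> real" where
  "twist w x = x / sqrt (1 + x\<^sup>2 * w (1 / x\<^sup>2))"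

lemma twist_coord:
  assumes "t > 0"
  shows "twist w (1 / sqrt t) = 1 / sqrt (t + w t)"
proof -
  have "1 + (1 / sqrt t)\<^sup>2 * w (1 / (1 / sqrt t)\<^sup>2) = (t + w t) / t"
    using assms by (simp add: power_divide field_simps)
  then show ?thesis
    using assms by (simp add: twist_def real_sqrt_divide)
qed

text \<open>Mean value estimate; the constant is \<open>3/2 * 2^3\<close>, with \<open>2^3\<close>
  as a bound for \<open>2^(5/2)\<close>.\<close>

lemma powr_neg_three_halves_lipschitz:
  fixes u v :: real
  assumes "u \<ge> 1/2" "v \<ge> 1/2"
  shows "\<bar>u powr (-3/2) - v powr (-3/2)\<bar> \<le> 12 * \<bar>u - v\<bar>"
proof -
  have "norm (u powr (-3/2) - v powr (-3/2)) \<le> 12 * norm (u - v)"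
  proof (rule field_differentiable_bound[of "{1/2..}"])
    fix z :: real assume z: "z \<in> {1/2..}"
    show "((\<lambda>u. u powr (-3/2)) has_field_derivative (-3/2 * z powr (-5/2))) (at z within {1/2..})"
      using z by (auto intro!: derivative_eq_intros)
    have "z powr (-5/2) \<le> (1/2) powr (-5/2)" using z by (intro powr_mono2') auto
    also have "\<dots> = 2 powr (5/2)" by (simp add: powr_minus_divide powr_divide)
    also have "\<dots> \<le> 2 powr 3" by (intro powr_mono) auto
    finally have "z powr (-5/2) \<le> 8" by simp
    then show "norm (-3/2 * z powr (-5/2)) \<le> 12" by (simp add: abs_mult)
  qed (use assms in auto)
  then show ?thesis by simp
qed

text \<open>Writing the map as \<open>x / sqrt (D x)\<close>, the identity
  \<open>D - x D' / 2 = 1 + w'\<close> gives the derivative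
  \<open>(1 + w' (1 / x^2)) * D x powr (-3/2)\<close>. The second factor is Lipschitz:
  \<open>half\<close> keeps \<open>D\<close> away from 0, and the bound \<open>M / sqrt t\<close>
  controls the term \<open>w' (1 / x^2) / x\<close> of \<open>D'\<close>. The Hoelder condition thus
  passes to \<open>w'\<close> read in the variable \<open>x\<close>.\<close>

lemma twist_diffeo:
  fixes w w' :: "real \<Rightarrow> real"
  assumes der: "\<And>t. t \<ge> 1 \<Longrightarrow> (w has_real_derivative w' t) (at t)"
    and pos: "\<And>t. t \<ge> 1 \<Longrightarrow> 1 + w' t > 0"
    and w1: "w 1 = 0"
    and bnd: "\<And>t. t \<ge> 1 \<Longrightarrow> \<bar>w t\<bar> \<le> 2"
    and half: "\<And>t. t \<ge> 1 \<Longrightarrow> t + w t \<ge> t / 2"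
    and M: "\<And>t. t \<ge> 1 \<Longrightarrow> \<bar>w' t\<bar> \<le> M / sqrt t"
    and hol: "holder_on \<alpha> {0..1} (\<lambda>x. if x = 0 then 0 else w' (1 / x\<^sup>2))"
    and \<alpha>: "0 < \<alpha>" "\<alpha> \<le> 1"
  shows "C1_holder_diffeo_on \<alpha> {0..1} (twist w)" and "strict_mono_on {0..1} (twist w)"
proof -
  define D where "D x = 1 + x\<^sup>2 * w (1 / x\<^sup>2)" for x
  define N where "N x = 1 + (if x = 0 then 0 else w' (1 / x\<^sup>2))" for x
  define f' where "f' x = N x * (D x) powr (-3/2)" for x
  have t1: "1 / x\<^sup>2 \<ge> 1" if "x \<in> {0..1}" "x \<noteq> 0" for x :: real
    using that power_le_one[of x 2] by (simp add: divide_simps)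
  have D_half: "D x \<ge> 1/2" if x: "x \<in> {0..1}" for x
  proof (cases "x = 0")
    case False
    have "x\<^sup>2 * (1 / x\<^sup>2 + w (1 / x\<^sup>2)) \<ge> x\<^sup>2 * (1 / x\<^sup>2 / 2)"
      by (rule mult_left_mono[OF half[OF t1[OF x False]]]) simp
    then show ?thesis using False by (simp add: D_def algebra_simps)
  qed (simp add: D_def)
  have D_bnd: "\<bar>D x - 1\<bar> \<le> 2 * x\<^sup>2" if x: "x \<in> {0..1}" for x
  proof (cases "x = 0")
    case False
    then show ?thesis using mult_left_mono[OF bnd[OF t1[OF x False]], of "x\<^sup>2"]
      by (simp add: D_def abs_mult mult.commute)
  qed (simp add: D_def)
  have D_der: "(D has_real_derivative (2 * x * w (1 / x\<^sup>2) - 2 * w' (1 / x\<^sup>2) / x)) (at x)"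
    if x: "x \<in> {0..1}" "x \<noteq> 0" for x
  proof -
    have "((\<lambda>x. 1 / x\<^sup>2) has_real_derivative (- 2 / x^3)) (at x)"
      using x by (auto intro!: derivative_eq_intros simp: field_simps power2_eq_square power3_eq_cube)
    from DERIV_chain2[OF der[OF t1[OF x]] this]
    have "((\<lambda>x. w (1 / x\<^sup>2)) has_real_derivative (w' (1 / x\<^sup>2) * (- 2 / x^3))) (at x)" .
    then show ?thesis unfolding D_def
      using x by (auto intro!: derivative_eq_intros simp: field_simps power2_eq_square power3_eq_cube)
  qed
  have M0: "M \<ge> 0" using M[of 1] by simp
  have D_lip_pos: "\<bar>D x - D y\<bar> \<le> (4 + 2 * M) * \<bar>x - y\<bar>" if "x \<in> {0<..1}" "y \<in> {0<..1}" for x y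
  proof -
    have "norm (D x - D y) \<le> (4 + 2 * M) * norm (x - y)"
    proof (rule field_differentiable_bound[of "{0<..1}"])
      fix z :: real assume z: "z \<in> {0<..1}"
      then have z': "z \<in> {0..1}" "z \<noteq> 0" by auto
      show "(D has_field_derivative (2 * z * w (1 / z\<^sup>2) - 2 * w' (1 / z\<^sup>2) / z)) (at z within {0<..1})"
        using D_der[OF z'] by (rule has_field_derivative_at_within)
      have "\<bar>w' (1 / z\<^sup>2)\<bar> \<le> M * z" using M[OF t1[OF z']] z by (simp add: real_sqrt_divide)
      then have "\<bar>2 * w' (1 / z\<^sup>2) / z\<bar> \<le> 2 * M" using z by (simp add: abs_mult field_simps)
      moreover have "\<bar>2 * z * w (1 / z\<^sup>2)\<bar> \<le> 2 * 1 * 2"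
        using bnd[OF t1[OF z']] z unfolding abs_mult by (intro mult_mono) auto
      ultimately show "norm (2 * z * w (1 / z\<^sup>2) - 2 * w' (1 / z\<^sup>2) / z) \<le> 4 + 2 * M"
        unfolding real_norm_def by linarith
    qed (use that in auto)
    then show ?thesis by simp
  qed
  have D_lip0: "\<bar>D x - D 0\<bar> \<le> (4 + 2 * M) * \<bar>x - 0\<bar>" if x: "x \<in> {0..1}" for x
  proof -
    have "2 * x\<^sup>2 \<le> (4 + 2 * M) * x"
    proof -
      have "x\<^sup>2 \<le> x" using x power_decreasing[of 1 2 x] by simp
      moreover have "M * x \<ge> 0" using x M0 by simp
      ultimately show ?thesis using x by (simp add: algebra_simps)
    qed
    moreover have "D 0 = 1" by (simp add: D_def)
    ultimately show ?thesis using D_bnd[OF x] x by simp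
  qed
  have D_lip: "\<bar>D x - D y\<bar> \<le> (4 + 2 * M) * \<bar>x - y\<bar>" if "x \<in> {0..1}" "y \<in> {0..1}" for x y
    using D_lip_pos[of x y] D_lip0[of x] D_lip0[of y] that
    by (cases "x = 0"; cases "y = 0") (auto simp: abs_minus_commute)
  have hol_D: "holder_on \<alpha> {0..1} (\<lambda>x. (D x) powr (-3/2))"
  proof (rule holder_on_lipschitz[OF \<alpha>])
    fix x y :: real assume xy: "x \<in> {0..1}" "y \<in> {0..1}"
    have "\<bar>(D x) powr (-3/2) - (D y) powr (-3/2)\<bar> \<le> 12 * \<bar>D x - D y\<bar>"
      using xy by (intro powr_neg_three_halves_lipschitz D_half)
    also have "\<dots> \<le> 12 * ((4 + 2 * M) * \<bar>x - y\<bar>)" using D_lip[OF xy] by (intro mult_left_mono) auto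
    finally show "\<bar>(D x) powr (-3/2) - (D y) powr (-3/2)\<bar> \<le> (12 * (4 + 2 * M)) * \<bar>x - y\<bar>"
      by (simp only: mult.assoc)
  qed
  have hol_N: "holder_on \<alpha> {0..1} N"
    unfolding N_def by (intro holder_on_add hol) (auto simp: holder_on_def intro: exI[of _ 0])
  have N_bnd: "\<bar>N x\<bar> \<le> 1 + M" if x: "x \<in> {0..1}" for x
  proof (cases "x = 0")
    case False
    have "M / sqrt (1 / x\<^sup>2) \<le> M" using M0 x by (simp add: real_sqrt_divide mult_left_le)
    then show ?thesis using M[OF t1[OF x False]] False by (simp add: N_def)
  qed (simp add: N_def M0)
  have DD_bnd: "\<bar>(D x) powr (-3/2)\<bar> \<le> 4" if x: "x \<in> {0..1}" for x
  proof -
    have "(D x) powr (-3/2) \<le> (1/2) powr (-3/2)" using D_half[OF x] by (intro powr_mono2') auto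
    also have "\<dots> = 2 powr (3/2)" by (simp add: powr_minus_divide powr_divide)
    also have "\<dots> \<le> 2 powr 2" by (intro powr_mono) auto
    finally show ?thesis by simp
  qed
  have f'_hol: "holder_on \<alpha> {0..1} f'"
    unfolding f'_def by (rule holder_on_mult[OF hol_N hol_D N_bnd DD_bnd])
  have f'_pos: "f' x > 0" if x: "x \<in> {0..1}" for x
  proof -
    have "N x > 0" using pos[OF t1[OF x]] by (auto simp: N_def)
    then show ?thesis using D_half[OF x] by (simp add: f'_def)
  qed
  have twist_D: "twist w x = x / sqrt (D x)" for x by (simp add: twist_def D_def)
  have f'_der: "(twist w has_real_derivative f' x) (at x within {0..1})" if x: "x \<in> {0..1}" for x
  proof (cases "x = 0")
    case True
    \<comment> \<open>At 0 the difference quotient of the map is \<open>1 / sqrt (D x)\<close>, so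
      the derivative there is 1.\<close>
    have "(D \<longlongrightarrow> 1) (at 0 within {0..1})"
    proof -
      have "((\<lambda>x::real. 2 * x\<^sup>2) \<longlongrightarrow> 2 * 0\<^sup>2) (at 0 within {0..1})" by (intro tendsto_intros)
      then have lim: "((\<lambda>x::real. 2 * x\<^sup>2) \<longlongrightarrow> 0) (at 0 within {0..1})" by simp
      have ev: "eventually (\<lambda>x. norm (D x - 1) \<le> 2 * x\<^sup>2) (at 0 within {0..1})"
        unfolding eventually_at_filter using D_bnd by (intro always_eventually allI impI) simp
      from Lim_null_comparison[OF ev lim] show ?thesis by (simp add: Lim_null[of D])
    qed
    then have "((\<lambda>x. 1 / sqrt (D x)) \<longlongrightarrow> 1 / sqrt 1) (at 0 within {0..1})"
      by (intro tendsto_intros) auto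
    moreover have "eventually (\<lambda>x. 1 / sqrt (D x) = (twist w x - twist w 0) / (x - 0)) (at 0 within {0..1})"
      unfolding eventually_at_filter
      by (intro always_eventually allI impI) (simp add: twist_D)
    ultimately have "((\<lambda>x. (twist w x - twist w 0) / (x - 0)) \<longlongrightarrow> 1 / sqrt 1) (at 0 within {0..1})"
      by (rule Lim_transform_eventually)
    then show ?thesis using True by (simp add: has_field_derivative_iff f'_def N_def D_def)
  next
    case False
    define d where "d = 2 * x * w (1 / x\<^sup>2) - 2 * w' (1 / x\<^sup>2) / x"
    have Dx: "D x > 0" using D_half[OF x] by simp
    have "((\<lambda>x. x * (D x) powr (-1/2)) has_real_derivative
        (1 * (D x) powr (-1/2) + (-1/2 * (D x) powr (-1/2 - 1) * d) * x)) (at x)"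
      using D_der[OF x False] Dx unfolding d_def[symmetric]
      by (auto intro!: derivative_eq_intros DERIV_fun_powr[THEN DERIV_cong])
    also have "(1 * (D x) powr (-1/2) + (-1/2 * (D x) powr (-1/2 - 1) * d) * x)
        = (D x) powr (-3/2) * (D x - d * x / 2)"
    proof -
      have "(D x) powr (-1/2) = (D x) powr (-3/2) * D x"
        using Dx powr_add[of "D x" "-3/2" 1] by simp
      then show ?thesis by (simp add: algebra_simps)
    qed
    also have "D x - d * x / 2 = N x"
      using False by (simp add: D_def d_def N_def field_simps power2_eq_square)
    finally have "((\<lambda>x. x * (D x) powr (-1/2)) has_real_derivative f' x) (at x within {0..1})"
      by (simp add: f'_def mult.commute has_field_derivative_at_within)
    then show ?thesis
    proof (rule has_field_derivative_transform_within[OF _ zero_less_one x])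
      fix y :: real assume "y \<in> {0..1}"
      then have "D y > 0" using D_half[of y] by simp
      then show "y * (D y) powr (-1/2) = twist w y"
        by (simp add: twist_D powr_minus_divide powr_half_sqrt)
    qed
  qed
  have f01: "twist w 0 = 0" "twist w 1 = 1" using w1 by (auto simp: twist_def)
  show "C1_holder_diffeo_on \<alpha> {0..1} (twist w)" "strict_mono_on {0..1} (twist w)"
    using C1_holder_diffeo_onI[OF f01 f'_der f'_pos f'_hol \<alpha>(1)] by simp_all
qed

section \<open>Bumps supported in unit intervals\<close>

text \<open>If \<open>y\<close> lies outside the island of \<open>x\<close>, the end of the island
  between them is closer to \<open>x\<close> and is a zero of \<open>q\<close>, so the estimate on
  the island bounds \<open>q x\<close> alone. Doing this for both \<open>x\<close> and
  \<open>y\<close> costs the factor 2.\<close>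

lemma holder_on_islands:
  fixes q :: "real \<Rightarrow> real"
  assumes isl: "\<And>x. x \<in> S \<Longrightarrow> q x \<noteq> 0 \<Longrightarrow> \<exists>l u. l \<le> x \<and> x \<le> u \<and> q l = 0 \<and> q u = 0 \<and>
      (\<forall>y\<in>{l..u}. \<bar>q x - q y\<bar> \<le> C * \<bar>x - y\<bar> powr \<alpha>)"
    and "C \<ge> 0" "\<alpha> > 0"
  shows "holder_on \<alpha> S q"
proof -
  have *: "\<bar>q x\<bar> \<le> C * \<bar>x - y\<bar> powr \<alpha> \<or> \<bar>q x - q y\<bar> \<le> C * \<bar>x - y\<bar> powr \<alpha>" if x: "x \<in> S" for x y
  proof (cases "q x = 0")
    case True
    then show ?thesis using \<open>C \<ge> 0\<close> by simp
  next
    case False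
    from isl[OF x this] obtain l u where lu: "l \<le> x" "x \<le> u" "q l = 0" "q u = 0"
      "\<forall>y\<in>{l..u}. \<bar>q x - q y\<bar> \<le> C * \<bar>x - y\<bar> powr \<alpha>" by blast
    have mono: "C * \<bar>x - z\<bar> powr \<alpha> \<le> C * \<bar>x - y\<bar> powr \<alpha>" if "\<bar>x - z\<bar> \<le> \<bar>x - y\<bar>" for z
      using that \<open>C \<ge> 0\<close> \<open>\<alpha> > 0\<close> by (intro mult_left_mono powr_mono2) auto
    consider "y < l" | "y \<in> {l..u}" | "y > u" by fastforce
    then show ?thesis
    proof cases
      case 1
      have "l \<in> {l..u}" using lu by simp
      from bspec[OF lu(5) this] have "\<bar>q x\<bar> \<le> C * \<bar>x - l\<bar> powr \<alpha>" unfolding lu by simp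
      with mono[of l] 1 lu show ?thesis by simp
    next
      case 2
      then show ?thesis using lu(5) by simp
    next
      case 3
      have "u \<in> {l..u}" using lu by simp
      from bspec[OF lu(5) this] have "\<bar>q x\<bar> \<le> C * \<bar>x - u\<bar> powr \<alpha>" unfolding lu by simp
      with mono[of u] 3 lu show ?thesis by simp
    qed
  qed
  have "\<bar>q x - q y\<bar> \<le> (2 * C) * \<bar>x - y\<bar> powr \<alpha>" if "x \<in> S" "y \<in> S" for x y
  proof -
    have "C * \<bar>x - y\<bar> powr \<alpha> \<ge> 0" using \<open>C \<ge> 0\<close> by simp
    then show ?thesis using *[OF that(1), of y] *[OF that(2), of x]
      unfolding abs_minus_commute[of y x] by (auto simp: abs_minus_commute[of "q y" "q x"])
  qed
  then show ?thesis unfolding holder_on_def by blast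
qed

lemma floor_bump_has_derivative:
  fixes B B' :: "int \<Rightarrow> real \<Rightarrow> real"
  assumes der: "\<And>m t. (B m has_real_derivative B' m t) (at t)"
    and supp: "\<And>m t. \<bar>t - m - 1/2\<bar> \<ge> 1/4 \<Longrightarrow> B m t = 0"
  shows "((\<lambda>t. B \<lfloor>t\<rfloor> t) has_real_derivative B' \<lfloor>t\<rfloor> t) (at t)"
proof (cases "t = \<lfloor>t\<rfloor>")
  case False
  define m where "m = \<lfloor>t\<rfloor>"
  have t: "of_int m < t" "t < of_int m + 1"
    using False unfolding m_def by linarith+
  show ?thesis unfolding m_def[symmetric]
  proof (rule has_field_derivative_transform_within_open[OF der])
    fix s assume "s \<in> {of_int m <..< of_int m + 1 :: real}"
    then have "\<lfloor>s\<rfloor> = m" by (simp add: floor_eq_iff)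
    then show "B m s = B \<lfloor>s\<rfloor> s" by simp
  qed (use t in auto)
next
  case True
  define m where "m = \<lfloor>t\<rfloor>"
  have t: "t = of_int m" using True unfolding m_def .
  have zero: "B k s = 0" if "s \<in> {t - 1/4 <..< t + 1/4}" "k = m \<or> k = m - 1" for k s
    using that supp[of s k] unfolding t by auto
  \<comment> \<open>Near an integer the bumps on both sides vanish. Comparing the zero function with
    \<open>B m\<close> shows that its derivative there may be written \<open>B' m t\<close>, the
    value that the floor selects.\<close>
  have "((\<lambda>s. 0) has_real_derivative B' m t) (at t)"
    by (rule has_field_derivative_transform_within_open[OF der, of "{t - 1/4 <..< t + 1/4}"])
      (use zero in auto)
  then show ?thesis unfolding m_def[symmetric]
  proof (rule has_field_derivative_transform_within_open[of _ _ _ "{t - 1/4 <..< t + 1/4}"])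
    fix s assume s: "s \<in> {t - 1/4 <..< t + 1/4}"
    then have "\<lfloor>s\<rfloor> = m \<or> \<lfloor>s\<rfloor> = m - 1" unfolding t by (simp add: floor_eq_iff) linarith
    then show "0 = B \<lfloor>s\<rfloor> s" using zero[OF s] by metis
  qed auto
qed

text \<open>For \<open>t = 1 / x^2\<close> the derivative \<open>dt/dx\<close> has size
  \<open>2 * t powr (3/2)\<close>, which explains the exponent; the constant is
  \<open>2 * 4\<close>, as \<open>(m + 1) powr (3/2)\<close> is at most
  \<open>4 * m powr (3/2)\<close>.\<close>

lemma inverse_square_lipschitz:
  fixes m x y :: real
  assumes "m \<ge> 1" and "x > 0" "y > 0" "1 / x\<^sup>2 \<le> m + 1" "1 / y\<^sup>2 \<le> m + 1"
  shows "\<bar>1 / x\<^sup>2 - 1 / y\<^sup>2\<bar> \<le> 8 * m powr (3/2) * \<bar>x - y\<bar>"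
proof -
  define r where "r = sqrt (m + 1)"
  have inv: "1 / x \<le> r" "1 / y \<le> r"
    using assms real_sqrt_le_mono[of "1 / x\<^sup>2" "m + 1"] real_sqrt_le_mono[of "1 / y\<^sup>2" "m + 1"]
    unfolding r_def by (simp_all add: real_sqrt_divide)
  have cube: "r * r * r \<le> 4 * m powr (3/2)"
  proof -
    have "r * r = m + 1" using assms by (simp add: r_def)
    then have "r * r * r = (m + 1) powr (3/2)"
      using powr_add[of "m + 1" 1 "1/2"] assms by (simp add: r_def powr_half_sqrt)
    also have "\<dots> \<le> (2 * m) powr (3/2)" using assms by (intro powr_mono2) auto
    also have "\<dots> = 2 powr (3/2) * m powr (3/2)" by (rule powr_mult)
    also have "\<dots> \<le> 4 * m powr (3/2)"
    proof -
      have "(2::real) powr (3/2) \<le> 2 powr 2" by (intro powr_mono) auto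
      then show ?thesis by (intro mult_right_mono) auto
    qed
    finally show ?thesis .
  qed
  have "1 / x\<^sup>2 - 1 / y\<^sup>2 = (y - x) * ((1 / x) * (1 / x) * (1 / y) + (1 / x) * (1 / y) * (1 / y))"
    using assms by (simp add: field_simps power2_eq_square)
  then have "\<bar>1 / x\<^sup>2 - 1 / y\<^sup>2\<bar> = \<bar>x - y\<bar> * ((1 / x) * (1 / x) * (1 / y) + (1 / x) * (1 / y) * (1 / y))"
    using assms by (simp add: abs_mult abs_minus_commute)
  also have "\<dots> \<le> \<bar>x - y\<bar> * (r * r * r + r * r * r)"
    using inv assms by (intro mult_left_mono add_mono mult_mono) (auto simp: r_def)
  also have "\<dots> \<le> \<bar>x - y\<bar> * (8 * m powr (3/2))"
    using cube by (intro mult_left_mono) auto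
  finally show ?thesis by (simp add: mult.commute)
qed

text \<open>Interpolation on the support, which has width \<open>2 * \<rho> m\<close> in
  \<open>t\<close>: split \<open>\<bar>t - s\<bar>\<close> into its powers of exponents
  \<open>1 - \<alpha>\<close> and \<alpha>, bound the first by the width and the second by the
  change of coordinate. The quantity bounded by \<open>C\<close> is the resulting Hoelder constant
  of the \<open>m\<close>-th bump, up to the factor \<open>8 powr \<alpha>\<close>.\<close>

lemma floor_bump_holder:
  fixes B' :: "int \<Rightarrow> real \<Rightarrow> real" and \<rho> K :: "int \<Rightarrow> real"
  assumes \<alpha>: "0 < \<alpha>" "\<alpha> \<le> 1"
    and supp: "\<And>m t. m \<ge> 1 \<Longrightarrow> \<bar>t - m - 1/2\<bar> \<ge> \<rho> m \<Longrightarrow> B' m t = 0"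
    and \<rho>: "\<And>m. m \<ge> 1 \<Longrightarrow> 0 < \<rho> m \<and> \<rho> m \<le> 1/4"
    and lip: "\<And>m s t. m \<ge> 1 \<Longrightarrow> \<bar>B' m s - B' m t\<bar> \<le> K m * \<bar>s - t\<bar>"
    and C: "\<And>m. m \<ge> 1 \<Longrightarrow> K m * (2 * \<rho> m) powr (1 - \<alpha>) * of_int m powr (3/2 * \<alpha>) \<le> C"
    and K: "\<And>m. m \<ge> 1 \<Longrightarrow> K m \<ge> 0"
  shows "holder_on \<alpha> {0..1} (\<lambda>x. if x = 0 then 0 else B' \<lfloor>1 / x\<^sup>2\<rfloor> (1 / x\<^sup>2))"
    (is "holder_on _ _ ?q")
proof (rule holder_on_islands[where C = "8 * C"])
  have "0 \<le> K 1 * (2 * \<rho> 1) powr (1 - \<alpha>) * of_int 1 powr (3/2 * \<alpha>)" using K[of 1] by simp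
  then show "8 * C \<ge> 0" using C[of 1] by simp
  show "\<alpha> > 0" by fact
next
  fix x :: real assume x: "x \<in> {0..1}" and qx: "?q x \<noteq> 0"
  have x0: "x > 0" using qx x by (cases "x = 0") auto
  define t where "t = 1 / x\<^sup>2"
  define m where "m = \<lfloor>t\<rfloor>"
  define M :: real where "M = of_int m"
  have "t \<ge> 1" using x x0 power_le_one[of x 2] by (simp add: t_def divide_simps)
  then have m1: "m \<ge> 1" unfolding m_def by linarith
  then have M1: "M \<ge> 1" by (simp add: M_def)
  have r: "0 < \<rho> m" "\<rho> m \<le> 1/4" using \<rho>[OF m1] by auto
  have Bt: "B' m t \<noteq> 0" using qx x0 by (simp add: t_def m_def)
  then have tr: "\<bar>t - M - 1/2\<bar> < \<rho> m" using supp[OF m1] unfolding M_def by (meson not_less)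
  \<comment> \<open>The ends of the support in the coordinate \<open>x\<close>; as \<open>t\<close>
    decreases in \<open>x\<close>, the left end \<open>l\<close> comes from the upper end of the
    support.\<close>
  define l where "l = 1 / sqrt (M + 1/2 + \<rho> m)"
  define u where "u = 1 / sqrt (M + 1/2 - \<rho> m)"
  have l0: "l > 0" and u0: "u > 0" using r M1 by (simp_all add: l_def u_def)
  have l2: "1 / l\<^sup>2 = M + 1/2 + \<rho> m" and u2: "1 / u\<^sup>2 = M + 1/2 - \<rho> m"
    using r M1 by (simp_all add: l_def u_def power_divide)
  have xt: "x = 1 / sqrt t" using x0 by (simp add: t_def real_sqrt_divide)
  have lx: "l \<le> x" and xu: "x \<le> u"
    unfolding xt l_def u_def using tr r M1 \<open>t \<ge> 1\<close> by (intro divide_left_mono real_sqrt_le_mono mult_pos_pos; simp)+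
  have fl: "\<lfloor>s\<rfloor> = m" if "\<bar>s - M - 1/2\<bar> \<le> \<rho> m" for s
    using that r unfolding M_def by (simp add: floor_eq_iff) linarith
  have ql: "?q l = 0" using fl[of "1 / l\<^sup>2"] supp[OF m1, of "1 / l\<^sup>2"] r l0 unfolding l2 M_def by simp
  have qu: "?q u = 0" using fl[of "1 / u\<^sup>2"] supp[OF m1, of "1 / u\<^sup>2"] r u0 unfolding u2 M_def by simp
  have "\<bar>?q x - ?q y\<bar> \<le> 8 * C * \<bar>x - y\<bar> powr \<alpha>" if y: "y \<in> {l..u}" for y
  proof -
    define s where "s = 1 / y\<^sup>2"
    have y0: "y > 0" using y l0 by simp
    have "s \<le> 1 / l\<^sup>2" unfolding s_def using y l0 by (intro divide_left_mono power_mono) auto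
    moreover have "s \<ge> 1 / u\<^sup>2" unfolding s_def using y y0 by (intro divide_left_mono power_mono) auto
    ultimately have sr: "\<bar>s - M - 1/2\<bar> \<le> \<rho> m" unfolding l2 u2 by linarith
    then have "\<lfloor>s\<rfloor> = m" by (rule fl)
    then have "\<bar>?q x - ?q y\<bar> = \<bar>B' m t - B' m s\<bar>" using x0 y0 by (simp add: t_def m_def s_def)
    also have "\<dots> \<le> K m * \<bar>t - s\<bar>" by (rule lip[OF m1])
    finally have 1: "\<bar>?q x - ?q y\<bar> \<le> K m * \<bar>t - s\<bar>" .
    have "\<bar>t - s\<bar> = \<bar>t - s\<bar> powr (1 - \<alpha>) * \<bar>t - s\<bar> powr \<alpha>" by (simp flip: powr_add)
    also have "\<dots> \<le> (2 * \<rho> m) powr (1 - \<alpha>) * (8 * M powr (3/2) * \<bar>x - y\<bar>) powr \<alpha>"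
    proof (rule mult_mono)
      have "\<bar>t - s\<bar> \<le> 2 * \<rho> m" using tr sr by linarith
      then show "\<bar>t - s\<bar> powr (1 - \<alpha>) \<le> (2 * \<rho> m) powr (1 - \<alpha>)" using \<alpha> by (intro powr_mono2) auto
      have "\<bar>t - s\<bar> \<le> 8 * M powr (3/2) * \<bar>x - y\<bar>" unfolding t_def s_def
        using M1 x0 y0 tr sr r by (intro inverse_square_lipschitz) (auto simp flip: t_def s_def)
      then show "\<bar>t - s\<bar> powr \<alpha> \<le> (8 * M powr (3/2) * \<bar>x - y\<bar>) powr \<alpha>" using \<alpha> by (intro powr_mono2) auto
    qed auto
    also have "(8 * M powr (3/2) * \<bar>x - y\<bar>) powr \<alpha> = 8 powr \<alpha> * M powr (3/2 * \<alpha>) * \<bar>x - y\<bar> powr \<alpha>"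
      by (simp add: powr_mult powr_powr)
    finally have "K m * \<bar>t - s\<bar>
        \<le> K m * ((2 * \<rho> m) powr (1 - \<alpha>) * (8 powr \<alpha> * M powr (3/2 * \<alpha>) * \<bar>x - y\<bar> powr \<alpha>))"
      by (rule mult_left_mono[OF _ K[OF m1]])
    also have "K m * ((2 * \<rho> m) powr (1 - \<alpha>) * (8 powr \<alpha> * M powr (3/2 * \<alpha>) * \<bar>x - y\<bar> powr \<alpha>))
        = (K m * (2 * \<rho> m) powr (1 - \<alpha>) * M powr (3/2 * \<alpha>)) * (8 powr \<alpha> * \<bar>x - y\<bar> powr \<alpha>)"
      by (simp add: algebra_simps)
    also have "\<dots> \<le> C * (8 * \<bar>x - y\<bar> powr \<alpha>)"
    proof (intro mult_mono)
      show "K m * (2 * \<rho> m) powr (1 - \<alpha>) * M powr (3/2 * \<alpha>) \<le> C" unfolding M_def by (rule C[OF m1])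
      then show "0 \<le> C" using K[OF m1] by (meson mult_nonneg_nonneg order_trans powr_ge_zero)
      show "(8::real) powr \<alpha> \<le> 8" using powr_mono[OF \<alpha>(2), of 8] by simp
    qed auto
    also have "\<dots> = 8 * C * \<bar>x - y\<bar> powr \<alpha>" by simp
    finally show ?thesis using 1 by (rule order_trans[rotated])
  qed
  then show "\<exists>l u. l \<le> x \<and> x \<le> u \<and> ?q l = 0 \<and> ?q u = 0 \<and>
      (\<forall>y\<in>{l..u}. \<bar>?q x - ?q y\<bar> \<le> 8 * C * \<bar>x - y\<bar> powr \<alpha>)"
    using lx xu ql qu by blast
qed

section \<open>Profiles of the bumps\<close>

text \<open>Truncated squares are \<open>C^1\<close> with a Lipschitz derivative, the regularity
  that \<open>floor_bump_holder\<close> asks of bumps; the two profiles and the correction of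
  \<open>f\<close> near \<open>t = 1\<close> are built from them.\<close>

lemma has_real_derivative_max_square:
  assumes "(h has_real_derivative D) (at x)"
  shows "((\<lambda>x. (max 0 (h x))\<^sup>2) has_real_derivative (2 * max 0 (h x) * D)) (at x)"
proof -
  have "((\<lambda>y::real. (max 0 y)\<^sup>2) has_real_derivative 2 * max 0 y) (at y)" for y
  proof -
    consider "y < 0" | "y = 0" | "y > 0" by linarith
    then show ?thesis
    proof cases
      case 1
      have "((\<lambda>y::real. 0) has_real_derivative 2 * max 0 y) (at y)" using 1 by simp
      then show ?thesis
        by (rule has_field_derivative_transform_within_open[of _ _ _ "{..<0}"]) (use 1 in auto)
    next
      case 2
      have "((\<lambda>y::real. max 0 y) \<longlongrightarrow> max 0 0) (at 0)" by (intro tendsto_intros)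
      then have "((\<lambda>y::real. max 0 y) \<longlongrightarrow> 0) (at 0)" by simp
      moreover have "eventually (\<lambda>y::real. max 0 y = ((max 0 y)\<^sup>2 - (max 0 0)\<^sup>2) / (y - 0)) (at 0)"
        unfolding eventually_at_filter
        by (intro always_eventually allI impI) (simp add: max_def power2_eq_square)
      ultimately show ?thesis unfolding 2 has_field_derivative_iff
        using Lim_transform_eventually by fastforce
    next
      case 3
      have "((\<lambda>y::real. y\<^sup>2) has_real_derivative 2 * max 0 y) (at y)"
        using 3 by (auto intro!: derivative_eq_intros)
      then show ?thesis
        by (rule has_field_derivative_transform_within_open[of _ _ _ "{0<..}"]) (use 3 in auto)
    qed
  qed
  from DERIV_chain2[OF this assms] show ?thesis .
qed

text \<open>It is positive on all of \<open>]-1, 1[\<close>, so that a multiple of it as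
  displacement leaves no fixed point inside its support.\<close>

definition hump :: "real \<Rightarrow> real" where
  "hump s = (max 0 (1 - s\<^sup>2))\<^sup>2"

definition hump' :: "real \<Rightarrow> real" where
  "hump' s = - 4 * s * max 0 (1 - s\<^sup>2)"

lemma hump_has_derivative: "(hump has_real_derivative hump' s) (at s)"
proof -
  have "((\<lambda>s. 1 - s\<^sup>2) has_real_derivative (- 2 * s)) (at s)" by (auto intro!: derivative_eq_intros)
  from has_real_derivative_max_square[OF this] show ?thesis
    unfolding hump_def[abs_def] hump'_def by (rule DERIV_cong) simp
qed

lemma square_ge_one: "\<bar>s\<bar> \<ge> 1 \<Longrightarrow> s\<^sup>2 \<ge> 1" for s :: real
  using power_mono[of 1 "\<bar>s\<bar>" 2] by simp

lemma hump_eq_0: "\<bar>s\<bar> \<ge> 1 \<Longrightarrow> hump s = 0" "\<bar>s\<bar> \<ge> 1 \<Longrightarrow> hump' s = 0"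
  using square_ge_one[of s] by (simp_all add: hump_def hump'_def)

lemma hump_pos: "\<bar>s\<bar> < 1 \<Longrightarrow> hump s > 0"
  using abs_square_less_1[of s] by (simp add: hump_def max_def)

lemma hump_le_1: "hump s \<le> 1" "hump s \<ge> 0"
proof -
  have "max 0 (1 - s\<^sup>2) \<le> 1" by simp
  then show "hump s \<le> 1" unfolding hump_def by (intro power_le_one) auto
qed (simp add: hump_def)

text \<open>Clamping \<open>s\<close> to \<open>[-1, 1]\<close> turns the truncated formula into a
  single polynomial, on which both estimates below can be read off.\<close>

lemma hump'_clamp: "hump' s = - 4 * (c * (1 - c\<^sup>2))" if "c = max (-1) (min 1 s)" for c
proof (cases "\<bar>s\<bar> \<ge> 1")
  case True
  then have "c = 1 \<or> c = -1" unfolding that by (auto simp: max_def min_def)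
  then show ?thesis using hump_eq_0(2)[OF True] by auto
next
  case False
  then have "c = s" unfolding that by (auto simp: max_def min_def)
  moreover have "s\<^sup>2 < 1" using False by (simp add: abs_square_less_1)
  ultimately show ?thesis by (simp add: hump'_def max_def)
qed

lemma hump'_bound: "\<bar>hump' s\<bar> \<le> 4"
proof -
  define c where "c = max (-1) (min 1 s)"
  have c: "\<bar>c\<bar> \<le> 1" by (simp add: c_def abs_le_iff)
  then have "c\<^sup>2 \<le> 1" by (simp add: abs_square_le_1)
  then have "\<bar>c\<bar> * \<bar>1 - c\<^sup>2\<bar> \<le> 1 * 1" using c by (intro mult_mono) auto
  then show ?thesis by (simp add: hump'_clamp[OF c_def] abs_mult)
qed

text \<open>Clamping is a contraction, and \<open>c - c^3\<close> has divided difference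
  \<open>1 - (c^2 + c * d + d^2)\<close>, which lies between -2 and 1 on the clamped range.\<close>

lemma hump'_lipschitz: "\<bar>hump' s - hump' t\<bar> \<le> 8 * \<bar>s - t\<bar>"
proof -
  define c where "c = max (-1) (min 1 s)"
  define d where "d = max (-1) (min 1 t)"
  have c: "\<bar>c\<bar> \<le> 1" and d: "\<bar>d\<bar> \<le> 1" by (simp_all add: c_def d_def abs_le_iff)
  then have "c\<^sup>2 \<le> 1" "d\<^sup>2 \<le> 1" by (simp_all add: abs_square_le_1)
  moreover have "\<bar>c * d\<bar> \<le> 1" using c d mult_mono[of "\<bar>c\<bar>" 1 "\<bar>d\<bar>" 1] by (simp add: abs_mult)
  moreover have "c\<^sup>2 + c * d + d\<^sup>2 = (c + d / 2)\<^sup>2 + 3 / 4 * d\<^sup>2"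
    by (simp add: power2_eq_square field_simps)
  then have "c\<^sup>2 + c * d + d\<^sup>2 \<ge> 0" by simp
  ultimately have b: "\<bar>1 - (c\<^sup>2 + c * d + d\<^sup>2)\<bar> \<le> 2" by linarith
  have cd: "\<bar>c - d\<bar> \<le> \<bar>s - t\<bar>" unfolding c_def d_def by linarith
  have "hump' s - hump' t = - 4 * ((c - d) * (1 - (c\<^sup>2 + c * d + d\<^sup>2)))"
    unfolding hump'_clamp[OF c_def] hump'_clamp[OF d_def]
    by (simp add: algebra_simps power2_eq_square)
  then have "\<bar>hump' s - hump' t\<bar> = 4 * (\<bar>c - d\<bar> * \<bar>1 - (c\<^sup>2 + c * d + d\<^sup>2)\<bar>)"
    by (simp add: abs_mult)
  also have "\<dots> \<le> 4 * (\<bar>s - t\<bar> * 2)"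
    using b cd by (intro mult_left_mono mult_mono) simp_all
  finally show ?thesis by simp
qed

text \<open>The derivative is piecewise linear with value \<open>1\<close> on \<open>[-1, 1]\<close>, \<open>- 1\<close> at \<open>\<plusminus> 3\<close> and \<open>0\<close> beyond \<open>\<plusminus> 5\<close>, chosen
  so that its integral over \<open>[0, 5]\<close> vanishes. Being exactly linear near \<open>0\<close>, a kink expands
  intervals around \<open>0\<close> by a constant factor.\<close>

definition kink :: "real \<Rightarrow> real" where
  "kink s = s - (max 0 (s - 1))\<^sup>2 / 2 + 3 * (max 0 (s - 3))\<^sup>2 / 4 - (max 0 (s - 5))\<^sup>2 / 4
     + (max 0 (- s - 1))\<^sup>2 / 2 - 3 * (max 0 (- s - 3))\<^sup>2 / 4 + (max 0 (- s - 5))\<^sup>2 / 4"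

definition kink' :: "real \<Rightarrow> real" where
  "kink' s = 1 - max 0 (s - 1) + 3 * max 0 (s - 3) / 2 - max 0 (s - 5) / 2
     - max 0 (- s - 1) + 3 * max 0 (- s - 3) / 2 - max 0 (- s - 5) / 2"

lemma kink_has_derivative: "(kink has_real_derivative kink' s) (at s)"
proof -
  define P where "P y = (max 0 y)\<^sup>2" for y :: real
  have 1: "((\<lambda>s. P (s - c)) has_real_derivative 2 * max 0 (s - c)) (at s)" for c
  proof -
    have "((\<lambda>s. s - c) has_real_derivative 1) (at s)" by (auto intro!: derivative_eq_intros)
    from has_real_derivative_max_square[OF this] show ?thesis by (simp add: P_def)
  qed
  have 2: "((\<lambda>s. P (- s - c)) has_real_derivative - 2 * max 0 (- s - c)) (at s)" for c
  proof -
    have "((\<lambda>s. - s - c) has_real_derivative -1) (at s)" by (auto intro!: derivative_eq_intros)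
    from has_real_derivative_max_square[OF this] show ?thesis by (simp add: P_def)
  qed
  show ?thesis unfolding kink_def[abs_def] kink'_def P_def[symmetric]
    by (auto intro!: derivative_eq_intros 1 2 simp: field_simps)
qed

lemma kink_eq_0: "\<bar>s\<bar> \<ge> 5 \<Longrightarrow> kink s = 0" "\<bar>s\<bar> \<ge> 5 \<Longrightarrow> kink' s = 0"
  by (auto simp: kink_def kink'_def max_def power2_eq_square abs_if field_simps split: if_splits)

lemma kink_linear: "\<bar>s\<bar> \<le> 1 \<Longrightarrow> kink s = s"
  by (auto simp: kink_def max_def)

lemma kink'_bound: "\<bar>kink' s\<bar> \<le> 1"
  by (auto simp: kink'_def max_def abs_le_iff field_simps)

lemma kink_bound: "\<bar>kink s\<bar> \<le> 5"
proof (cases "\<bar>s\<bar> \<ge> 5")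
  case False
  have "norm (kink s - kink 0) \<le> 1 * norm (s - 0)"
    by (rule field_differentiable_bound[of UNIV]) (auto intro: kink_has_derivative kink'_bound)
  then show ?thesis using False kink_linear[of 0] by simp
qed (simp add: kink_eq_0)

text \<open>Each truncation is 1-Lipschitz, and the absolute values of the coefficients add up to
  \<open>2 * (1 + 3/2 + 1/2) = 6\<close>.\<close>

lemma kink'_lipschitz: "\<bar>kink' s - kink' t\<bar> \<le> 6 * \<bar>s - t\<bar>"
proof -
  define h where "h y = max 0 y" for y :: real
  define d where "d = \<bar>s - t\<bar>"
  have "\<bar>h (s - c) - h (t - c)\<bar> \<le> d" "\<bar>h (- s - c) - h (- t - c)\<bar> \<le> d" for c :: real
    unfolding h_def d_def by linarith+
  note * = this[THEN abs_le_D1] this[THEN abs_le_D2]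
  have "s - t \<le> d" "t - s \<le> d" by (simp_all add: d_def)
  show ?thesis unfolding kink'_def h_def[symmetric] d_def[symmetric]
    using *(1)[of 1] *(1)[of 3] *(1)[of 5] *(2)[of 1] *(2)[of 3] *(2)[of 5]
      *(3)[of 1] *(3)[of 3] *(3)[of 5] *(4)[of 1] *(4)[of 3] *(4)[of 5]
    by (intro abs_leI) linarith+
qed

section \<open>The map \<open>f\<close>\<close>

definition amp :: "int \<Rightarrow> real" where
  "amp m = of_int m powr (-15/16) / 2"

text \<open>The scale 20 shrinks the support \<open>[-5, 5]\<close> of \<open>kink\<close> to
  distance 1/4 from the midpoint and its linear part to distance 1/20. The value 5 is the least
  \<open>m\<close> met on the way from level 2 to level 1, and it keeps the bumps clear of the
  quadratic term of \<open>f_disp\<close>, which lives on \<open>t < 4\<close>.\<close>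

definition f_bump :: "int \<Rightarrow> real \<Rightarrow> real" where
  "f_bump m t = (if m \<ge> 5 then amp m * kink (20 * (t - m - 1/2)) / 20 else 0)"

definition f_bump' :: "int \<Rightarrow> real \<Rightarrow> real" where
  "f_bump' m t = (if m \<ge> 5 then amp m * kink' (20 * (t - m - 1/2)) else 0)"

text \<open>The quadratic term makes \<open>t \<mapsto> t + f_disp t\<close> fix \<open>t = 1\<close>, that is \<open>x = 1\<close>, with multiplier \<open>1/3\<close>.\<close>

definition f_disp :: "real \<Rightarrow> real" where
  "f_disp t = - 1 + (max 0 (4 - t))\<^sup>2 / 9 + f_bump \<lfloor>t\<rfloor> t"

definition f_disp' :: "real \<Rightarrow> real" where
  "f_disp' t = - 2 / 9 * max 0 (4 - t) + f_bump' \<lfloor>t\<rfloor> t"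

definition f_map :: "real \<Rightarrow> real" where
  "f_map = twist f_disp"

definition f_shift :: "real \<Rightarrow> real" where
  "f_shift t = t + f_disp t"

lemma amp_nonneg: "amp m \<ge> 0" by (simp add: amp_def)

lemma amp_le: "m \<ge> 1 \<Longrightarrow> amp m \<le> 1/2"
  using powr_mono[of "-15/16" 0 "of_int m :: real"] by (simp add: amp_def)

lemma f_bump_has_derivative: "(f_bump m has_real_derivative f_bump' m t) (at t)"
proof (cases "m \<ge> 5")
  case True
  have "((\<lambda>t. 20 * (t - m - 1/2)) has_real_derivative 20) (at t)"
    by (auto intro!: derivative_eq_intros)
  from DERIV_chain2[OF kink_has_derivative this]
  have "((\<lambda>t. amp m * kink (20 * (t - m - 1/2)) / 20) has_real_derivative
      amp m * (kink' (20 * (t - m - 1/2)) * 20) / 20) (at t)"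
    by (intro DERIV_cmult DERIV_cdivide)
  with True show ?thesis by (simp add: f_bump_def[abs_def] f_bump'_def)
next
  case False
  then show ?thesis by (simp add: f_bump_def[abs_def] f_bump'_def)
qed

lemma f_bump_eq_0:
  assumes "\<bar>t - m - 1/2\<bar> \<ge> 1/4"
  shows "f_bump m t = 0" "f_bump' m t = 0"
proof -
  have "\<bar>20 * (t - m - 1/2)\<bar> \<ge> 5" using assms unfolding abs_mult by simp
  then show "f_bump m t = 0" "f_bump' m t = 0"
    by (simp_all add: f_bump_def f_bump'_def kink_eq_0)
qed

lemma f_bump_bound: "\<bar>f_bump m t\<bar> \<le> 1/8"
proof (cases "m \<ge> 5")
  case True
  then have "\<bar>amp m\<bar> * \<bar>kink (20 * (t - m - 1/2))\<bar> \<le> 1/2 * 5"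
    using amp_le[of m] amp_nonneg[of m] by (intro mult_mono kink_bound) auto
  then show ?thesis using True by (simp add: f_bump_def abs_mult)
qed (simp add: f_bump_def)

lemma f_bump'_bound: "m \<ge> 5 \<Longrightarrow> \<bar>f_bump' m t\<bar> \<le> amp m"
  using mult_left_mono[OF kink'_bound amp_nonneg, of m] amp_nonneg[of m]
  by (simp add: f_bump'_def abs_mult)

lemma f_bump_small: "m < 5 \<Longrightarrow> f_bump m t = 0" "m < 5 \<Longrightarrow> f_bump' m t = 0"
  by (simp_all add: f_bump_def f_bump'_def)

lemma f_bump'_lipschitz: "\<bar>f_bump' m s - f_bump' m t\<bar> \<le> (120 * amp m) * \<bar>s - t\<bar>"
proof (cases "m \<ge> 5")
  case True
  have "\<bar>f_bump' m s - f_bump' m t\<bar> = amp m * \<bar>kink' (20 * (s - m - 1/2)) - kink' (20 * (t - m - 1/2))\<bar>"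
    using True amp_nonneg[of m] unfolding f_bump'_def by (simp only: if_True right_diff_distrib[symmetric] abs_mult abs_of_nonneg)
  also have "\<dots> \<le> amp m * (6 * \<bar>20 * (s - m - 1/2) - 20 * (t - m - 1/2)\<bar>)"
    by (intro mult_left_mono kink'_lipschitz amp_nonneg)
  also have "20 * (s - m - 1/2) - 20 * (t - m - 1/2) = 20 * (s - t)" by simp
  also have "\<bar>20 * (s - t)\<bar> = 20 * \<bar>s - t\<bar>" by (simp only: abs_mult abs_numeral)
  finally show ?thesis by simp
qed (simp add: f_bump'_def amp_nonneg)

text \<open>As \<open>3/2 * 5/8 = 15/16\<close>, the amplitude cancels the distortion of the
  coordinate exactly, leaving \<open>120 * 1/2 = 60\<close>.\<close>

lemma f_bump'_holder:
  "holder_on (5/8) {0..1} (\<lambda>x. if x = 0 then 0 else f_bump' \<lfloor>1 / x\<^sup>2\<rfloor> (1 / x\<^sup>2))"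
proof (rule floor_bump_holder[where \<rho> = "\<lambda>_. 1/4" and K = "\<lambda>m. 120 * amp m" and C = 60])
  fix m :: int assume m: "m \<ge> 1"
  have "(2 * (1/4) :: real) powr (1 - 5/8) \<le> 1" by (intro powr_le1) auto
  moreover have "amp m * of_int m powr (3/2 * (5/8)) = 1/2"
    using m by (simp add: amp_def powr_minus field_simps)
  ultimately have "(2 * (1/4) :: real) powr (1 - 5/8) * (amp m * of_int m powr (3/2 * (5/8))) \<le> 1 * (1/2)"
    by (intro mult_mono) auto
  then show "120 * amp m * (2 * (1/4)) powr (1 - 5/8) * of_int m powr (3/2 * (5/8)) \<le> 60"
    by (simp add: mult_ac)
qed (use f_bump_eq_0 f_bump'_lipschitz amp_nonneg in auto)

text \<open>The term vanishes for \<open>t \<ge> 4\<close>, that is for \<open>x \<le> 1/2\<close>.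
  Clamping \<open>x\<close> from below at 1/2 therefore replaces the truncation and keeps
  \<open>1 / x^2\<close> away from its pole.\<close>

lemma cap_holder:
  "holder_on (5/8) {0..1} (\<lambda>x::real. if x = 0 then 0 else - 2 / 9 * max 0 (4 - 1 / x\<^sup>2))"
proof (rule holder_on_lipschitz)
  fix x y :: real assume xy: "x \<in> {0..1}" "y \<in> {0..1}"
  define c :: "real \<Rightarrow> real" where "c x = max (1/2) x" for x
  have *: "(if z = 0 then 0 else - 2 / 9 * max 0 (4 - 1 / z\<^sup>2)) = - 2 / 9 * (4 - 1 / (c z)\<^sup>2)"
    if z: "z \<in> {0..1}" for z :: real
  proof (cases "z \<le> 1/2")
    case True
    have "1 / z\<^sup>2 \<ge> 4" if "z \<noteq> 0"
    proof -
      have "z\<^sup>2 \<le> (1/2)\<^sup>2" using z True by (intro power_mono) auto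
      then show ?thesis using that z by (simp add: pos_le_divide_eq power_divide)
    qed
    then have "max 0 (4 - 1 / z\<^sup>2) = 0" if "z \<noteq> 0" using that by (intro max_absorb1) simp
    moreover have "1 / (c z)\<^sup>2 = 4" using True by (simp add: c_def power_divide)
    ultimately show ?thesis by simp
  next
    case False
    then have "z\<^sup>2 \<ge> (1/2)\<^sup>2" using z by (intro power_mono) auto
    then have "1 / z\<^sup>2 \<le> 4" using False by (simp add: pos_divide_le_eq power_divide)
    then have "max 0 (4 - 1 / z\<^sup>2) = 4 - 1 / z\<^sup>2" by (intro max_absorb2) simp
    moreover have "c z = z" "z \<noteq> 0" using False by (auto simp: c_def)
    ultimately show ?thesis by simp
  qed
  have c: "1 / (c z)\<^sup>2 \<le> 3 + 1" for z
  proof -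
    have "(c z)\<^sup>2 \<ge> (1/2)\<^sup>2" by (intro power_mono) (auto simp: c_def)
    moreover have "(c z)\<^sup>2 > 0" by (auto simp: c_def max_def)
    ultimately show ?thesis by (simp add: pos_divide_le_eq power_divide)
  qed
  have c0: "c z > 0" for z by (auto simp: c_def max_def)
  have "\<bar>1 / (c x)\<^sup>2 - 1 / (c y)\<^sup>2\<bar> \<le> 8 * 3 powr (3/2) * \<bar>c x - c y\<bar>"
    by (rule inverse_square_lipschitz[of 3]) (use c c0 in auto)
  also have "\<dots> \<le> 8 * 3 powr (3/2) * \<bar>x - y\<bar>"
  proof -
    have "\<bar>c x - c y\<bar> \<le> \<bar>x - y\<bar>" unfolding c_def by linarith
    then show ?thesis by (intro mult_left_mono) auto
  qed
  finally have lip: "\<bar>1 / (c x)\<^sup>2 - 1 / (c y)\<^sup>2\<bar> \<le> 8 * 3 powr (3/2) * \<bar>x - y\<bar>" .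
  show "\<bar>(if x = 0 then 0 else - 2 / 9 * max 0 (4 - 1 / x\<^sup>2)) - (if y = 0 then 0 else - 2 / 9 * max 0 (4 - 1 / y\<^sup>2))\<bar>
      \<le> 8 * 3 powr (3/2) * \<bar>x - y\<bar>"
  proof -
    define p q where "p = 1 / (c x)\<^sup>2" and "q = 1 / (c y)\<^sup>2"
    have "- 2 / 9 * (4 - p) - - 2 / 9 * (4 - q) = 2 / 9 * (p - q)" by (simp add: field_simps)
    then have "\<bar>- 2 / 9 * (4 - p) - - 2 / 9 * (4 - q)\<bar> \<le> \<bar>p - q\<bar>" by (simp only: abs_mult) simp
    then show ?thesis using lip unfolding *[OF xy(1)] *[OF xy(2)] p_def q_def by (rule order_trans)
  qed
qed auto

lemma f_disp_has_derivative: "(f_disp has_real_derivative f_disp' t) (at t)"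
proof -
  have "((\<lambda>t. 4 - t) has_real_derivative -1) (at t)" by (auto intro!: derivative_eq_intros)
  from has_real_derivative_max_square[OF this]
  have 1: "((\<lambda>t. (max 0 (4 - t))\<^sup>2 / 9) has_real_derivative (2 * max 0 (4 - t) * -1) / 9) (at t)"
    by (rule DERIV_cdivide)
  have 2: "((\<lambda>t. f_bump \<lfloor>t\<rfloor> t) has_real_derivative f_bump' \<lfloor>t\<rfloor> t) (at t)"
    by (rule floor_bump_has_derivative[OF f_bump_has_derivative f_bump_eq_0(1)])
  have "(f_disp has_real_derivative (0 + (2 * max 0 (4 - t) * -1) / 9 + f_bump' \<lfloor>t\<rfloor> t)) (at t)"
    unfolding f_disp_def[abs_def] by (intro DERIV_add 1 2 DERIV_const)
  then show ?thesis by (simp add: f_disp'_def)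
qed

lemma f_disp_le_4: "t \<le> 4 \<Longrightarrow> f_disp t = - 1 + (4 - t)\<^sup>2 / 9"
  and f_disp_ge_4: "t \<ge> 4 \<Longrightarrow> f_disp t = - 1 + f_bump \<lfloor>t\<rfloor> t"
proof -
  assume "t \<le> 4"
  moreover from this have "\<lfloor>t\<rfloor> < 5" by linarith
  ultimately show "f_disp t = - 1 + (4 - t)\<^sup>2 / 9" by (simp add: f_disp_def f_bump_small)
qed (simp add: f_disp_def)

lemma f_disp'_cases:
  assumes "t \<ge> 1"
  shows "\<bar>f_disp' t\<bar> \<le> 2 / sqrt t" "f_disp' t \<ge> - 2/3"
proof -
  have "\<bar>f_disp' t\<bar> \<le> 2 / sqrt t \<and> f_disp' t \<ge> - 2/3"
  proof (cases "t < 5")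
    case True
    then have "\<lfloor>t\<rfloor> < 5" by linarith
    then have d: "f_disp' t = - 2/9 * max 0 (4 - t)" by (simp add: f_disp'_def f_bump_small)
    have "sqrt t \<le> sqrt 9" using True by (intro real_sqrt_le_mono) auto
    then have "sqrt t \<le> 3" by simp
    moreover have "sqrt t \<ge> 1" using assms by simp
    ultimately have "2 / sqrt t \<ge> 2/3" by (simp add: field_simps)
    moreover define p where "p = max 0 (4 - t)"
    have "0 \<le> p" "p \<le> 3" using assms by (auto simp: p_def)
    ultimately show ?thesis unfolding d p_def[symmetric] by (simp add: abs_mult)
  next
    case False
    define m where "m = \<lfloor>t\<rfloor>"
    have m: "m \<ge> 5" using False unfolding m_def by linarith
    have mt: "t \<le> 4 * of_int m" using m unfolding m_def by linarith
    have d: "f_disp' t = f_bump' m t" using False by (simp add: f_disp'_def m_def)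
    have b: "\<bar>f_disp' t\<bar> \<le> amp m" unfolding d by (rule f_bump'_bound[OF m])
    \<comment> \<open>The amplitude decays faster than \<open>1 / sqrt t\<close> because 15/16
      exceeds 1/2.\<close>
    have "of_int m powr (-15/16) \<le> of_int m powr (-1/2 :: real)" using m by (intro powr_mono) auto
    also have "\<dots> = 1 / sqrt (of_int m)" using m by (simp add: powr_minus_divide powr_half_sqrt)
    also have "\<dots> = 2 / sqrt (4 * of_int m)" by (simp add: real_sqrt_mult)
    also have "\<dots> \<le> 2 / sqrt t" using mt assms m by (intro divide_left_mono) auto
    finally have "amp m \<le> 2 / sqrt t" unfolding amp_def using assms by (simp add: field_simps) 
    with b amp_le[of m] m show ?thesis by auto
  qed
  then show "\<bar>f_disp' t\<bar> \<le> 2 / sqrt t" "f_disp' t \<ge> - 2/3" by auto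
qed

lemma f_disp_bounds:
  assumes "t \<ge> 1"
  shows "\<bar>f_disp t\<bar> \<le> 2" "t + f_disp t \<ge> t / 2"
proof -
  have "\<bar>f_disp t\<bar> \<le> 2 \<and> t + f_disp t \<ge> t / 2"
  proof (cases "t \<le> 4")
    case True
    have "(4 - t)\<^sup>2 \<le> 3\<^sup>2" using assms True by (intro power_mono) auto
    moreover have "t / 2 - 1 + (4 - t)\<^sup>2 / 9 = (t - 7/4)\<^sup>2 / 9 + 7/16"
      by (simp add: power2_eq_square field_simps)
    then have "t / 2 - 1 + (4 - t)\<^sup>2 / 9 \<ge> 0" by simp
    ultimately show ?thesis using f_disp_le_4[OF True] zero_le_power2[of "4 - t"]
      unfolding power2_eq_square[of 3] by (intro conjI abs_leI) linarith+
  next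
    case False
    then show ?thesis using f_disp_ge_4[of t] f_bump_bound[of "\<lfloor>t\<rfloor>" t] by auto
  qed
  then show "\<bar>f_disp t\<bar> \<le> 2" "t + f_disp t \<ge> t / 2" by auto
qed

lemma f_map_diffeo:
  "C1_holder_diffeo_on (5/8) {0..1} f_map" "strict_mono_on {0..1} f_map"
proof -
  have "holder_on (5/8) {0..1} (\<lambda>x. (if x = 0 then 0 else - 2 / 9 * max 0 (4 - 1 / x\<^sup>2)) +
      (if x = 0 then 0 else f_bump' \<lfloor>1 / x\<^sup>2\<rfloor> (1 / x\<^sup>2)))"
    by (intro holder_on_add cap_holder f_bump'_holder)
  also have "(\<lambda>x::real. (if x = 0 then 0 else - 2 / 9 * max 0 (4 - 1 / x\<^sup>2)) +
      (if x = 0 then 0 else f_bump' \<lfloor>1 / x\<^sup>2\<rfloor> (1 / x\<^sup>2))) = (\<lambda>x. if x = 0 then 0 else f_disp' (1 / x\<^sup>2))"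
    by (auto simp: f_disp'_def)
  finally have hol: "holder_on (5/8) {0..1} (\<lambda>x. if x = 0 then 0 else f_disp' (1 / x\<^sup>2))" .
  have pos: "1 + f_disp' t > 0" if "t \<ge> 1" for t using f_disp'_cases(2)[OF that] by linarith
  have one: "f_disp 1 = 0" by (simp add: f_disp_le_4)
  show "C1_holder_diffeo_on (5/8) {0..1} f_map" "strict_mono_on {0..1} f_map" unfolding f_map_def
    using twist_diffeo[of f_disp f_disp' 2 "5/8", OF f_disp_has_derivative pos one f_disp_bounds
        f_disp'_cases(1) hol] by simp_all
qed

lemma f_shift_int: "m \<ge> 4 \<Longrightarrow> f_shift (of_int m) = of_int m - 1"
  by (simp add: f_shift_def f_disp_ge_4 f_bump_eq_0)

text \<open>On the linear part of the kink the map is affine and carries midpoint to midpoint, so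
  under iteration the slopes simply multiply, without distortion.\<close>

lemma f_shift_middle:
  assumes "m \<ge> 5" "\<bar>s\<bar> \<le> 1/20"
  shows "f_shift (of_int m + 1/2 + s) = of_int (m - 1) + 1/2 + (1 + amp m) * s"
proof -
  have fl: "\<lfloor>of_int m + 1/2 + s\<rfloor> = m" using assms(2) by (simp add: floor_eq_iff) linarith
  have "of_int m + 1/2 + s \<ge> 4" using assms by linarith
  then have "f_disp (of_int m + 1/2 + s) = - 1 + f_bump m (of_int m + 1/2 + s)"
    by (simp only: f_disp_ge_4 fl)
  also have "f_bump m (of_int m + 1/2 + s) = amp m * kink (20 * s) / 20"
    using assms(1) by (simp add: f_bump_def)
  also have "kink (20 * s) = 20 * s" using assms(2) by (intro kink_linear) (simp add: abs_mult)
  finally show ?thesis by (simp add: f_shift_def algebra_simps)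
qed

text \<open>The displacement is quadratic here and \<open>f_shift t - 1\<close> factors as
  \<open>(t - 1) * (t + 2) / 9\<close>; the rate 5/9 is the value of the second factor at
  \<open>t = 3\<close>. It gives the convergence of \<open>a_n\<close> to 1.\<close>

lemma f_shift_near_1:
  assumes "1 < t" "t \<le> 3"
  shows "1 < f_shift t" "f_shift t < t" "f_shift t - 1 \<le> 5/9 * (t - 1)"
proof -
  have e: "f_shift t - 1 = (t - 1) * ((t + 2) / 9)"
    using assms by (simp add: f_shift_def f_disp_le_4 power2_eq_square field_simps)
  have "(t - 1) * ((t + 2) / 9) > 0" using assms by simp
  then show "1 < f_shift t" using e by linarith
  have "(t - 1) * ((t + 2) / 9) \<le> (t - 1) * (5/9)" using assms by (intro mult_left_mono) auto
  then show *: "f_shift t - 1 \<le> 5/9 * (t - 1)" using e by linarith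
  have "5/9 * (t - 1) < t - 1" using assms by simp
  with * show "f_shift t < t" by linarith
qed

lemma f_map_coord: "t > 0 \<Longrightarrow> f_map (1 / sqrt t) = 1 / sqrt (f_shift t)"
  by (simp add: f_map_def f_shift_def twist_coord)

section \<open>Radii of the nested intervals\<close>

text \<open>The slope, in the coordinate \<open>t\<close>, of \<open>2 ^ k\<close> steps of
  \<open>f\<close> along the midpoints: the intervals left behind are those with \<open>m\<close>
  from \<open>2 ^ Suc k + 2\<close> down to \<open>2 ^ k + 3\<close>.\<close>

definition expansion :: "nat \<Rightarrow> real" where
  "expansion k = (\<Prod>i<2 ^ k. 1 + amp (2 ^ Suc k + 2 - int i))"

text \<open>There are \<open>2 ^ k\<close> factors. Each index is at most
  \<open>2 powr (k + 2)\<close>, so each amplitude is at least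
  \<open>2 powr (- 15/16 * k) / 8\<close>, and the logarithm loses at most a factor 2 because
  \<open>ln (1 + x) \<ge> x - x^2 \<ge> x / 2\<close> for
  \<open>0 \<le> x \<le> 1/2\<close>.\<close>

lemma ln_expansion_ge: "expansion k > 0" "ln (expansion k) \<ge> 2 powr (k / 16) / 16"
proof -
  show "expansion k > 0"
    unfolding expansion_def by (intro prod_pos) (simp add: amp_nonneg add_pos_nonneg)
  have "2 powr (k / 16) / 16 = (\<Sum>i<(2::nat) ^ k. 2 powr (- 15 / 16 * k) / 16)"
    by (simp add: powr_add[symmetric] flip: powr_realpow)
  also have "\<dots> \<le> (\<Sum>i<2 ^ k. ln (1 + amp (2 ^ Suc k + 2 - int i)))"
  proof (rule sum_mono)
    fix i assume i: "i \<in> {..<(2::nat) ^ k}"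
    define j where "j = 2 ^ Suc k + 2 - int i"
    have "int i < 2 ^ k" using i by (metis lessThan_iff of_nat_less_iff of_nat_numeral of_nat_power)
    moreover have "(1::int) \<le> 2 ^ k" by simp
    ultimately have j: "j \<ge> 1" "j \<le> 4 * 2 ^ k" unfolding j_def power_Suc by linarith+
    have "real_of_int j \<le> of_int (4 * 2 ^ k)" using j(2) by (simp only: of_int_le_iff)
    then have jr: "real_of_int j \<le> 2 powr (k + 2)" by (simp add: powr_add powr_realpow)
    have "2 powr (- 15 / 16 * k) / 4 = 2 powr (- 2 + - 15 / 16 * real k)"
      unfolding powr_add by (simp add: powr_minus)
    also have "\<dots> \<le> 2 powr ((k + 2) * (- 15 / 16))" by (intro powr_mono) (auto simp: field_simps)
    also have "\<dots> = (2 powr (k + 2)) powr (- 15 / 16)" by (simp add: powr_powr)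
    also have "\<dots> \<le> of_int j powr (- 15 / 16)" using j(1) jr by (intro powr_mono2') auto
    finally have a: "2 powr (- 15 / 16 * k) / 8 \<le> amp j" by (simp add: amp_def)
    have "amp j / 2 \<le> amp j - (amp j)\<^sup>2"
      using amp_le[OF j(1)] amp_nonneg[of j] mult_right_mono[of "amp j" "1/2" "amp j"]
      by (simp add: power2_eq_square)
    also have "\<dots> \<le> ln (1 + amp j)"
      using amp_le[OF j(1)] amp_nonneg[of j] by (intro ln_one_plus_pos_lower_bound) auto
    finally show "2 powr (- 15 / 16 * k) / 16 \<le> ln (1 + amp (2 ^ Suc k + 2 - int i))"
      using a unfolding j_def[symmetric] by linarith
  qed
  also have "\<dots> = ln (expansion k)"
  proof -
    have "1 + amp j \<noteq> 0" for j using amp_nonneg[of j] by linarith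
    then show ?thesis unfolding expansion_def by (intro ln_prod[symmetric]) auto
  qed
  finally show "ln (expansion k) \<ge> 2 powr (k / 16) / 16" .
qed

lemma bounded_above_if_eventually_nonpos:
  fixes h :: "nat \<Rightarrow> real"
  assumes "eventually (\<lambda>k. h k \<le> 0) sequentially"
  shows "\<exists>C\<ge>0. \<forall>k. h k \<le> C"
proof -
  obtain K where K: "\<And>k. k \<ge> K \<Longrightarrow> h k \<le> 0" using assms by (auto simp: eventually_sequentially)
  define C where "C = (\<Sum>k<K. \<bar>h k\<bar>)"
  have C0: "C \<ge> 0" unfolding C_def by (rule sum_nonneg) simp
  have "h k \<le> C" for k
  proof (cases "k < K")
    case True
    then have "\<bar>h k\<bar> \<le> C" unfolding C_def by (intro member_le_sum) auto
    then show ?thesis by linarith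
  next
    case False
    then show ?thesis using K[of k] C0 by simp
  qed
  with C0 show ?thesis by blast
qed

text \<open>Half-lengths, in the coordinate \<open>t\<close>, of \<open>[b_k, c_k]\<close> and
  \<open>[u_k, v_k]\<close>. The bound 1/20 stays within the linear part of the kinks; the ratio 24
  keeps the derivative of \<open>g\<close> positive; \<open>r'_Suc\<close> is condition (4);
  \<open>r'_powr\<close> bounds the Hoelder constant of the derivative of \<open>g\<close>, with
  \<open>13/8 = 1 + 5/8\<close>.\<close>

locale bump_radii =
  fixes r r' :: "nat \<Rightarrow> real" and C :: real
  assumes r'_pos: "k \<ge> 1 \<Longrightarrow> r' k > 0"
    and r_le: "k \<ge> 1 \<Longrightarrow> r k \<le> 1/20"
    and r'_le: "k \<ge> 1 \<Longrightarrow> r' k \<le> r k / 24"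
    and r'_Suc: "k \<ge> 1 \<Longrightarrow> expansion k * r' (Suc k) = r k"
    and r'_powr: "k \<ge> 1 \<Longrightarrow> r' k * (2 ^ k + 2) powr (15/16) \<le> C * r k powr (13/8)"

text \<open>In logarithms the two inequalities between \<open>r'\<close> and \<open>r\<close> become
  the linear conditions \<open>gap\<close> and \<open>fast\<close> on
  \<open>y = - ln (20 * r)\<close>, where the expansion contributes the large positive term
  \<open>S\<close>.\<close>

lemma bump_radii_exist: "\<exists>r r' C. bump_radii r r' C"
proof -
  define z :: "nat \<Rightarrow> real" where "z k = 2 powr (k / 16)" for k
  have z: "z k > 0" "z (Suc k) \<le> 2 * z k" for k
  proof -
    have "z (Suc k) = 2 powr (k / 16) * 2 powr (1/16)" by (simp add: z_def add_divide_distrib powr_add)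
    also have "(2::real) powr (1/16) \<le> 2 powr 1" by (intro powr_mono) auto
    finally show "z (Suc k) \<le> 2 * z k" by (simp add: z_def mult.commute)
  qed (simp add: z_def)
  \<comment> \<open>The target 23 comes from \<open>24 \<le> exp 23\<close>, and
    \<open>3/64 = 1/16 - 2/128\<close> is what \<open>S k - z (Suc k) / 128\<close> provides per
    \<open>z k\<close>. The drop from \<open>L / 2 ^ k\<close> to half of it will cover the
    remaining deficit at small \<open>k\<close>.\<close>
  have "eventually (\<lambda>k::nat. (23 - 3/64 * 2 powr (k / 16)) * 2 * 2 ^ k \<le> (0::real)) sequentially"
    by real_asymp
  from bounded_above_if_eventually_nonpos[OF this]
  obtain L where L: "L \<ge> 0" "\<And>k::nat. (23 - 3/64 * z k) * 2 * 2 ^ k \<le> L"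
    unfolding z_def by blast
  \<comment> \<open>Here \<open>19/512 = 1/16 - 13/8 * 2/128\<close>; the logarithmic term bounds
    the power of \<open>2 ^ Suc k + 2\<close> in the Hoelder condition at level
    \<open>Suc k\<close>.\<close>
  have "eventually (\<lambda>k::nat. (real k + 2) * ln 2 - 19/512 * 2 powr (k / 16) \<le> 0) sequentially"
    by real_asymp
  from bounded_above_if_eventually_nonpos[OF this]
  obtain B where B: "B \<ge> 0" "\<And>k::nat. (real k + 2) * ln 2 - 19/512 * z k \<le> B"
    unfolding z_def by blast
  \<comment> \<open>The second term of \<open>y\<close> is absorbed by the expansion \<open>S k \<ge> z k / 16\<close>; the first term separates
    \<open>r' k\<close> from \<open>r k\<close> for the small \<open>k\<close>, and costs nothing as \<open>13/8 < 2\<close>.\<close>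
  define y where "y k = L / 2 ^ k + z k / 128" for k :: nat
  define r where "r k = exp (- y k) / 20" for k
  \<comment> \<open>No equation of the locale fixes \<open>r' 1\<close>; taking it from the
    auxiliary radius \<open>r 0\<close> lets the same estimates cover \<open>k = 1\<close>.\<close>
  define r' where "r' k = r (k - 1) / expansion (k - 1)" for k
  define S where "S k = ln (expansion k)" for k
  have S: "S k \<ge> z k / 16" for k using ln_expansion_ge(2)[of k] by (simp add: S_def z_def)
  have r': "r' (Suc k) = exp (- y k - S k) / 20" for k
    using ln_expansion_ge(1)[of k] by (simp add: r'_def r_def S_def exp_diff)
  have gap: "y k + S k - y (Suc k) \<ge> 23" for k
  proof -
    have "23 - 3/64 * z k \<le> L / 2 ^ k / 2" using L(2)[of k] by (simp add: field_simps)
    then show ?thesis using S[of k] z[of k] by (simp add: y_def)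
  qed
  have fast: "y k + S k - 13/8 * y (Suc k) \<ge> (real k + 2) * ln 2 - B" for k
  proof -
    define t where "t = L / 2 ^ k"
    have "t \<ge> 0" using L(1) by (simp add: t_def)
    moreover have "y k = t + z k / 128" "y (Suc k) = t / 2 + z (Suc k) / 128"
      by (simp_all add: y_def t_def)
    ultimately show ?thesis using B(2)[of k] S[of k] z[of k] by linarith
  qed
  have "bump_radii r r' (exp B * 20 powr (5/8))"
  proof
    fix k :: nat assume "k \<ge> 1"
    then obtain j where k: "k = Suc j" by (cases k) auto
    show "r' k > 0" unfolding k r' by simp
    have "y k \<ge> 0" using L(1) z(1)[of k] by (simp add: y_def)
    then show "r k \<le> 1/20" by (simp add: r_def)
    have "(24::real) \<le> exp 23" using exp_ge_add_one_self[of 23] by simp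
    also have "exp 23 \<le> exp (y j + S j - y k)" using gap[of j] unfolding k by simp
    finally have "exp (- y j - S j) * 24 \<le> exp (- y j - S j) * exp (y j + S j - y k)"
      by (rule mult_left_mono) simp
    also have "\<dots> = exp (- y k)" by (simp add: exp_add[symmetric])
    finally show "r' k \<le> r k / 24" unfolding k r' by (simp add: r_def)
    show "expansion k * r' (Suc k) = r k" using ln_expansion_ge(1)[of k] by (simp add: r'_def)
    have "(2 ^ k + 2 :: real) powr (15/16) \<le> (2 ^ k + 2) powr 1" by (intro powr_mono) auto
    also have "\<dots> \<le> 2 ^ (j + 2)" unfolding k by simp
    also have "\<dots> = 2 powr real (j + 2)" by (rule powr_realpow[symmetric]) simp
    also have "\<dots> = exp ((real j + 2) * ln 2)" by (simp add: powr_def)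
    finally have "r' k * (2 ^ k + 2) powr (15/16) \<le> r' k * exp ((real j + 2) * ln 2)"
      using \<open>r' k > 0\<close> by (intro mult_left_mono) auto
    also have "\<dots> = exp (- y j - S j + (real j + 2) * ln 2) / 20"
      unfolding k r' by (simp add: exp_add)
    also have "\<dots> \<le> exp (B + 13/8 * (- y k)) / 20" using fast[of j] unfolding k by simp
    also have "\<dots> = exp B * 20 powr (5/8) * r k powr (13/8)"
    proof -
      have "r k powr (13/8) = exp (13/8 * (- y k)) / 20 powr (13/8)"
        by (simp add: r_def powr_divide exp_powr_real mult.commute)
      moreover have "(20::real) powr (13/8) = 20 powr (5/8) * 20"
        using powr_add[of "20::real" "5/8" 1] by simp
      ultimately show ?thesis unfolding exp_add by simp
    qed
    finally show "r' k * (2 ^ k + 2) powr (15/16) \<le> exp B * 20 powr (5/8) * r k powr (13/8)" .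
  qed
  then show ?thesis by blast
qed

section \<open>The map \<open>g\<close>\<close>

context bump_radii
begin

lemma r_pos: "k \<ge> 1 \<Longrightarrow> r k > 0"
  using r'_pos[of k] r'_le[of k] by simp

text \<open>The choice is unique, but unspecified unless \<open>is_level\<close> holds.\<close>

definition level :: "int \<Rightarrow> nat" where
  "level m = (THE k. m = 2 ^ k + 2)"

lemma level [simp]: "level (2 ^ k + 2) = k"
  unfolding level_def by (rule the_equality) auto

text \<open>The shift by 2 is that of \<open>t_seq\<close>: the interval between
  \<open>a_(n_k + 1)\<close> and \<open>a_(n_k)\<close> is \<open>[2 ^ k + 2, 2 ^ k + 3]\<close> in
  the coordinate \<open>t\<close>.\<close>

definition is_level :: "int \<Rightarrow> bool" where
  "is_level m \<longleftrightarrow> (\<exists>k\<ge>1. m = 2 ^ k + 2)"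

lemma is_levelE:
  assumes "is_level m"
  obtains k where "k \<ge> 1" "m = 2 ^ k + 2" "level m = k" "m \<ge> 4"
proof -
  obtain k where k: "k \<ge> 1" "m = 2 ^ k + 2" using assms unfolding is_level_def by blast
  moreover have "(2::int) ^ 1 \<le> 2 ^ k" using k(1) by (intro power_increasing) auto
  ultimately show ?thesis using that[of k] by simp
qed

text \<open>Normalised so that the displacement at offset \<open>r' k\<close> from the midpoint is
  exactly \<open>2 * r' k\<close>, which takes \<open>u_k\<close> to \<open>v_k\<close>.\<close>

definition height :: "nat \<Rightarrow> real" where
  "height k = 2 * r' k / hump (r' k / r k)"

definition g_bump :: "int \<Rightarrow> real \<Rightarrow> real" where
  "g_bump m t = (if is_level m then - height (level m) * hump ((t - m - 1/2) / r (level m)) else 0)"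

definition g_bump' :: "int \<Rightarrow> real \<Rightarrow> real" where
  "g_bump' m t =
     (if is_level m then - height (level m) / r (level m) * hump' ((t - m - 1/2) / r (level m)) else 0)"

definition g_disp :: "real \<Rightarrow> real" where
  "g_disp t = g_bump \<lfloor>t\<rfloor> t"

definition g_disp' :: "real \<Rightarrow> real" where
  "g_disp' t = g_bump' \<lfloor>t\<rfloor> t"

definition g_map :: "real \<Rightarrow> real" where
  "g_map = twist g_disp"

definition g_shift :: "real \<Rightarrow> real" where
  "g_shift t = t + g_disp t"

text \<open>Since \<open>r' k / r k\<close> is at most 1/24, the hump is at least 1/2 at that
  offset. The last bound makes the derivative of the bump at most 2/3 in absolute value.\<close>

lemma height_bounds:
  assumes k: "k \<ge> 1"
  shows "height k > 0" "height k \<le> 4 * r' k" "height k \<le> r k / 6"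
proof -
  define q where "q = r' k / r k"
  have q: "0 \<le> q" "q \<le> 1/24"
    using r'_pos[OF k] r_pos[OF k] r'_le[OF k] by (simp_all add: q_def field_simps)
  then have "q\<^sup>2 \<le> (1/24)\<^sup>2" by (intro power_mono) auto
  then have q2: "q\<^sup>2 \<le> 1/576" by (simp add: power_divide)
  then have "(575/576)\<^sup>2 \<le> (1 - q\<^sup>2)\<^sup>2" by (intro power_mono) auto
  moreover have "hump q = (1 - q\<^sup>2)\<^sup>2" using q2 by (simp add: hump_def)
  ultimately have h: "hump q \<ge> 1/2" by (simp add: power_divide)
  show "height k > 0" unfolding height_def q_def[symmetric] using h r'_pos[OF k] by simp
  have "2 * r' k / hump q \<le> 2 * r' k / (1/2)"
    using h r'_pos[OF k] by (intro divide_left_mono) auto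
  then show "height k \<le> 4 * r' k" unfolding height_def q_def[symmetric] by simp
  then show "height k \<le> r k / 6" using r'_le[OF k] by simp
qed

lemma g_bump_has_derivative: "(g_bump m has_real_derivative g_bump' m t) (at t)"
proof (cases "is_level m")
  case True
  then obtain k where k: "k \<ge> 1" "level m = k" by (rule is_levelE)
  have "((\<lambda>t. (t - m - 1/2) / r k) has_real_derivative 1 / r k) (at t)"
    using r_pos[OF k(1)] by (auto intro!: derivative_eq_intros)
  from DERIV_cmult[OF DERIV_chain2[OF hump_has_derivative this], of "- height k"]
  show ?thesis using True k by (simp add: g_bump_def[abs_def] g_bump'_def)
next
  case False
  then show ?thesis by (simp add: g_bump_def[abs_def] g_bump'_def)
qed

lemma g_bump_eq_0:
  assumes "is_level m" "\<bar>t - m - 1/2\<bar> \<ge> r (level m)"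
  shows "g_bump m t = 0" "g_bump' m t = 0"
proof -
  obtain k where k: "k \<ge> 1" "level m = k" using assms(1) by (rule is_levelE)
  have "\<bar>(t - m - 1/2) / r k\<bar> \<ge> 1"
    using assms(2) r_pos[OF k(1)] unfolding k(2) abs_divide by simp
  then show "g_bump m t = 0" "g_bump' m t = 0"
    unfolding g_bump_def g_bump'_def k(2) by (simp_all add: hump_eq_0)
qed

lemma g_bump_nonlevel: "\<not> is_level m \<Longrightarrow> g_bump m t = 0" "\<not> is_level m \<Longrightarrow> g_bump' m t = 0"
  by (simp_all add: g_bump_def g_bump'_def)

lemma level_radius:
  assumes "is_level m"
  shows "0 < r (level m)" "r (level m) \<le> 1/20"
  using assms r_pos r_le by (auto elim!: is_levelE)

lemma g_disp_has_derivative: "(g_disp has_real_derivative g_disp' t) (at t)"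
  unfolding g_disp_def[abs_def] g_disp'_def
proof (rule floor_bump_has_derivative[OF g_bump_has_derivative])
  fix m :: int and t :: real assume t: "\<bar>t - m - 1/2\<bar> \<ge> 1/4"
  show "g_bump m t = 0"
    using g_bump_eq_0(1)[of m t] g_bump_nonlevel(1)[of m t] level_radius(2)[of m] t
    by (cases "is_level m") auto
qed

lemma g_bump_bound: "- 1/2 \<le> g_bump m t" "g_bump m t \<le> 0"
proof -
  have "- 1/2 \<le> g_bump m t \<and> g_bump m t \<le> 0"
  proof (cases "is_level m")
    case True
    then obtain k where k: "k \<ge> 1" "level m = k" by (rule is_levelE)
    define h where "h = hump ((t - m - 1/2) / r k)"
    have "height k * h \<le> 1/2 * 1"
      using height_bounds[OF k(1)] r_le[OF k(1)] hump_le_1 unfolding h_def by (intro mult_mono) auto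
    moreover have "height k * h \<ge> 0" using height_bounds(1)[OF k(1)] hump_le_1(2) by (simp add: h_def)
    ultimately show ?thesis using True k by (simp add: g_bump_def h_def)
  qed (simp add: g_bump_nonlevel)
  then show "- 1/2 \<le> g_bump m t" "g_bump m t \<le> 0" by auto
qed

lemma g_bump'_bound:
  assumes "is_level m" "level m = k" "k \<ge> 1"
  shows "\<bar>g_bump' m t\<bar> \<le> 4 * height k / r k"
proof -
  have "\<bar>g_bump' m t\<bar> = height k / r k * \<bar>hump' ((t - m - 1/2) / r k)\<bar>"
    using assms r_pos[of k] height_bounds(1)[of k] by (simp add: g_bump'_def abs_mult)
  also have "\<dots> \<le> height k / r k * 4"
    using r_pos[of k] height_bounds(1)[of k] assms(3) by (intro mult_left_mono hump'_bound) auto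
  finally show ?thesis by (simp add: mult.commute)
qed

text \<open>The condition \<open>r'_powr\<close> in the two shapes needed for \<open>g\<close>: the
  Hoelder constant of \<open>floor_bump_holder\<close>, using \<open>3/8 + 13/8 = 2\<close>, and the
  decay \<open>1 / sqrt t\<close> of \<open>twist_diffeo\<close>, using \<open>r k \<le> 1\<close>
  and \<open>1/2 \<le> 15/16\<close>.\<close>

lemma r'_scaled:
  assumes k: "k \<ge> 1"
  shows "r' k / (r k)\<^sup>2 * (2 * r k) powr (3/8) * (2 ^ k + 2) powr (15/16) \<le> 2 * C"
    and "r' k / r k \<le> C / sqrt (2 ^ k + 2)" and "C \<ge> 0"
proof -
  define M :: real where "M = 2 ^ k + 2"
  have M1: "M \<ge> 1" by (simp add: M_def)
  have r0: "r k > 0" and r'0: "r' k > 0" using r_pos[OF k] r'_pos[OF k] .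
  have main: "r' k * M powr (15/16) \<le> C * r k powr (13/8)" using r'_powr[OF k] by (simp add: M_def)
  have "0 \<le> r' k * M powr (15/16)" using r'0 by simp
  then have "0 \<le> C * r k powr (13/8)" using main by linarith
  then show C0: "C \<ge> 0" using r0 by (simp add: zero_le_mult_iff not_le)
  have "(2::real) powr (3/8) \<le> 2 powr 1" by (intro powr_mono) auto
  then have "(2 * r k) powr (3/8) \<le> 2 * r k powr (3/8)"
    using r0 by (simp add: powr_mult mult_right_mono)
  then have "r' k / (r k)\<^sup>2 * (2 * r k) powr (3/8) * M powr (15/16)
      \<le> r' k / (r k)\<^sup>2 * (2 * r k powr (3/8)) * M powr (15/16)"
    using r'0 by (intro mult_right_mono mult_left_mono) auto
  also have "\<dots> = 2 * (r k powr (3/8) / (r k)\<^sup>2) * (r' k * M powr (15/16))" by simp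
  also have "\<dots> \<le> 2 * (r k powr (3/8) / (r k)\<^sup>2) * (C * r k powr (13/8))"
    using main by (intro mult_left_mono) auto
  also have "\<dots> = 2 * C * ((r k powr (3/8) * r k powr (13/8)) / (r k)\<^sup>2)" by simp
  also have "r k powr (3/8) * r k powr (13/8) = (r k)\<^sup>2"
    using r0 powr_realpow[of "r k" 2] by (simp flip: powr_add)
  finally show "r' k / (r k)\<^sup>2 * (2 * r k) powr (3/8) * (2 ^ k + 2) powr (15/16) \<le> 2 * C"
    using r0 by (simp add: M_def)
  have "r k powr (13/8) \<le> r k powr 1" using r_le[OF k] r0 by (intro powr_mono') auto
  then have "C * r k powr (13/8) \<le> C * r k" using C0 r0 by (intro mult_left_mono) auto
  then have "r' k * M powr (15/16) \<le> C * r k" using main by linarith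
  moreover have "r' k * sqrt M \<le> r' k * M powr (15/16)"
    using M1 r'0 powr_mono[of "1/2" "15/16" M] by (intro mult_left_mono) (auto simp: powr_half_sqrt)
  ultimately have "r' k * sqrt M \<le> C * r k" by linarith
  then show "r' k / r k \<le> C / sqrt (2 ^ k + 2)"
    using r0 M1 unfolding M_def[symmetric] by (simp add: field_simps)
qed

lemma g_disp'_bounds:
  assumes "t \<ge> 1"
  shows "\<bar>g_disp' t\<bar> \<le> 32 * C / sqrt t" "g_disp' t > -1"
proof -
  define m where "m = \<lfloor>t\<rfloor>"
  have "\<bar>g_disp' t\<bar> \<le> 32 * C / sqrt t \<and> g_disp' t > -1"
  proof (cases "is_level m")
    case True
    then obtain k where k: "k \<ge> 1" "m = 2 ^ k + 2" "level m = k" "m \<ge> 4" by (rule is_levelE)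
    have r0: "r k > 0" by (rule r_pos[OF k(1)])
    have b: "\<bar>g_disp' t\<bar> \<le> 4 * height k / r k"
      using g_bump'_bound[OF True k(3,1)] by (simp add: g_disp'_def m_def)
    have "4 * height k / r k \<le> 2/3" using height_bounds(3)[OF k(1)] r0 by (simp add: field_simps)
    then have "g_disp' t > -1" using b by linarith
    have "4 * height k / r k \<le> 4 * (4 * r' k) / r k"
      using height_bounds(2)[OF k(1)] r0 by (intro divide_right_mono) auto
    also have "\<dots> = 16 * (r' k / r k)" by simp
    also have "\<dots> \<le> 16 * (C / sqrt (2 ^ k + 2))"
      using r'_scaled(2)[OF k(1)] by (rule mult_left_mono) simp
    also have "\<dots> = 32 * C / sqrt (4 * (2 ^ k + 2))" unfolding real_sqrt_mult by simp
    also have "\<dots> \<le> 32 * C / sqrt t"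
    proof -
      define N :: real where "N = 2 ^ k"
      have "t \<le> of_int m + 1" unfolding m_def by linarith
      moreover have "N > 0" "of_int m = N + 2" unfolding k(2) N_def by simp_all
      ultimately have "t \<le> 4 * (N + 2)" "4 * (N + 2) > 0" by auto
      then show ?thesis unfolding N_def[symmetric]
        using r'_scaled(3)[OF k(1)] assms by (intro divide_left_mono real_sqrt_le_mono mult_pos_pos) auto
    qed
    finally show ?thesis using b \<open>g_disp' t > -1\<close> by linarith
  next
    case False
    then show ?thesis using r'_scaled(3)[of 1] assms by (simp add: g_disp'_def m_def g_bump_nonlevel)
  qed
  then show "\<bar>g_disp' t\<bar> \<le> 32 * C / sqrt t" "g_disp' t > -1" by auto
qed

text \<open>The Hoelder constant is \<open>64 = 8 * 4 * 2\<close> times \<open>C\<close>: the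
  Lipschitz constant of \<open>hump'\<close>, the bound of the height by \<open>4 * r' k\<close>,
  and the factor in \<open>r'_scaled\<close>. Off the levels the bump is zero and the radius 1/4 is
  a dummy.\<close>

lemma g_disp'_holder:
  "holder_on (5/8) {0..1} (\<lambda>x. if x = 0 then 0 else g_disp' (1 / x\<^sup>2))"
  unfolding g_disp'_def
proof (rule floor_bump_holder[where \<rho> = "\<lambda>m. if is_level m then r (level m) else 1/4"
      and K = "\<lambda>m. if is_level m then 8 * height (level m) / (r (level m))\<^sup>2 else 0"
      and C = "64 * C"])
  fix m :: int assume m: "m \<ge> 1"
  show "g_bump' m t = 0" if "\<bar>t - m - 1/2\<bar> \<ge> (if is_level m then r (level m) else 1/4)" for t :: real
    using that g_bump_eq_0(2)[of m t] g_bump_nonlevel(2)[of m t] by (auto split: if_splits)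
  show "0 < (if is_level m then r (level m) else 1/4) \<and> (if is_level m then r (level m) else 1/4) \<le> 1/4"
    using level_radius[of m] by auto
  show "(if is_level m then 8 * height (level m) / (r (level m))\<^sup>2 else 0) \<ge> 0"
    using height_bounds(1) by (auto elim!: is_levelE simp: less_imp_le)
  show "\<bar>g_bump' m s - g_bump' m t\<bar>
      \<le> (if is_level m then 8 * height (level m) / (r (level m))\<^sup>2 else 0) * \<bar>s - t\<bar>" for s t :: real
  proof (cases "is_level m")
    case True
    then obtain k where k: "k \<ge> 1" "level m = k" by (rule is_levelE)
    define h where "h t = (t - m - 1/2) / r k" for t :: real
    have r0: "r k > 0" by (rule r_pos[OF k(1)])
    have hk: "height k / r k \<ge> 0" using r0 height_bounds(1)[OF k(1)] by simp
    have "g_bump' m s - g_bump' m t = - ((height k / r k) * (hump' (h s) - hump' (h t)))"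
      using True k by (simp add: g_bump'_def h_def algebra_simps)
    then have "\<bar>g_bump' m s - g_bump' m t\<bar> = height k / r k * \<bar>hump' (h s) - hump' (h t)\<bar>"
      using hk by (simp only: abs_minus_cancel abs_mult abs_of_nonneg)
    also have "\<dots> \<le> height k / r k * (8 * \<bar>h s - h t\<bar>)"
      using hk by (intro mult_left_mono hump'_lipschitz)
    also have "\<bar>h s - h t\<bar> = \<bar>s - t\<bar> / r k"
      using r0 by (simp add: h_def abs_divide flip: diff_divide_distrib)
    finally show ?thesis using True k by (simp add: power2_eq_square mult_ac)
  qed (simp add: g_bump_nonlevel)
  show "(if is_level m then 8 * height (level m) / (r (level m))\<^sup>2 else 0)
      * (2 * (if is_level m then r (level m) else 1/4)) powr (1 - 5/8) * of_int m powr (3/2 * (5/8)) \<le> 64 * C"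
  proof (cases "is_level m")
    case True
    then obtain k where k: "k \<ge> 1" "m = 2 ^ k + 2" "level m = k" by (rule is_levelE)
    have "8 * height k / (r k)\<^sup>2 * (2 * r k) powr (3/8) * (2 ^ k + 2) powr (15/16)
        \<le> 8 * (4 * r' k) / (r k)\<^sup>2 * (2 * r k) powr (3/8) * (2 ^ k + 2) powr (15/16)"
      using height_bounds(2)[OF k(1)] by (intro mult_right_mono divide_right_mono) auto
    also have "\<dots> = 32 * (r' k / (r k)\<^sup>2 * (2 * r k) powr (3/8) * (2 ^ k + 2) powr (15/16))" by simp
    also have "\<dots> \<le> 32 * (2 * C)" using r'_scaled(1)[OF k(1)] by (intro mult_left_mono) auto
    finally show ?thesis using True k by simp
  next
    case False
    then show ?thesis using r'_scaled(3)[of 1] by simp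
  qed
qed auto

lemma g_map_diffeo:
  "C1_holder_diffeo_on (5/8) {0..1} g_map" "strict_mono_on {0..1} g_map"
proof -
  have pos: "1 + g_disp' t > 0" if "t \<ge> 1" for t using g_disp'_bounds(2)[OF that] by linarith
  have "\<not> is_level 1" by (auto elim: is_levelE)
  then have one: "g_disp 1 = 0" by (simp add: g_disp_def g_bump_nonlevel)
  have bnd: "\<bar>g_disp t\<bar> \<le> 2" for t using g_bump_bound[of "\<lfloor>t\<rfloor>" t] by (simp add: g_disp_def)
  have half: "t + g_disp t \<ge> t / 2" if "t \<ge> 1" for t
    using g_bump_bound[of "\<lfloor>t\<rfloor>" t] that unfolding g_disp_def by linarith
  show "C1_holder_diffeo_on (5/8) {0..1} g_map" "strict_mono_on {0..1} g_map" unfolding g_map_def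
    using twist_diffeo[of g_disp g_disp' "32 * C" "5/8", OF g_disp_has_derivative pos one bnd half
        g_disp'_bounds(1) g_disp'_holder] by simp_all
qed

lemma g_map_coord: "t > 0 \<Longrightarrow> g_map (1 / sqrt t) = 1 / sqrt (g_shift t)"
  by (simp add: g_map_def g_shift_def twist_coord)

lemma g_shift_nonlevel: "\<not> is_level \<lfloor>t\<rfloor> \<Longrightarrow> g_shift t = t"
  by (simp add: g_shift_def g_disp_def g_bump_nonlevel)

lemma g_shift_level:
  assumes "k \<ge> 1" "\<bar>s\<bar> \<le> 1/4"
  shows "g_shift (2 ^ k + 5/2 + s) = 2 ^ k + 5/2 + s - height k * hump (s / r k)"
proof -
  have fl: "\<lfloor>2 ^ k + 5/2 + s\<rfloor> = 2 ^ k + 2" using assms(2) by (simp add: floor_eq_iff) linarith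
  have "is_level (2 ^ k + 2)" using assms(1) by (auto simp: is_level_def)
  then show ?thesis unfolding g_shift_def g_disp_def fl by (simp add: g_bump_def)
qed

lemma g_shift_center: "k \<ge> 1 \<Longrightarrow> g_shift (2 ^ k + 5/2 + r' k) = 2 ^ k + 5/2 - r' k"
proof -
  assume k: "k \<ge> 1"
  have "r' k / r k < 1" using r'_pos[OF k] r'_le[OF k] r_pos[OF k] by (simp add: field_simps)
  then have "hump (r' k / r k) > 0"
    using r'_pos[OF k] r_pos[OF k] by (intro hump_pos) (simp add: abs_less_iff)
  then have "height k * hump (r' k / r k) = 2 * r' k" by (simp add: height_def)
  moreover have "\<bar>r' k\<bar> \<le> 1/4" using r'_pos[OF k] r'_le[OF k] r_le[OF k] by simp
  ultimately show ?thesis using g_shift_level[OF k, of "r' k"] by simp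
qed

lemma g_shift_fixed:
  assumes k: "k \<ge> 1" and s: "r k \<le> \<bar>s\<bar>" "\<bar>s\<bar> \<le> 1/2"
  shows "g_shift (2 ^ k + 5/2 + s) = 2 ^ k + 5/2 + s"
proof (cases "s = 1/2")
  \<comment> \<open>The upper end of the unit interval has the next integer as floor; there the bump
    of that next interval vanishes.\<close>
  case True
  have e: "(2 ^ k + 5/2 + s :: real) = of_int (2 ^ k + 3)" using True by simp
  have "g_bump m (of_int m) = 0" for m
    using g_bump_eq_0(1)[of m "of_int m"] g_bump_nonlevel(1)[of m] level_radius(2)[of m]
    by (cases "is_level m") auto
  then show ?thesis unfolding e by (simp only: g_shift_def g_disp_def floor_of_int)
next
  case False
  then have fl: "\<lfloor>2 ^ k + 5/2 + s\<rfloor> = 2 ^ k + 2" using s(2) by (simp add: floor_eq_iff) linarith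
  have "is_level (2 ^ k + 2)" using k by (auto simp: is_level_def)
  from g_bump_eq_0(1)[OF this, of "2 ^ k + 5/2 + s"] show ?thesis
    using s(1) unfolding g_shift_def g_disp_def fl by simp
qed

lemma g_shift_moves:
  assumes k: "k \<ge> 1" and s: "\<bar>s\<bar> < r k"
  shows "g_shift (2 ^ k + 5/2 + s) < 2 ^ k + 5/2 + s"
proof -
  have "hump (s / r k) > 0" using s r_pos[OF k] by (intro hump_pos) (simp add: abs_divide)
  then have "height k * hump (s / r k) > 0" using height_bounds(1)[OF k] by simp
  moreover have "\<bar>s\<bar> \<le> 1/4" using s r_le[OF k] by linarith
  ultimately show ?thesis using g_shift_level[OF k] by simp
qed

end

section \<open>The marked points\<close>

text \<open>On integers from 4 on, \<open>f_shift\<close> is the unit translation, so the points are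
  consecutive integers down to 3; from there they follow the forward orbit of 3 towards the fixed
  point \<open>t = 1\<close>.\<close>

definition t_seq :: "int \<Rightarrow> real" where
  "t_seq m = (if m \<ge> 1 then of_int m + 2 else (f_shift ^^ nat (1 - m)) 3)"

lemma f_shift_iterate_3:
  "1 < (f_shift ^^ j) 3 \<and> (f_shift ^^ j) 3 \<le> 3 \<and> (f_shift ^^ j) 3 - 1 \<le> 2 * (5/9) ^ j"
proof (induction j)
  case (Suc j)
  define t where "t = (f_shift ^^ j) 3"
  have "1 < t" "t \<le> 3" "t - 1 \<le> 2 * (5/9) ^ j" using Suc unfolding t_def by auto
  with f_shift_near_1[of t] show ?case unfolding funpow.simps o_def t_def[symmetric] by auto
qed simp

lemma t_seq_low: "m \<le> 1 \<Longrightarrow> 1 < t_seq m \<and> t_seq m \<le> 3 \<and> t_seq m - 1 \<le> 2 * (5/9) ^ nat (1 - m)"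
  using f_shift_iterate_3[of "nat (1 - m)"] by (cases "m = 1") (auto simp: t_seq_def)

lemma t_seq_gt_1: "t_seq m > 1"
  using t_seq_low[of m] by (cases "m \<ge> 1") (auto simp: t_seq_def)

lemma f_shift_t_seq: "f_shift (t_seq (m + 1)) = t_seq m"
proof (cases "m \<ge> 1")
  case True
  then show ?thesis using f_shift_int[of "m + 3"] by (simp add: t_seq_def add.commute)
next
  case False
  then have "nat (1 - m) = Suc (nat (1 - (m + 1)))" by linarith
  moreover have "t_seq (m + 1) = (f_shift ^^ nat (1 - (m + 1))) 3"
    using False by (cases "m = 0") (auto simp: t_seq_def)
  ultimately show ?thesis using False by (simp add: t_seq_def)
qed

lemma t_seq_less: "t_seq m < t_seq (m + 1)"
proof (cases "m \<ge> 1")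
  case False
  then show ?thesis
    using t_seq_low[of "m + 1"] f_shift_near_1(2)[of "t_seq (m + 1)"] f_shift_t_seq[of m] by simp
qed (simp add: t_seq_def)

definition a_seq :: "int \<Rightarrow> real" where
  "a_seq m = 1 / sqrt (t_seq m)"

lemma a_seq_bounds: "0 < a_seq m" "a_seq m < 1"
  using t_seq_gt_1[of m] by (simp_all add: a_seq_def)

lemma inverse_sqrt_less: "0 < s \<Longrightarrow> s < t \<Longrightarrow> 1 / sqrt t < 1 / sqrt s"
  by (intro divide_strict_left_mono) auto

lemma a_seq_less: "a_seq (m + 1) < a_seq m"
  unfolding a_seq_def using t_seq_less[of m] t_seq_gt_1[of m] by (intro inverse_sqrt_less) auto

lemma a_seq_at_top: "(a_seq \<longlongrightarrow> 0) at_top"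
proof -
  have "((\<lambda>x::real. 1 / sqrt (x + 2)) \<longlongrightarrow> 0) at_top" by real_asymp
  then have "((\<lambda>m::int. 1 / sqrt (of_int m + 2)) \<longlongrightarrow> 0) at_top"
    by (rule filterlim_compose) (rule filterlim_real_of_int_at_top)
  moreover have "eventually (\<lambda>m::int. 1 / sqrt (of_int m + 2) = a_seq m) at_top"
    using eventually_ge_at_top[of 1] by eventually_elim (simp add: a_seq_def t_seq_def)
  ultimately show ?thesis by (rule Lim_transform_eventually)
qed

lemma a_seq_at_bot: "(a_seq \<longlongrightarrow> 1) at_bot"
proof -
  have "filterlim (\<lambda>m::int. nat (1 - m)) sequentially at_bot"
    unfolding filterlim_at_top
  proof
    fix Z :: nat
    show "eventually (\<lambda>m::int. Z \<le> nat (1 - m)) at_bot"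
      unfolding eventually_at_bot_linorder by (intro exI[of _ "- int Z"]) auto
  qed
  moreover have "(\<lambda>j::nat. 2 * (5/9) ^ j) \<longlonglongrightarrow> (0::real)" by real_asymp
  ultimately have lim: "((\<lambda>m::int. 2 * (5/9) ^ nat (1 - m)) \<longlongrightarrow> (0::real)) at_bot"
    by (rule filterlim_compose[rotated])
  have "eventually (\<lambda>m. norm (t_seq m - 1) \<le> 2 * (5/9) ^ nat (1 - m)) at_bot"
    using eventually_le_at_bot[of 1] by eventually_elim (drule t_seq_low, simp)
  from Lim_null_comparison[OF this lim] have "(t_seq \<longlongrightarrow> 1) at_bot" by (simp add: Lim_null[of t_seq])
  then have "((\<lambda>m. 1 / sqrt (t_seq m)) \<longlongrightarrow> 1 / sqrt 1) at_bot" by (intro tendsto_intros) auto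
  then show ?thesis by (simp add: a_seq_def[abs_def])
qed

lemma f_map_a_seq: "f_map (a_seq (m + 1)) = a_seq m"
  using t_seq_gt_1[of "m + 1"] by (simp add: a_seq_def f_map_coord f_shift_t_seq)

text \<open>All slopes are at least 1, so bounding the final offset by 1/20 keeps every earlier
  offset in the linear part.\<close>

lemma f_map_iterate_middle:
  assumes "j - int d \<ge> 4" "\<bar>s * (\<Prod>i<d. 1 + amp (j - int i))\<bar> \<le> 1/20"
  shows "(f_map ^^ d) (1 / sqrt (of_int j + 1/2 + s))
    = 1 / sqrt (of_int (j - int d) + 1/2 + s * (\<Prod>i<d. 1 + amp (j - int i)))"
  using assms
proof (induction d)
  case (Suc d)
  define p where "p = s * (\<Prod>i<d. 1 + amp (j - int i))"
  define q where "q = 1 + amp (j - int d)"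
  have q: "q \<ge> 1" by (simp add: q_def amp_nonneg)
  have pq: "s * (\<Prod>i<Suc d. 1 + amp (j - int i)) = q * p" by (simp add: p_def q_def mult_ac)
  have "\<bar>q * p\<bar> \<le> 1/20" using Suc.prems(2) unfolding pq .
  moreover have "1 * \<bar>p\<bar> \<le> \<bar>q\<bar> * \<bar>p\<bar>" using q by (intro mult_right_mono) auto
  ultimately have p: "\<bar>p\<bar> \<le> 1/20" by (simp add: abs_mult)
  have jd: "j - int d \<ge> 5" using Suc.prems(1) by simp
  then have jd': "real_of_int (j - int d) \<ge> 5" by linarith
  have "(f_map ^^ Suc d) (1 / sqrt (of_int j + 1/2 + s)) = f_map (1 / sqrt (of_int (j - int d) + 1/2 + p))"
    using Suc.IH[folded p_def] p jd by simp
  also have "\<dots> = 1 / sqrt (f_shift (of_int (j - int d) + 1/2 + p))"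
    using jd' p by (intro f_map_coord) linarith
  also have "f_shift (of_int (j - int d) + 1/2 + p) = of_int (j - int d - 1) + 1/2 + q * p"
    unfolding q_def by (rule f_shift_middle[OF jd p])
  finally show ?case unfolding pq by (simp add: algebra_simps)
qed simp

lemma coord_intervalE:
  assumes "1 / sqrt t\<^sub>1 \<le> x" "x \<le> 1 / sqrt t\<^sub>2" "0 < t\<^sub>1" "0 < t\<^sub>2"
  obtains t where "x = 1 / sqrt t" "t\<^sub>2 \<le> t" "t \<le> t\<^sub>1"
proof
  have x: "x > 0" using assms(1,3) by (meson less_le_trans real_sqrt_gt_0_iff zero_less_divide_1_iff)
  show "x = 1 / sqrt (1 / x\<^sup>2)" using x by (simp add: real_sqrt_divide)
  have "x\<^sup>2 \<le> (1 / sqrt t\<^sub>2)\<^sup>2" using x assms by (intro power_mono) auto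
  then show "t\<^sub>2 \<le> 1 / x\<^sup>2" using x assms by (simp add: power_divide field_simps)
  have "(1 / sqrt t\<^sub>1)\<^sup>2 \<le> x\<^sup>2" using x assms by (intro power_mono) auto
  then show "1 / x\<^sup>2 \<le> t\<^sub>1" using x assms by (simp add: power_divide field_simps)
qed

context bump_radii
begin

text \<open>The coordinate reverses the orientation: \<open>b\<^sub>k, u\<^sub>k, v\<^sub>k, c\<^sub>k\<close> are the points with offsets
  \<open>r\<^sub>k, r'\<^sub>k, - r'\<^sub>k, - r\<^sub>k\<close> from the midpoint.\<close>

definition pt :: "nat \<Rightarrow> real \<Rightarrow> real" where
  "pt k s = 1 / sqrt (2 ^ k + 5/2 + s)"

lemma pt_less: "\<bar>s\<bar> \<le> 1/2 \<Longrightarrow> s < t \<Longrightarrow> pt k t < pt k s"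
proof -
  assume s: "\<bar>s\<bar> \<le> 1/2" "s < t"
  have "(2::real) ^ k > 0" by simp
  then have "0 < 2 ^ k + 5/2 + s" using s by linarith
  then show ?thesis unfolding pt_def using s by (intro inverse_sqrt_less) auto
qed

lemma a_seq_pt: "a_seq (2 ^ k + 1) = pt k (1/2)" "a_seq (2 ^ k) = pt k (-1/2)"
  by (simp_all add: a_seq_def t_seq_def pt_def algebra_simps)

lemma pt_order:
  assumes "k \<ge> 1"
  shows "pt k (1/2) < pt k (r k)" "pt k (r k) < pt k (r' k)" "pt k (r' k) < pt k (- r' k)"
    "pt k (- r' k) < pt k (- r k)" "pt k (- r k) < pt k (-1/2)"
  using r'_pos[OF assms] r'_le[OF assms] r_le[OF assms] by (auto intro!: pt_less)

lemma pt_intervalE: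
  assumes "pt k s\<^sub>1 \<le> x" "x \<le> pt k s\<^sub>2" "\<bar>s\<^sub>1\<bar> \<le> 1/2" "\<bar>s\<^sub>2\<bar> \<le> 1/2"
  obtains s where "x = pt k s" "s\<^sub>2 \<le> s" "s \<le> s\<^sub>1"
proof -
  have "(2::real) ^ k > 0" by simp
  then have p: "2 ^ k + 5/2 + s\<^sub>1 > 0" "2 ^ k + 5/2 + s\<^sub>2 > 0" using assms(3,4) by linarith+
  obtain t where "x = 1 / sqrt t" "2 ^ k + 5/2 + s\<^sub>2 \<le> t" "t \<le> 2 ^ k + 5/2 + s\<^sub>1"
    using coord_intervalE[OF assms(1,2)[unfolded pt_def] p] by blast
  then show thesis using that[of "t - (2 ^ k + 5/2)"] by (simp add: pt_def)
qed

lemma g_map_pt: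
  assumes "\<bar>s\<bar> \<le> 1/2"
  shows "g_map (pt k s) = 1 / sqrt (g_shift (2 ^ k + 5/2 + s))"
proof -
  have "(2::real) ^ k > 0" by simp
  then have "0 < 2 ^ k + 5/2 + s" using assms by linarith
  then show ?thesis unfolding pt_def by (rule g_map_coord)
qed

lemma g_map_id_off_levels:
  assumes m: "m \<notin> {2 ^ k |k. k \<ge> (1::nat)}" and x: "x \<in> {a_seq (m + 1)..a_seq m}"
  shows "g_map x = x"
proof -
  obtain t where t: "x = 1 / sqrt t" "t_seq m \<le> t" "t \<le> t_seq (m + 1)"
    using x t_seq_gt_1[of m] t_seq_gt_1[of "m + 1"] coord_intervalE[of "t_seq (m + 1)" x "t_seq m"]
    unfolding a_seq_def by auto
  have "g_shift t = t"
  proof (cases "is_level \<lfloor>t\<rfloor>")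
    case True
    then obtain k where k: "k \<ge> 1" "\<lfloor>t\<rfloor> = 2 ^ k + 2" "\<lfloor>t\<rfloor> \<ge> 4" by (rule is_levelE)
    have t4: "t \<ge> 4" using k(3) by linarith
    have m1: "m \<ge> 1"
    proof (rule ccontr)
      assume "\<not> m \<ge> 1"
      then have "t_seq (m + 1) \<le> 3" using t_seq_low[of "m + 1"] by simp
      then show False using t t4 by simp
    qed
    then have tm: "of_int m + 2 \<le> t" "t \<le> of_int m + 3" using t by (simp_all add: t_seq_def)
    \<comment> \<open>The floor of \<open>t\<close> can be a level other than \<open>m + 2\<close>
      only if \<open>t\<close> is the upper end of its interval, an integer, where all bumps
      vanish.\<close>
    have "\<lfloor>t\<rfloor> \<noteq> m + 2" using k m by auto
    then have "t = of_int (m + 3)" using tm by linarith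
    moreover have "g_bump j (of_int j) = 0" for j
      using g_bump_eq_0(1)[of j "of_int j"] g_bump_nonlevel(1)[of j] level_radius(2)[of j]
      by (cases "is_level j") auto
    ultimately show ?thesis by (simp only: g_shift_def g_disp_def floor_of_int)
  qed (rule g_shift_nonlevel)
  moreover have "t > 0" using t(2) t_seq_gt_1[of m] by simp
  ultimately show ?thesis unfolding t(1) by (simp add: g_map_coord)
qed

lemma g_map_fixed:
  assumes k: "k \<ge> 1" and x: "x \<in> {pt k (1/2)..pt k (r k)} \<union> {pt k (- r k)..pt k (-1/2)}"
  shows "g_map x = x"
proof -
  have r: "0 < r k" "r k \<le> 1/20" using r_pos[OF k] r_le[OF k] .
  obtain s where s: "x = pt k s" "r k \<le> \<bar>s\<bar>" "\<bar>s\<bar> \<le> 1/2"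
    using x
  proof
    assume "x \<in> {pt k (1/2)..pt k (r k)}"
    then have "pt k (1/2) \<le> x" "x \<le> pt k (r k)" by auto
    then obtain s where "x = pt k s" "r k \<le> s" "s \<le> 1/2" by (rule pt_intervalE) (use r in auto)
    with that[of s] r show thesis by auto
  next
    assume "x \<in> {pt k (- r k)..pt k (-1/2)}"
    then have "pt k (- r k) \<le> x" "x \<le> pt k (-1/2)" by auto
    then obtain s where "x = pt k s" "-1/2 \<le> s" "s \<le> - r k" by (rule pt_intervalE) (use r in auto)
    with that[of s] r show thesis by auto
  qed
  then show ?thesis using g_shift_fixed[OF k] by (simp add: g_map_pt) (simp add: pt_def)
qed

lemma g_map_moves:
  assumes k: "k \<ge> 1" and x: "x \<in> {pt k (r k)<..<pt k (- r k)}"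
  shows "g_map x \<noteq> x"
proof -
  have r: "0 < r k" "r k \<le> 1/20" using r_pos[OF k] r_le[OF k] .
  have "pt k (r k) \<le> x" "x \<le> pt k (- r k)" using x by auto
  then obtain s where s: "x = pt k s" "- r k \<le> s" "s \<le> r k" by (rule pt_intervalE) (use r in auto)
  have "s \<noteq> r k" "s \<noteq> - r k" using x s(1) by auto
  then have "\<bar>s\<bar> < r k" using s by linarith
  then show ?thesis using g_shift_moves[OF k, of s] r s by (simp add: g_map_pt) (simp add: pt_def)
qed

lemma g_map_center: "k \<ge> 1 \<Longrightarrow> g_map (pt k (r' k)) = pt k (- r' k)"
  using r'_pos[of k] r'_le[of k] r_le[of k] g_shift_center[of k]
  by (simp add: g_map_pt) (simp add: pt_def)

text \<open>Used with both signs of \<open>s\<close>: by \<open>r'_Suc\<close> the offsets of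
  \<open>u\<close> and \<open>v\<close> at level \<open>Suc k\<close> become those of
  \<open>b\<close> and \<open>c\<close> at level \<open>k\<close>.\<close>

lemma f_map_iterate_pt:
  assumes k: "k \<ge> 1" and s: "\<bar>s\<bar> = r' (Suc k)"
  shows "(f_map ^^ (2 ^ k)) (pt (Suc k) s) = pt k (expansion k * s)"
proof -
  have e: "s * (\<Prod>i<2 ^ k. 1 + amp (2 ^ Suc k + 2 - int i)) = expansion k * s"
    by (simp add: expansion_def mult.commute)
  have "\<bar>expansion k * s\<bar> = r k"
    unfolding abs_mult s using ln_expansion_ge(1)[of k] r'_Suc[OF k] by simp
  then have b: "\<bar>s * (\<Prod>i<2 ^ k. 1 + amp (2 ^ Suc k + 2 - int i))\<bar> \<le> 1/20"
    unfolding e using r_le[OF k] by simp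
  have "(2::int) ^ 1 \<le> 2 ^ k" using k by (intro power_increasing) auto
  then have "(2 ^ Suc k + 2) - int (2 ^ k) \<ge> 4" by simp
  from f_map_iterate_middle[OF this b] show ?thesis unfolding e pt_def by (simp add: algebra_simps)
qed

end

section \<open>Dynamics of the nested intervals\<close>

lemma strict_mono_surj_continuous:
  fixes f :: "real \<Rightarrow> real"
  assumes "strict_mono f" "surj f"
  shows "continuous_on UNIV f"
  by (rule continuous_onI_mono) (use assms in \<open>auto simp: strict_mono_less_eq\<close>)

lemma strict_mono_inv_surj:
  fixes f :: "real \<Rightarrow> real"
  assumes "strict_mono f" "surj f"
  shows "strict_mono (inv_into UNIV f)" "surj (inv_into UNIV f)"
proof -
  show "strict_mono (inv_into UNIV f)"
  proof (rule strict_monoI)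
    fix x y :: real assume "x < y"
    then show "inv_into UNIV f x < inv_into UNIV f y"
      using strict_mono_less[OF assms(1), of "inv_into UNIV f x" "inv_into UNIV f y"] surj_f_inv_f[OF assms(2)] by simp
  qed
  show "surj (inv_into UNIV f)" using assms by (simp add: inj_imp_surj_inv strict_mono_imp_inj_on)
qed

lemma strict_mono_surj_open_image:
  fixes f :: "real \<Rightarrow> real"
  assumes f: "strict_mono f" "surj f" and S: "open S"
  shows "open (f ` S)"
proof -
  have "f ` S = inv_into UNIV f -` S"
    using f by (auto simp: strict_mono_imp_inj_on inv_f_f surj_f_inv_f image_iff) (metis surj_f_inv_f)
  moreover have "continuous_on UNIV (inv_into UNIV f)"
    using strict_mono_inv_surj[OF f] by (rule strict_mono_surj_continuous)
  ultimately show ?thesis using S by (simp add: open_vimage)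
qed

lemma strict_mono_funpow: "strict_mono h \<Longrightarrow> strict_mono (h ^^ i)" for h :: "real \<Rightarrow> real"
  by (induction i) (auto simp: strict_mono_def)

text \<open>Conditions (1) to (4) for increasing homeomorphisms of the whole line; on the line all
  integer powers of \<open>f\<close> are total functions.\<close>

locale nested_action =
  fixes f g :: "real \<Rightarrow> real" and a :: "int \<Rightarrow> real" and b u v c :: "nat \<Rightarrow> real" and n :: "nat \<Rightarrow> nat"
  assumes f_mono: "strict_mono f" and f_surj: "surj f"
    and g_mono: "strict_mono g" and g_surj: "surj g"
    and n_less: "k \<ge> 1 \<Longrightarrow> n k < n (Suc k)"
    and a_Suc: "a (m + 1) < a m"
    and order: "k \<ge> 1 \<Longrightarrow>
      a (int (n k) + 1) < b k \<and> b k < u k \<and> u k < v k \<and> v k < c k \<and> c k < a (int (n k))"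
    and f_a: "f (a (m + 1)) = a m"
    and g_id: "m \<notin> {int (n k) |k. k \<ge> 1} \<Longrightarrow> x \<in> {a (m + 1)..a m} \<Longrightarrow> g x = x"
    and g_id': "k \<ge> 1 \<Longrightarrow> x \<in> {a (int (n k) + 1)..b k} \<union> {c k..a (int (n k))} \<Longrightarrow> g x = x"
    and g_u: "k \<ge> 1 \<Longrightarrow> g (u k) = v k"
    and g_nofix: "k \<ge> 1 \<Longrightarrow> x \<in> {b k<..<c k} \<Longrightarrow> g x \<noteq> x"
    and f_u: "k \<ge> 1 \<Longrightarrow> (f ^^ (n (Suc k) - n k)) (u (Suc k)) = b k"
    and f_v: "k \<ge> 1 \<Longrightarrow> (f ^^ (n (Suc k) - n k)) (v (Suc k)) = c k"
begin

section \<open>Integer powers of \<open>f\<close> and the intervals between consecutive points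
  \<open>a m\<close>\<close>

definition fpow :: "int \<Rightarrow> real \<Rightarrow> real" where
  "fpow m = (if m \<ge> 0 then f ^^ nat m else inv_into UNIV f ^^ nat (- m))"

lemma fpow_Suc: "fpow (m + 1) x = f (fpow m x)"
proof (cases "m \<ge> 0")
  case True
  then have "nat (m + 1) = Suc (nat m)" by linarith
  then show ?thesis using True by (simp add: fpow_def)
next
  case False
  then have "nat (- m) = Suc (nat (- (m + 1)))" by linarith
  moreover have "fpow (m + 1) = inv_into UNIV f ^^ nat (- (m + 1))" using False by (cases "m = -1") (auto simp: fpow_def)
  ultimately show ?thesis using False f_surj by (simp add: fpow_def surj_f_inv_f)
qed

lemma fpow_0 [simp]: "fpow 0 x = x" by (simp add: fpow_def)

lemma fpow_of_nat: "fpow (int i) = f ^^ i" by (simp add: fpow_def)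

lemma f_inj: "f x = f y \<longleftrightarrow> x = y" using f_mono by (simp add: strict_mono_eq)

lemma fpow_add: "fpow (m + j) x = fpow m (fpow j x)"
proof (induction m rule: int_induct[where k = 0])
  case (step1 i)
  then show ?case using fpow_Suc[of "i + j" x] fpow_Suc[of i "fpow j x"] by (simp add: ac_simps)
next
  case (step2 i)
  have "f (fpow (i - 1 + j) x) = f (fpow (i - 1) (fpow j x))"
    using step2 fpow_Suc[of "i - 1 + j" x] fpow_Suc[of "i - 1" "fpow j x"] by (simp add: algebra_simps)
  then show ?case by (simp add: f_inj)
qed simp

lemma fpow_minus: "fpow (- m) (fpow m x) = x" "fpow m (fpow (- m) x) = x"
  using fpow_add[of "- m" m x] fpow_add[of m "- m" x] by simp_all

lemma fpow_strict_mono: "strict_mono (fpow m)"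
  unfolding fpow_def using f_mono f_surj by (auto intro!: strict_mono_funpow strict_mono_inv_surj)

lemma fpow_less [simp]: "fpow m x < fpow m y \<longleftrightarrow> x < y"
  using fpow_strict_mono by (simp add: strict_mono_less)

lemma fpow_surj: "surj (fpow m)"
  by (rule surjI[where f = "fpow (- m)"]) (rule fpow_minus)

lemma fpow_a: "fpow m (a j) = a (j - m)"
proof (induction m rule: int_induct[where k = 0])
  case (step1 i)
  then show ?case using fpow_Suc[of i "a j"] f_a[of "j - (i + 1)"] by simp
next
  case (step2 i)
  have "f (fpow (i - 1) (a j)) = f (a (j - (i - 1)))"
    using step2 fpow_Suc[of "i - 1" "a j"] f_a[of "j - i"] by (simp add: algebra_simps)
  then show ?case by (simp add: f_inj)
qed simp

lemma a_less: "i < j \<Longrightarrow> a j < a i"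
proof (induction j rule: int_gr_induct[where k = i])
  case base
  then show ?case using a_Suc by simp
next
  case (step j)
  then show ?case using a_Suc[of j] by simp
qed

lemma a_interval_unique:
  assumes "a (m + 1) < x" "x < a m" "a (j + 1) < x" "x < a j"
  shows "m = j"
proof (rule ccontr)
  assume "m \<noteq> j"
  then consider "m + 1 \<le> j" | "j + 1 \<le> m" by linarith
  then show False
  proof cases
    case 1
    then have "a j \<le> a (m + 1)" using a_less[of "m + 1" j] by (cases "m + 1 = j") auto
    then show False using assms by simp
  next
    case 2
    then have "a m \<le> a (j + 1)" using a_less[of "j + 1" m] by (cases "j + 1 = m") auto
    then show False using assms by simp
  qed
qed

section \<open>The maps that \<open>g\<close> induces on the fundamental domain between
  \<open>a 1\<close> and \<open>a 0\<close>\<close>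

definition \<gamma> :: "nat \<Rightarrow> real \<Rightarrow> real" where
  "\<gamma> k y = fpow (n k) (g (fpow (- int (n k)) y))"

definition B :: "nat \<Rightarrow> real" where "B k = fpow (n k) (b k)"
definition D :: "nat \<Rightarrow> real" where "D k = fpow (n k) (c k)"

lemma \<gamma>_fpow: "\<gamma> k (fpow (n k) x) = fpow (n k) (g x)"
  by (simp add: \<gamma>_def fpow_minus)

lemma \<gamma>_mono: "strict_mono (\<gamma> k)"
  using g_mono by (auto simp: \<gamma>_def strict_mono_def)

lemma \<gamma>_less [simp]: "\<gamma> k x < \<gamma> k y \<longleftrightarrow> x < y"
  using \<gamma>_mono by (simp add: strict_mono_less)

lemma \<gamma>_le [simp]: "\<gamma> k x \<le> \<gamma> k y \<longleftrightarrow> x \<le> y"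
  using \<gamma>_mono by (simp add: strict_mono_less_eq)

lemma \<gamma>_surj: "surj (\<gamma> k)"
proof -
  have "\<gamma> k = fpow (n k) \<circ> g \<circ> fpow (- int (n k))" by (auto simp: \<gamma>_def)
  moreover have "surj (fpow (n k) \<circ> g \<circ> fpow (- int (n k)))" by (intro comp_surj fpow_surj g_surj)
  ultimately show ?thesis by (simp only:)
qed

lemma f_g_continuous: "continuous_on UNIV g" "continuous_on UNIV (\<gamma> k)" "continuous_on UNIV (fpow m)"
  by (intro strict_mono_surj_continuous g_mono g_surj \<gamma>_mono \<gamma>_surj fpow_strict_mono fpow_surj)+

lemma B_D_order:
  assumes k: "k \<ge> 1"
  shows "a 1 < B k" "B k < D k" "D k < a 0"
proof -
  have "fpow (n k) (a (int (n k) + 1)) < B k" "B k < D k" "D k < fpow (n k) (a (n k))"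
    unfolding B_def D_def using order[OF k] by auto
  then show "a 1 < B k" "B k < D k" "D k < a 0" by (simp_all add: fpow_a)
qed

text \<open>Splitting \<open>n (Suc k)\<close> as \<open>n k\<close> plus the difference, condition
  (4) identifies the transported \<open>u\<close> and \<open>v\<close> of level \<open>Suc k\<close>
  with \<open>B k\<close> and \<open>D k\<close>. Then \<open>g u = v\<close> becomes the jump from
  \<open>B k\<close> to \<open>D k\<close>, and \<open>b < u\<close>, \<open>v < c\<close> become
  strict nesting.\<close>

lemma B_D_Suc:
  assumes k: "k \<ge> 1"
  shows "\<gamma> (Suc k) (B k) = D k" "B (Suc k) < B k" "D k < D (Suc k)"
proof -
  have e: "int (n (Suc k)) = int (n k) + int (n (Suc k) - n k)" using n_less[OF k] by simp
  have u: "fpow (n (Suc k)) (u (Suc k)) = B k" and v: "fpow (n (Suc k)) (v (Suc k)) = D k"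
    unfolding e fpow_add fpow_of_nat f_u[OF k] f_v[OF k] by (simp_all add: B_def D_def fpow_of_nat)
  show "\<gamma> (Suc k) (B k) = D k" unfolding u[symmetric] v[symmetric] \<gamma>_fpow using g_u[of "Suc k"] by simp
  have "fpow (n (Suc k)) (b (Suc k)) < B k" "D k < fpow (n (Suc k)) (c (Suc k))"
    unfolding u[symmetric] v[symmetric] using order[of "Suc k"] by auto
  then show "B (Suc k) < B k" "D k < D (Suc k)" by (simp_all add: B_def D_def)
qed

lemma B_D_mono:
  assumes "1 \<le> j" "j \<le> k"
  shows "B k \<le> B j" "D j \<le> D k"
proof -
  have "B k \<le> B j \<and> D j \<le> D k"
    using assms(2)
  proof (induction k rule: dec_induct)
    case (step k)
    then show ?case using B_D_Suc[of k] assms(1) by simp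
  qed simp
  then show "B k \<le> B j" "D j \<le> D k" by auto
qed

text \<open>Without fixed points in the interval, \<open>g x - x\<close> has constant sign there by
  the intermediate value theorem, and it is positive at \<open>u k\<close>.\<close>

lemma g_moves_right:
  assumes k: "k \<ge> 1" and x: "x \<in> {b k<..<c k}"
  shows "g x > x"
proof (rule ccontr)
  assume "\<not> g x > x"
  then have gx: "g x - x \<le> 0" by simp
  have gu: "g (u k) - u k \<ge> 0" using g_u[OF k] order[OF k] by simp
  have cont: "continuous_on S (\<lambda>x. g x - x)" for S
    by (intro continuous_intros continuous_on_subset[OF f_g_continuous(1)]) auto
  have "\<exists>z. min x (u k) \<le> z \<and> z \<le> max x (u k) \<and> g z - z = 0"
  proof (cases "x \<le> u k")
    case True
    then show ?thesis using IVT'[of "\<lambda>x. g x - x" x 0 "u k"] gx gu cont by auto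
  next
    case False
    then show ?thesis using IVT2'[of "\<lambda>x. g x - x" x 0 "u k"] gx gu cont by auto
  qed
  then obtain z where "min x (u k) \<le> z" "z \<le> max x (u k)" "g z = z" by auto
  moreover from this have "z \<in> {b k<..<c k}" using x order[OF k] by auto
  ultimately show False using g_nofix[OF k] by blast
qed

lemma \<gamma>_moves_right:
  assumes k: "k \<ge> 1" and y: "B k < y" "y < D k"
  shows "\<gamma> k y > y"
proof -
  define x where "x = fpow (- int (n k)) y"
  have yx: "y = fpow (n k) x" by (simp add: x_def fpow_minus)
  have "b k < x" "x < c k" using y unfolding yx B_def D_def by simp_all
  then show ?thesis unfolding yx \<gamma>_fpow using g_moves_right[OF k] by simp
qed

lemma \<gamma>_id:
  assumes k: "k \<ge> 1" and y: "a 1 \<le> y \<and> y \<le> B k \<or> D k \<le> y \<and> y \<le> a 0"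
  shows "\<gamma> k y = y"
proof -
  define x where "x = fpow (- int (n k)) y"
  have yx: "y = fpow (n k) x" by (simp add: x_def fpow_minus)
  have le: "fpow m x \<le> fpow m z \<longleftrightarrow> x \<le> z" for m x z using fpow_less[of m z x] by linarith
  have a: "a 1 = fpow (n k) (a (int (n k) + 1))" "a 0 = fpow (n k) (a (n k))" by (simp_all add: fpow_a)
  have "x \<in> {a (int (n k) + 1)..b k} \<union> {c k..a (int (n k))}"
    using y unfolding yx a B_def D_def le by auto
  then show ?thesis unfolding yx \<gamma>_fpow by (simp add: g_id'[OF k])
qed

lemma \<gamma>_ge:
  assumes k: "k \<ge> 1" and y: "a 1 \<le> y" "y \<le> a 0"
  shows "\<gamma> k y \<ge> y" "\<gamma> k y \<le> a 0"
proof -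
  show "\<gamma> k y \<ge> y" using \<gamma>_id[OF k, of y] \<gamma>_moves_right[OF k, of y] y by force
  have "\<gamma> k y \<le> \<gamma> k (a 0)" using y by simp
  also have "\<gamma> k (a 0) = a 0" using B_D_order[OF k] by (intro \<gamma>_id[OF k]) auto
  finally show "\<gamma> k y \<le> a 0" .
qed

lemma \<gamma>_funpow_ge:
  assumes k: "k \<ge> 1" and y: "a 1 \<le> y" "y \<le> a 0"
  shows "y \<le> (\<gamma> k ^^ i) y \<and> (\<gamma> k ^^ i) y \<le> a 0"
proof (induction i)
  case (Suc i)
  then show ?case using \<gamma>_ge[OF k, of "(\<gamma> k ^^ i) y"] y by auto
qed (use y in simp)

lemma \<gamma>_funpow_Suc_ge:
  assumes k: "k \<ge> 1" and y: "a 1 \<le> y" "y \<le> a 0"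
  shows "\<gamma> k y \<le> (\<gamma> k ^^ Suc i) y"
  using \<gamma>_funpow_ge[OF k y, of i] by simp

lemma g_a: "g (a m) = a m"
proof (cases "m \<in> {int (n k) |k. k \<ge> 1}")
  case True
  then obtain k where k: "k \<ge> 1" "m = int (n k)" by blast
  then show ?thesis using order[OF k(1)] by (intro g_id'[OF k(1)]) auto
next
  case False
  then show ?thesis using a_Suc[of m] by (intro g_id[OF False]) auto
qed

section \<open>Invariant sets generated by subsets of the fundamental domain\<close>

definition sat :: "real set \<Rightarrow> real set" where
  "sat X = {x. \<exists>m. fpow m x \<in> X}"

lemma subset_sat: "X \<subseteq> sat X"
  unfolding sat_def by (auto intro: exI[of _ 0])

lemma sat_f: "f x \<in> sat X \<longleftrightarrow> x \<in> sat X"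
proof -
  have "fpow m (f x) = fpow (m + 1) x" for m using fpow_add[of m 1 x] by (simp add: fpow_def)
  then show ?thesis unfolding sat_def by (auto intro: exI[of _ "_ - 1"])
qed

lemma sat_interval:
  assumes X: "X \<subseteq> {a 1<..<a 0}" and x: "fpow m x \<in> X"
  shows "a (m + 1) < x" "x < a m"
proof -
  have "fpow m (a (m + 1)) < fpow m x" "fpow m x < fpow m (a m)"
    using X x by (auto simp: fpow_a)
  then show "a (m + 1) < x" "x < a m" by simp_all
qed

text \<open>The open intervals between consecutive \<open>a m\<close> are disjoint, so only the
  power \<open>m\<close> can bring \<open>x\<close> into the fundamental domain.\<close>

lemma sat_iff:
  assumes X: "X \<subseteq> {a 1<..<a 0}" and x: "a (m + 1) < x" "x < a m"
  shows "x \<in> sat X \<longleftrightarrow> fpow m x \<in> X"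
proof
  assume "x \<in> sat X"
  then obtain j where j: "fpow j x \<in> X" unfolding sat_def by blast
  have "j = m" using sat_interval[OF X j] x by (intro a_interval_unique) auto
  then show "fpow m x \<in> X" using j by simp
qed (auto simp: sat_def)

definition \<gamma>_inv :: "real set \<Rightarrow> bool" where
  "\<gamma>_inv X \<longleftrightarrow> X \<subseteq> {a 1<..<a 0} \<and> (\<forall>k\<ge>1. \<forall>y\<in>{a 1<..<a 0}. \<gamma> k y \<in> X \<longleftrightarrow> y \<in> X)"

text \<open>As \<open>g\<close> fixes every \<open>a m\<close>, it preserves each interval between
  them. On the \<open>k\<close>-th level interval it is conjugate to \<open>\<gamma> k\<close>, on
  the others it is the identity; so invariance of \<open>X\<close> under all
  \<open>\<gamma> k\<close> is what is required.\<close>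

lemma sat_g:
  assumes "\<gamma>_inv X"
  shows "g x \<in> sat X \<longleftrightarrow> x \<in> sat X"
proof -
  have X: "X \<subseteq> {a 1<..<a 0}" and inv: "\<And>k y. k \<ge> 1 \<Longrightarrow> y \<in> {a 1<..<a 0} \<Longrightarrow> \<gamma> k y \<in> X \<longleftrightarrow> y \<in> X"
    using assms unfolding \<gamma>_inv_def by auto
  have main: "g x \<in> sat X \<longleftrightarrow> x \<in> sat X" if x: "a (m + 1) < x" "x < a m" for m
  proof (cases "m \<in> {int (n k) |k. k \<ge> 1}")
    case True
    then obtain k where k: "k \<ge> 1" "m = int (n k)" by blast
    have gx: "a (m + 1) < g x" "g x < a m"
      using x g_a[of m] g_a[of "m + 1"] strict_mono_less[OF g_mono, of "a (m + 1)" x]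
        strict_mono_less[OF g_mono, of x "a m"] by auto
    have "a 1 < fpow m x" "fpow m x < a 0"
      using x fpow_less[of m "a (m + 1)" x] fpow_less[of m x "a m"] by (simp_all add: fpow_a del: fpow_less)
    then have "\<gamma> k (fpow m x) \<in> X \<longleftrightarrow> fpow m x \<in> X" by (intro inv k) auto
    then show ?thesis unfolding sat_iff[OF X x] sat_iff[OF X gx] by (simp add: k \<gamma>_fpow)
  next
    case False
    then show ?thesis using g_id[OF False, of x] x by simp
  qed
  show ?thesis
  proof
    assume "g x \<in> sat X"
    then obtain m where "fpow m (g x) \<in> X" unfolding sat_def by blast
    then have "a (m + 1) < g x" "g x < a m" using sat_interval[OF X] by auto
    then have "g (a (m + 1)) < g x" "g x < g (a m)" by (simp_all add: g_a)
    then have "a (m + 1) < x" "x < a m" using g_mono by (simp_all add: strict_mono_less)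
    then show "x \<in> sat X" using main \<open>g x \<in> sat X\<close> by blast
  next
    assume "x \<in> sat X"
    then obtain m where "fpow m x \<in> X" unfolding sat_def by blast
    then show "g x \<in> sat X" using sat_interval[OF X] main \<open>x \<in> sat X\<close> by blast
  qed
qed

lemma open_sat: "open X \<Longrightarrow> open (sat X)"
proof -
  assume "open X"
  moreover have "sat X = (\<Union>m. fpow m -` X)" by (auto simp: sat_def)
  ultimately show ?thesis using f_g_continuous(3) by (auto intro!: open_vimage)
qed

text \<open>\<open>Y k d\<close> is the saturation of \<open>]B\<^sub>k, D\<^sub>k[\<close> under \<open>\<gamma>\<^sub>1, \<dots>, \<gamma>\<^sub>k\<^sub>+\<^sub>d\<close>. Adding \<open>\<gamma>\<^sub>k\<^sub>+\<^sub>d\<^sub>+\<^sub>1\<close> only adds disjoint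
  translates, as this map sends \<open>]B\<^sub>k\<^sub>+\<^sub>d, D\<^sub>k\<^sub>+\<^sub>d[\<close> off itself.\<close>

fun Y :: "nat \<Rightarrow> nat \<Rightarrow> real set" where
  "Y k 0 = {B k<..<D k}"
| "Y k (Suc d) = (\<Union>i. (\<gamma> (k + Suc d) ^^ i) -` Y k d) \<union> (\<Union>i. (\<gamma> (k + Suc d) ^^ i) ` Y k d)"

lemma Y_open: "open (Y k d)"
proof (induction d)
  case (Suc d)
  have "strict_mono (\<gamma> (k + Suc d) ^^ i)" "surj (\<gamma> (k + Suc d) ^^ i)" for i
    using strict_mono_funpow[OF \<gamma>_mono] surj_fn[OF \<gamma>_surj] by auto
  then show ?case using Suc unfolding Y.simps
    by (intro open_Un open_UN ballI open_vimage strict_mono_surj_open_image strict_mono_surj_continuous)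
qed simp

lemma \<gamma>_fixes_B_D:
  assumes "1 \<le> j" "j \<le> k"
  shows "\<gamma> j (B k) = B k" "\<gamma> j (D k) = D k"
  using assms B_D_mono[OF assms] B_D_order[of k] by (auto intro!: \<gamma>_id)

lemma \<gamma>_interval_iff:
  assumes "1 \<le> j" "j \<le> k"
  shows "\<gamma> j z \<in> {B k<..<D k} \<longleftrightarrow> z \<in> {B k<..<D k}"
  using \<gamma>_less[of j "B k" z] \<gamma>_less[of j z "D k"] \<gamma>_fixes_B_D[OF assms] by simp

lemma funpow_interval_iff:
  assumes "1 \<le> j" "j \<le> k"
  shows "(\<gamma> j ^^ i) z \<in> {B k<..<D k} \<longleftrightarrow> z \<in> {B k<..<D k}"
  using \<gamma>_interval_iff[OF assms] by (induction i) auto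

lemma Y_subset:
  assumes k: "k \<ge> 1"
  shows "Y k d \<subseteq> {B (k + d)<..<D (k + d)}"
proof (induction d)
  case (Suc d)
  have "Y k d \<subseteq> {B (k + Suc d)<..<D (k + Suc d)}"
    using Suc B_D_Suc[of "k + d"] k by force
  moreover have "(\<gamma> (k + Suc d) ^^ i) z \<in> {B (k + Suc d)<..<D (k + Suc d)} \<longleftrightarrow>
      z \<in> {B (k + Suc d)<..<D (k + Suc d)}" for i z
    by (rule funpow_interval_iff) (use k in auto)
  ultimately show ?case unfolding Y.simps subset_iff Un_iff UN_iff vimage_eq image_iff by metis
qed simp

lemma Y_mono_Suc: "Y k d \<subseteq> Y k (Suc d)"
proof -
  have "Y k d = (\<gamma> (k + Suc d) ^^ 0) -` Y k d" by simp
  then show ?thesis unfolding Y.simps by blast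
qed

lemma Y_mono: "d \<le> e \<Longrightarrow> Y k d \<subseteq> Y k e"
  using Y_mono_Suc lift_Suc_mono_le[of "Y k"] by blast

text \<open>The new map jumps from \<open>B (k + d)\<close> to \<open>D (k + d)\<close> and moves no
  point of the fundamental domain to the left. So a positive power takes the interval past its right
  end, and a negative power cannot bring points of \<open>Y k d\<close> back into it. The closed
  bounds matter, since the lemma is applied to the endpoint \<open>D k\<close> when
  \<open>d = 0\<close>.\<close>

lemma Y_Suc_inter:
  assumes k: "k \<ge> 1" and z: "z \<in> Y k (Suc d)" "B (k + d) \<le> z" "z \<le> D (k + d)"
  shows "z \<in> Y k d"
proof -
  let ?G = "\<gamma> (k + Suc d)"
  have kd: "k + Suc d \<ge> 1" "k + d \<ge> 1" using k by auto
  have jump: "?G (B (k + d)) = D (k + d)" using B_D_Suc(1)[OF kd(2)] by simp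
  note ord = B_D_order[OF kd(2)]
  from z(1) consider i where "(?G ^^ i) z \<in> Y k d" | i y where "y \<in> Y k d" "z = (?G ^^ i) y"
    unfolding Y.simps by blast
  then show ?thesis
  proof cases
    case 1
    show ?thesis
    proof (cases i)
      case (Suc j)
      have "D (k + d) \<le> ?G z" using z(2) jump \<gamma>_le[of "k + Suc d" "B (k + d)" z] by simp
      also have "\<dots> \<le> (?G ^^ i) z" unfolding Suc using z ord by (intro \<gamma>_funpow_Suc_ge kd) auto
      finally show ?thesis using 1 Y_subset[OF k, of d] by force
    qed (use 1 in simp)
  next
    case 2
    show ?thesis
    proof (cases i)
      case (Suc j)
      have y: "B (k + d) < y" "y < D (k + d)" using 2(1) Y_subset[OF k, of d] by auto
      have "D (k + d) < ?G y" using y jump \<gamma>_less[of "k + Suc d" "B (k + d)" y] by simp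
      also have "\<dots> \<le> z" unfolding 2(2) Suc using y ord by (intro \<gamma>_funpow_Suc_ge kd) auto
      finally show ?thesis using z by simp
    qed (use 2 in simp)
  qed
qed

lemma D_not_in_Y:
  assumes k: "k \<ge> 1"
  shows "D k \<notin> Y k d"
proof (induction d)
  case (Suc d)
  then show ?case
    using Y_Suc_inter[OF k, of "D k" d] B_D_mono[of k "k + d"] B_D_order[of k] k by force
qed simp

text \<open>The union runs over all integer powers of the top map, written as preimages and images
  under natural powers; applying the map shifts the exponent.\<close>

lemma Y_top_invariant: "\<gamma> (k + Suc d) z \<in> Y k (Suc d) \<longleftrightarrow> z \<in> Y k (Suc d)"
proof -
  let ?G = "\<gamma> (k + Suc d)"
  have inj: "?G x = ?G y \<longleftrightarrow> x = y" for x y using \<gamma>_mono by (simp add: strict_mono_eq)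
  show ?thesis
  proof
    assume "?G z \<in> Y k (Suc d)"
    then consider i where "(?G ^^ i) (?G z) \<in> Y k d" | i y where "y \<in> Y k d" "?G z = (?G ^^ i) y"
      unfolding Y.simps by blast
    then show "z \<in> Y k (Suc d)"
    proof cases
      case 1
      then have "(?G ^^ Suc i) z \<in> Y k d" by (simp add: funpow_swap1)
      then show ?thesis unfolding Y.simps by blast
    next
      case 2
      show ?thesis
      proof (cases i)
        case 0
        then have "(?G ^^ Suc 0) z \<in> Y k d" using 2 by simp
        then show ?thesis unfolding Y.simps by blast
      next
        case (Suc j)
        then have "z = (?G ^^ j) y" using 2 inj by simp
        then show ?thesis using 2(1) unfolding Y.simps by blast
      qed
    qed
  next
    assume "z \<in> Y k (Suc d)"
    then consider i where "(?G ^^ i) z \<in> Y k d" | i y where "y \<in> Y k d" "z = (?G ^^ i) y"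
      unfolding Y.simps by blast
    then show "?G z \<in> Y k (Suc d)"
    proof cases
      case 1
      show ?thesis
      proof (cases i)
        case 0
        then have "?G z = (?G ^^ Suc 0) z" "z \<in> Y k d" using 1 by simp_all
        then show ?thesis unfolding Y.simps by blast
      next
        case (Suc j)
        then have "(?G ^^ j) (?G z) \<in> Y k d" using 1 by (simp add: funpow_swap1)
        then show ?thesis unfolding Y.simps by blast
      qed
    next
      case 2
      then have "?G z = (?G ^^ Suc i) y" by simp
      then show ?thesis using 2(1) unfolding Y.simps by blast
    qed
  qed
qed

text \<open>For \<open>j\<close> below the top index, inside the interval of index
  \<open>k + d\<close> the last step adds nothing and induction applies; outside it,
  \<open>\<gamma> j\<close> is the identity, its support being contained in that interval.\<close>

lemma Y_invariant:
  assumes k: "k \<ge> 1" and j: "1 \<le> j" "j \<le> k + d" and z: "z \<in> {a 1<..<a 0}"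
  shows "\<gamma> j z \<in> Y k d \<longleftrightarrow> z \<in> Y k d"
  using j
proof (induction d)
  case 0
  then show ?case using \<gamma>_interval_iff[of j k] by simp
next
  case (Suc d)
  show ?case
  proof (cases "j = k + Suc d")
    case True
    then show ?thesis using Y_top_invariant by simp
  next
    case False
    then have j': "j \<le> k + d" using Suc.prems by simp
    show ?thesis
    proof (cases "z \<in> {B (k + d)<..<D (k + d)}")
      case True
      then have "\<gamma> j z \<in> {B (k + d)<..<D (k + d)}" using \<gamma>_interval_iff[OF Suc.prems(1) j'] by blast
      then have "\<gamma> j z \<in> Y k (Suc d) \<longleftrightarrow> \<gamma> j z \<in> Y k d" "z \<in> Y k (Suc d) \<longleftrightarrow> z \<in> Y k d"
        using True Y_Suc_inter[OF k, of _ d] Y_mono_Suc[of k d]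
        by (auto simp del: Y.simps simp: less_imp_le)
      then show ?thesis using Suc.IH Suc.prems(1) j' by simp
    next
      case False
      then have "\<gamma> j z = z"
        using z B_D_mono[OF Suc.prems(1) j'] Suc.prems(1) by (intro \<gamma>_id) auto
      then show ?thesis by simp
    qed
  qed
qed

definition Yall :: "nat \<Rightarrow> real set" where
  "Yall k = (\<Union>d. Y k d)"

lemma Yall_\<gamma>_inv:
  assumes k: "k \<ge> 1"
  shows "\<gamma>_inv (Yall k)"
  unfolding \<gamma>_inv_def
proof (intro conjI allI impI ballI)
  show "Yall k \<subseteq> {a 1<..<a 0}"
  proof
    fix x assume "x \<in> Yall k"
    then obtain d where "x \<in> Y k d" unfolding Yall_def by blast
    then show "x \<in> {a 1<..<a 0}" using Y_subset[OF k, of d] B_D_order[of "k + d"] k by force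
  qed
next
  fix j :: nat and y assume j: "1 \<le> j" and y: "y \<in> {a 1<..<a 0}"
  \<comment> \<open>Passing to stage \<open>d + j\<close> ensures
    \<open>j \<le> k + (d + j)\<close>, so that \<open>\<gamma> j\<close> is among the maps already
    used.\<close>
  have "\<gamma> j y \<in> Y k d \<Longrightarrow> y \<in> Y k (d + j)" "y \<in> Y k d \<Longrightarrow> \<gamma> j y \<in> Y k (d + j)" for d
    using Y_mono[of d "d + j" k] Y_invariant[OF k j, of "d + j" y] y by auto
  then show "\<gamma> j y \<in> Yall k \<longleftrightarrow> y \<in> Yall k" unfolding Yall_def by blast
qed

section \<open>The open invariant set and its closed invariant subsets\<close>

definition core :: "real set" where
  "core = (\<Union>k\<in>{1..}. {B k<..<D k})"

lemma core_\<gamma>_inv: "\<gamma>_inv core"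
  unfolding \<gamma>_inv_def
proof (intro conjI allI impI ballI)
  show "core \<subseteq> {a 1<..<a 0}"
  proof
    fix x assume "x \<in> core"
    then obtain k where k: "k \<in> {1..}" "x \<in> {B k<..<D k}"
      unfolding core_def by (rule UN_E)
    have "1 \<le> k" using k(1) by simp
    from B_D_order[OF this] k(2) show "x \<in> {a 1<..<a 0}"
      unfolding greaterThanLessThan_iff by linarith
  qed
next
  fix j :: nat and y assume j: "1 \<le> j" and y: "y \<in> {a 1<..<a 0}"
  define I where "I k = {B k<..<D k}" for k
  \<comment> \<open>The map \<open>\<gamma> j\<close> is known to preserve the \<open>k\<close>-th
    interval only for \<open>k \<ge> j\<close>; by nesting a point may be placed in such a later
    interval.\<close>
  have up: "\<exists>k\<ge>j. z \<in> I k" if z: "z \<in> core" for z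
  proof -
    from z obtain k where k: "k \<in> {1..}" "z \<in> I k" unfolding core_def I_def by (rule UN_E)
    have "1 \<le> k" "k \<le> max j k" using k(1) by simp_all
    from B_D_mono[OF this] k(2) have "z \<in> I (max j k)"
      unfolding I_def greaterThanLessThan_iff by linarith
    then show ?thesis by (intro exI[of _ "max j k"]) simp
  qed
  have down: "z \<in> core" if "k \<ge> j" "z \<in> I k" for k z
    using that j unfolding core_def I_def by (intro UN_I[of k]) auto
  have iff: "\<gamma> j y \<in> I k \<longleftrightarrow> y \<in> I k" if "k \<ge> j" for k
    unfolding I_def using j that by (rule \<gamma>_interval_iff)
  show "\<gamma> j y \<in> core \<longleftrightarrow> y \<in> core"
  proof
    assume "\<gamma> j y \<in> core"
    then obtain k where "k \<ge> j" "\<gamma> j y \<in> I k" using up by blast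
    then show "y \<in> core" using iff down by simp
  next
    assume "y \<in> core"
    then obtain k where "k \<ge> j" "y \<in> I k" using up by blast
    then show "\<gamma> j y \<in> core" using iff down by simp
  qed
qed

definition W :: "real set" where
  "W = sat core"

definition invariant :: "real set \<Rightarrow> bool" where
  "invariant M \<longleftrightarrow> (\<forall>x. (f x \<in> M \<longleftrightarrow> x \<in> M) \<and> (g x \<in> M \<longleftrightarrow> x \<in> M))"

lemma W_open: "open W"
  unfolding W_def core_def by (intro open_sat) auto

lemma W_invariant: "invariant W"
  unfolding invariant_def W_def using sat_f sat_g[OF core_\<gamma>_inv] by blast

lemma W_bounds: "x \<in> W \<Longrightarrow> \<exists>m. a (m + 1) < x \<and> x < a m"
proof -
  assume "x \<in> W"
  then obtain m where m: "fpow m x \<in> core" unfolding W_def sat_def by blast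
  have "core \<subseteq> {a 1<..<a 0}" using core_\<gamma>_inv unfolding \<gamma>_inv_def by simp
  from sat_interval[OF this m] show ?thesis by blast
qed

lemma D_in_W: "k \<ge> 1 \<Longrightarrow> D k \<in> W"
proof -
  assume k: "k \<ge> 1"
  then have "D k \<in> {B (Suc k)<..<D (Suc k)}" using B_D_Suc[OF k] B_D_order[OF k] by simp
  then have "D k \<in> core" unfolding core_def using k by (intro UN_I[of "Suc k"]) auto
  then show ?thesis unfolding W_def using subset_sat by blast
qed

lemma invariant_fpow: "invariant M \<Longrightarrow> fpow m x \<in> M \<longleftrightarrow> x \<in> M"
proof (induction m rule: int_induct[where k = 0])
  case (step1 i)
  then show ?case unfolding fpow_Suc invariant_def by blast
next
  case (step2 i)
  then show ?case using fpow_Suc[of "i - 1" x] unfolding invariant_def by (metis diff_add_cancel)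
qed simp

lemma invariant_\<gamma>: "invariant M \<Longrightarrow> \<gamma> k y \<in> M \<longleftrightarrow> y \<in> M"
  unfolding \<gamma>_def using invariant_fpow[of M] by (metis invariant_def)

text \<open>The iterates of \<open>y\<close> under \<open>\<gamma> k\<close> increase to a fixed
  point, and \<open>D k\<close> is the only one to the right of \<open>B k\<close> up to
  \<open>D k\<close>. Since \<open>M\<close> is closed only relative to \<open>W\<close>, it matters
  that \<open>D k\<close> belongs to \<open>W\<close>.\<close>

lemma closed_invariant_contains_D:
  assumes inv: "invariant M" and cl: "closedin (top_of_set W) M"
    and k: "k \<ge> 1" and y: "y \<in> M" "B k < y" "y < D k"
  shows "D k \<in> M"
proof -
  define s where "s i = (\<gamma> k ^^ i) y" for i
  have s_M: "s i \<in> M" for i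
    using y(1) invariant_\<gamma>[OF inv] by (induction i) (simp_all add: s_def)
  have s_int: "s i \<in> {B k<..<D k}" for i
    unfolding s_def using funpow_interval_iff[of k k i y] k y by simp
  have "incseq s"
  proof (rule incseq_SucI)
    fix i
    show "s i \<le> s (Suc i)" using \<gamma>_moves_right[OF k, of "s i"] s_int[of i] by (simp add: s_def)
  qed
  then obtain l where l: "s \<longlonglongrightarrow> l" "\<And>i. s i \<le> l"
    using incseq_convergent[of s "D k"] s_int by (auto simp: less_imp_le)
  have lB: "B k < l" using s_int[of 0] l(2)[of 0] by simp
  have lD: "l \<le> D k" using l(1) by (rule LIMSEQ_le_const2) (use s_int in \<open>auto intro: less_imp_le\<close>)
  have "(\<lambda>i. \<gamma> k (s i)) \<longlonglongrightarrow> \<gamma> k l"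
    by (rule continuous_on_tendsto_compose[OF f_g_continuous(2) l(1)]) auto
  moreover have "(\<lambda>i. \<gamma> k (s i)) = (\<lambda>i. s (Suc i))" by (simp add: s_def)
  ultimately have "(\<lambda>i. s (Suc i)) \<longlonglongrightarrow> \<gamma> k l" by simp
  moreover have "(\<lambda>i. s (Suc i)) \<longlonglongrightarrow> l" using l(1) by (rule LIMSEQ_Suc)
  ultimately have "\<gamma> k l = l" by (rule LIMSEQ_unique)
  then have "l = D k" using \<gamma>_moves_right[OF k lB] lD by linarith
  obtain T where T: "closed T" "M = W \<inter> T" using cl unfolding closedin_closed by auto
  have "s i \<in> T" for i using s_M[of i] T(2) by simp
  from closed_sequentially[OF T(1) this l(1)] have "l \<in> T" .
  then show ?thesis using T(2) D_in_W[OF k] \<open>l = D k\<close> by simp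
qed

theorem no_minimal_subset:
  assumes M: "invariant M" "closedin (top_of_set W) M" "M \<noteq> {}"
  shows "\<exists>M'. M' \<subset> M \<and> M' \<noteq> {} \<and> invariant M' \<and> closedin (top_of_set W) M'"
proof -
  have MW: "M \<subseteq> W" using closedin_imp_subset[OF M(2)] .
  obtain x where x: "x \<in> M" using M(3) by blast
  then obtain m k where k: "k \<ge> 1" and mk: "fpow m x \<in> {B k<..<D k}"
    using MW unfolding W_def sat_def core_def by auto
  have "fpow m x \<in> M" using x invariant_fpow[OF M(1)] by blast
  then have D1: "D k \<in> M" using closed_invariant_contains_D[OF M(1,2) k] mk by auto
  have D_int: "B (Suc k) < D k" "D k < D (Suc k)" using B_D_Suc[OF k] B_D_order[OF k] by auto
  \<comment> \<open>The point \<open>D k\<close> is interior to the next interval, so the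
    accumulation argument can start again from it.\<close>
  then have D2: "D (Suc k) \<in> M" using closed_invariant_contains_D[OF M(1,2) _ D1] by auto
  define U where "U = sat (Yall (Suc k))"
  have inv: "\<gamma>_inv (Yall (Suc k))" by (rule Yall_\<gamma>_inv) simp
  have "D k \<in> Y (Suc k) 0" using D_int by simp
  then have "D k \<in> Yall (Suc k)" unfolding Yall_def by (rule UN_I[OF UNIV_I])
  then have "D k \<in> U" unfolding U_def by (rule subsetD[OF subset_sat])
  have "D (Suc k) \<notin> U"
  proof -
    have "D (Suc k) \<notin> Yall (Suc k)" using D_not_in_Y[of "Suc k"] by (simp add: Yall_def)
    moreover have "Yall (Suc k) \<subseteq> {a 1<..<a 0}" using inv unfolding \<gamma>_inv_def by simp
    moreover have "a (0 + 1) < D (Suc k)" "D (Suc k) < a 0" using B_D_order[of "Suc k"] by auto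
    ultimately show ?thesis unfolding U_def using sat_iff[of "Yall (Suc k)" 0 "D (Suc k)"] by simp
  qed
  have "open U" unfolding U_def Yall_def using Y_open by (intro open_sat) auto
  then have "openin (top_of_set W) (W \<inter> U)" by (rule openin_open_Int)
  then have "closedin (top_of_set W) (M - W \<inter> U)" by (rule closedin_diff[OF M(2)])
  moreover have "M - W \<inter> U = M - U" using MW by blast
  ultimately have "closedin (top_of_set W) (M - U)" by simp
  moreover have "invariant (M - U)"
    using M(1) sat_f[of _ "Yall (Suc k)"] sat_g[OF inv] unfolding invariant_def U_def by blast
  moreover have "M - U \<subset> M" using D1 \<open>D k \<in> U\<close> by blast
  moreover have "M - U \<noteq> {}" using D2 \<open>D (Suc k) \<notin> U\<close> by blast
  ultimately show ?thesis by blast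
qed

end

section \<open>Actions and their suspensions\<close>

lemma homeo_group_simps:
  shows "carrier (homeo_group X) = {h \<in> Bij (topspace X). homeomorphic_map X X h}"
    and "\<one>\<^bsub>homeo_group X\<^esub> = (\<lambda>x\<in>topspace X. x)"
    and "h \<in> Bij (topspace X) \<Longrightarrow> k \<in> Bij (topspace X) \<Longrightarrow>
      h \<otimes>\<^bsub>homeo_group X\<^esub> k = compose (topspace X) h k"
  by (simp_all add: homeo_group_def BijGroup_def)

lemma homeo_subgroup: "subgroup {h \<in> Bij (topspace X). homeomorphic_map X X h} (BijGroup (topspace X))"
proof (rule group.subgroupI[OF group_BijGroup])
  let ?S = "topspace X" and ?H = "{h \<in> Bij (topspace X). homeomorphic_map X X h}"
  show "?H \<subseteq> carrier (BijGroup ?S)" by (auto simp: BijGroup_def)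
  have "homeomorphic_map X X (\<lambda>x\<in>?S. x)"
    by (rule homeomorphic_map_eq[of X X id]) auto
  then have "(\<lambda>x\<in>?S. x) \<in> ?H" by (simp add: id_Bij)
  then show "?H \<noteq> {}" by blast
  fix h assume h: "h \<in> ?H"
  then obtain k where k: "homeomorphic_maps X X h k" by (auto simp: homeomorphic_map_maps)
  have bij: "bij_betw h ?S ?S" using h by (simp add: Bij_def)
  have "homeomorphic_map X X k" using k homeomorphic_maps_map by blast
  \<comment> \<open>The topological inverse agrees on the space with the extensional inverse of
    \<open>BijGroup\<close>, which therefore inherits continuity.\<close>
  moreover have "k y = (\<lambda>x\<in>?S. inv_into ?S h x) y" if y: "y \<in> ?S" for y
  proof -
    have "k y \<in> ?S" "h (k y) = y"
      using k y by (auto simp: homeomorphic_maps_def continuous_map_def)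
    then have "inv_into ?S h y = k y" using bij by (intro inv_into_f_eq) (auto simp: bij_betw_def)
    then show ?thesis using y by simp
  qed
  ultimately have "homeomorphic_map X X (\<lambda>x\<in>?S. inv_into ?S h x)"
    by (rule homeomorphic_map_eq)
  moreover have "(\<lambda>x\<in>?S. inv_into ?S h x) \<in> Bij ?S" using h by (intro restrict_inv_into_Bij) auto
  ultimately show "inv\<^bsub>BijGroup ?S\<^esub> h \<in> ?H" using h by (simp add: inv_BijGroup)
  fix k assume k: "k \<in> ?H"
  have "homeomorphic_map X X (h \<circ> k)" using h k by (auto intro: homeomorphic_map_compose)
  then have "homeomorphic_map X X (compose ?S h k)"
    by (rule homeomorphic_map_eq) (auto simp: compose_def)
  then show "h \<otimes>\<^bsub>BijGroup ?S\<^esub> k \<in> ?H"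
    using h k by (simp add: BijGroup_def compose_Bij)
qed

lemma group_homeo_group: "group (homeo_group X)"
  unfolding homeo_group_def by (rule subgroup.subgroup_is_group[OF homeo_subgroup group_BijGroup])

lemma homeo_group_apply:
  assumes "h \<in> carrier (homeo_group X)" "x \<in> topspace X"
  shows "h x \<in> topspace X"
    and "k \<in> carrier (homeo_group X) \<Longrightarrow> (k \<otimes>\<^bsub>homeo_group X\<^esub> h) x = k (h x)"
    and "\<one>\<^bsub>homeo_group X\<^esub> x = x"
    and "(inv\<^bsub>homeo_group X\<^esub> h) (h x) = x" "h ((inv\<^bsub>homeo_group X\<^esub> h) x) = x"
proof -
  interpret group "homeo_group X" by (rule group_homeo_group)
  have mult: "(k \<otimes>\<^bsub>homeo_group X\<^esub> h) y = k (h y)"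
    if "k \<in> carrier (homeo_group X)" "h \<in> carrier (homeo_group X)" "y \<in> topspace X" for k h y
    using that by (simp add: homeo_group_simps compose_def)
  show one: "\<one>\<^bsub>homeo_group X\<^esub> x = x" using assms by (simp add: homeo_group_simps)
  show "h x \<in> topspace X" using assms by (auto simp: homeo_group_simps Bij_def bij_betw_def)
  show "(k \<otimes>\<^bsub>homeo_group X\<^esub> h) x = k (h x)" if "k \<in> carrier (homeo_group X)"
    using mult[OF that assms] .
  show "(inv\<^bsub>homeo_group X\<^esub> h) (h x) = x"
    using mult[of "inv\<^bsub>homeo_group X\<^esub> h" h x] assms one by (simp add: l_inv)
  show "h ((inv\<^bsub>homeo_group X\<^esub> h) x) = x"
    using mult[of h "inv\<^bsub>homeo_group X\<^esub> h" x] assms one by (simp add: r_inv)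
qed

lemma deck_subgroup:
  "subgroup {h \<in> carrier (homeo_group (top_of_set C)). \<forall>z\<in>C. p (h z) = p z} (homeo_group (top_of_set C))"
proof -
  let ?X = "top_of_set C"
  interpret group "homeo_group ?X" by (rule group_homeo_group)
  have apply_C: "h z \<in> C" if "h \<in> carrier (homeo_group ?X)" "z \<in> C" for h z
    using homeo_group_apply(1)[of h ?X z] that by simp
  show ?thesis
  proof (rule subgroupI)
    have "\<one>\<^bsub>homeo_group ?X\<^esub> \<in> {h \<in> carrier (homeo_group ?X). \<forall>z\<in>C. p (h z) = p z}"
      using homeo_group_apply(3)[OF one_closed] by auto
    then show "{h \<in> carrier (homeo_group ?X). \<forall>z\<in>C. p (h z) = p z} \<noteq> {}" by blast
  next
    fix h assume h: "h \<in> {h \<in> carrier (homeo_group ?X). \<forall>z\<in>C. p (h z) = p z}"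
    have "p ((inv\<^bsub>homeo_group ?X\<^esub> h) z) = p z" if z: "z \<in> C" for z
    proof -
      have hc: "h \<in> carrier (homeo_group ?X)" and ph: "\<And>z. z \<in> C \<Longrightarrow> p (h z) = p z" using h by auto
      have "(inv\<^bsub>homeo_group ?X\<^esub> h) z \<in> C" using apply_C[OF inv_closed[OF hc] z] .
      from ph[OF this] homeo_group_apply(5)[OF hc, of z] z show ?thesis by simp
    qed
    then show "inv\<^bsub>homeo_group ?X\<^esub> h \<in> {h \<in> carrier (homeo_group ?X). \<forall>z\<in>C. p (h z) = p z}"
      using h by simp
    fix k assume k: "k \<in> {h \<in> carrier (homeo_group ?X). \<forall>z\<in>C. p (h z) = p z}"
    show "h \<otimes>\<^bsub>homeo_group ?X\<^esub> k \<in> {h \<in> carrier (homeo_group ?X). \<forall>z\<in>C. p (h z) = p z}"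
      using h k homeo_group_apply(2)[of k ?X _ h] apply_C by simp
  qed auto
qed

lemma deck_group_facts:
  fixes p :: "'a::topological_space \<Rightarrow> 'b"
  assumes h: "h \<in> carrier (deck_group C p)"
  shows "group (deck_group C p)" "h \<in> carrier (homeo_group (top_of_set C))"
    and "inv\<^bsub>deck_group C p\<^esub> h = inv\<^bsub>homeo_group (top_of_set C)\<^esub> h"
    and "x \<otimes>\<^bsub>deck_group C p\<^esub> y = x \<otimes>\<^bsub>homeo_group (top_of_set C)\<^esub> y"
    and "\<one>\<^bsub>deck_group C p\<^esub> = \<one>\<^bsub>homeo_group (top_of_set C)\<^esub>"
  using h subgroup.subgroup_is_group[OF deck_subgroup group_homeo_group, of C p]
    group.m_inv_consistent[OF group_homeo_group deck_subgroup, of h C p]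
  by (simp_all add: deck_group_def)

section \<open>Invariant sets of a group acting on the interval\<close>

definition action_invariant :: "(real \<Rightarrow> real) set \<Rightarrow> real set \<Rightarrow> bool" where
  "action_invariant \<Gamma> A \<longleftrightarrow> A \<subseteq> {0..1} \<and> (\<forall>h\<in>\<Gamma>. \<forall>x\<in>{0..1}. h x \<in> A \<longleftrightarrow> x \<in> A)"

lemma action_invariant_Diff:
  "action_invariant \<Gamma> A \<Longrightarrow> action_invariant \<Gamma> A' \<Longrightarrow> action_invariant \<Gamma> (A - A')"
  unfolding action_invariant_def by auto

text \<open>The interface between dynamics and foliation. It is stronger than a failure of the LMS
  property at one leaf: \<open>W\<close> contains no minimal set at all, so every leaf in
  \<open>W\<close> is a counterexample.\<close>

definition no_local_minimal_set :: "(real \<Rightarrow> real) set \<Rightarrow> real set \<Rightarrow> bool" where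
  "no_local_minimal_set \<Gamma> W \<longleftrightarrow> W \<noteq> {} \<and> action_invariant \<Gamma> W \<and> openin unit_interval W \<and>
     (\<forall>M. action_invariant \<Gamma> M \<longrightarrow> closedin (top_of_set W) M \<longrightarrow> M \<noteq> {} \<longrightarrow>
       (\<exists>M'. M' \<subset> M \<and> M' \<noteq> {} \<and> action_invariant \<Gamma> M' \<and> closedin (top_of_set W) M'))"

lemma saturated_orbits_iff:
  assumes \<Gamma>: "subgroup \<Gamma> (homeo_group unit_interval)"
  shows "saturated (orbits \<Gamma> {0..1}) A \<longleftrightarrow> action_invariant \<Gamma> A"
proof -
  interpret subgroup \<Gamma> "homeo_group unit_interval" by (rule \<Gamma>)
  interpret group "homeo_group unit_interval" by (rule group_homeo_group)
  note app = homeo_group_apply[where X = unit_interval, simplified]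
  show ?thesis
  proof
    assume "saturated (orbits \<Gamma> {0..1}) A"
    then obtain L where L: "L \<subseteq> orbits \<Gamma> {0..1}" "A = \<Union>L" unfolding saturated_def by blast
    have A: "x \<in> A \<longleftrightarrow> (\<exists>y\<in>{0..1}. (\<lambda>h. h y) ` \<Gamma> \<in> L \<and> x \<in> (\<lambda>h. h y) ` \<Gamma>)" for x
      using L unfolding orbits_def by blast
    have closed: "h x \<in> A" if h: "h \<in> \<Gamma>" and x: "x \<in> A" for h x
    proof -
      obtain y k where y: "y \<in> {0..1}" "(\<lambda>h. h y) ` \<Gamma> \<in> L" and k: "k \<in> \<Gamma>" "x = k y"
        using x unfolding A by blast
      have "(h \<otimes>\<^bsub>homeo_group unit_interval\<^esub> k) y = h x"
        using app(2)[of k y h] k h y by (auto dest: mem_carrier)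
      moreover have "h \<otimes>\<^bsub>homeo_group unit_interval\<^esub> k \<in> \<Gamma>" using h k by simp
      ultimately have "h x \<in> (\<lambda>h. h y) ` \<Gamma>" by (metis image_eqI)
      then show ?thesis unfolding A using y by blast
    qed
    show "action_invariant \<Gamma> A"
      unfolding action_invariant_def
    proof (intro conjI ballI iffI)
      show "A \<subseteq> {0..1}"
      proof
        fix x assume "x \<in> A"
        then obtain y k where "y \<in> {0..1}" "k \<in> \<Gamma>" "x = k y" unfolding A by blast
        then show "x \<in> {0..1}" using app(1)[of k y] by (auto dest: mem_carrier)
      qed
    next
      fix h and x :: real assume h: "h \<in> \<Gamma>" and x: "x \<in> {0..1}" and hx: "h x \<in> A"
      have "inv\<^bsub>homeo_group unit_interval\<^esub> h \<in> \<Gamma>" using h by simp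
      from closed[OF this hx] show "x \<in> A" using app(4)[of h x] h x by (auto dest: mem_carrier)
    qed (rule closed)
  next
    assume inv: "action_invariant \<Gamma> A"
    then have A01: "A \<subseteq> {0..1}" and A_inv: "\<And>h x. h \<in> \<Gamma> \<Longrightarrow> x \<in> {0..1} \<Longrightarrow> h x \<in> A \<longleftrightarrow> x \<in> A"
      unfolding action_invariant_def by simp_all
    have one: "\<one>\<^bsub>homeo_group unit_interval\<^esub> \<in> \<Gamma>" by (rule subgroup.one_closed[OF \<Gamma>])
    have "A = \<Union>((\<lambda>x. (\<lambda>h. h x) ` \<Gamma>) ` A)"
    proof (intro equalityI subsetI)
      fix x assume x: "x \<in> A"
      then have "x \<in> {0..1}" using A01 by (rule subsetD[rotated])
      then have "\<one>\<^bsub>homeo_group unit_interval\<^esub> x = x" using app(3)[OF mem_carrier[OF one]] by simp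
      then have "x \<in> (\<lambda>h. h x) ` \<Gamma>" using one by (metis image_eqI)
      then show "x \<in> \<Union>((\<lambda>x. (\<lambda>h. h x) ` \<Gamma>) ` A)" using x by (intro UN_I)
    next
      fix w assume "w \<in> \<Union>((\<lambda>x. (\<lambda>h. h x) ` \<Gamma>) ` A)"
      then obtain x h where xh: "x \<in> A" "h \<in> \<Gamma>" "w = h x" by (elim UN_E imageE)
      then show "w \<in> A" using A_inv[OF xh(2), of x] A01 by (simp add: subset_iff)
    qed
    moreover have "(\<lambda>x. (\<lambda>h. h x) ` \<Gamma>) ` A \<subseteq> orbits \<Gamma> {0..1}"
    proof (rule image_subsetI)
      fix x assume "x \<in> A"
      then have "x \<in> {0..1}" by (rule subsetD[OF A01])
      then show "(\<lambda>h. h x) ` \<Gamma> \<in> orbits \<Gamma> {0..1}" unfolding orbits_def by blast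
    qed
    ultimately show "saturated (orbits \<Gamma> {0..1}) A" unfolding saturated_def by blast
  qed
qed

lemma not_LMS_action:
  assumes \<Gamma>: "subgroup \<Gamma> (homeo_group unit_interval)" and W: "no_local_minimal_set \<Gamma> W"
  shows "\<not> LMS_property unit_interval (orbits \<Gamma> {0..1})"
proof
  assume LMS: "LMS_property unit_interval (orbits \<Gamma> {0..1})"
  note sat = saturated_orbits_iff[OF \<Gamma>]
  have W': "W \<noteq> {}" "action_invariant \<Gamma> W" "openin unit_interval W" and W01: "W \<subseteq> {0..1}"
    using W unfolding no_local_minimal_set_def action_invariant_def by auto
  obtain x where x: "x \<in> W" using W'(1) by blast
  have "(\<lambda>h. h x) ` \<Gamma> \<in> orbits \<Gamma> {0..1}" "(\<lambda>h. h x) ` \<Gamma> \<subseteq> W"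
    using x W01 W'(2) unfolding orbits_def action_invariant_def by blast+
  then obtain K where K: "minimal_set_in unit_interval (orbits \<Gamma> {0..1}) W K"
    using LMS W'(2,3) unfolding LMS_property_def sat by metis
  have top: "subtopology unit_interval W = top_of_set W"
    using W01 by (simp add: subtopology_subtopology inf_absorb2)
  have "action_invariant \<Gamma> K" "closedin (top_of_set W) K" "K \<noteq> {}"
    using K unfolding minimal_set_in_def closed_saturated_in_def sat top by auto
  then obtain M' where "M' \<subset> K" "M' \<noteq> {}" "action_invariant \<Gamma> M'" "closedin (top_of_set W) M'"
    using W unfolding no_local_minimal_set_def by metis
  then show False using K unfolding minimal_set_in_def closed_saturated_in_def sat top by blast
qed

section \<open>Invariant subsets of the interval and saturated subsets of the suspension\<close>

locale suspended_action =
  fixes C :: "'a::topological_space set" and p :: "'a \<Rightarrow> 'b" and \<rho> :: "('a \<Rightarrow> 'a) \<Rightarrow> real \<Rightarrow> real"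
  assumes C_ne: "C \<noteq> {}" and \<rho>: "\<rho> \<in> hom (deck_group C p) (homeo_group unit_interval)"
begin

abbreviation "G \<equiv> deck_group C p"
abbreviation "q \<equiv> suspension_proj G \<rho>"
abbreviation "\<Gamma> \<equiv> \<rho> ` carrier G"

lemma group_G: "group G"
  using subgroup.subgroup_is_group[OF deck_subgroup group_homeo_group, of C p]
  by (simp add: deck_group_def)

lemma \<rho>_apply:
  assumes "\<gamma> \<in> carrier G" "x \<in> {0..1}"
  shows "\<rho> \<gamma> x \<in> {0..1}"
    and "\<delta> \<in> carrier G \<Longrightarrow> \<rho> (\<delta> \<otimes>\<^bsub>G\<^esub> \<gamma>) x = \<rho> \<delta> (\<rho> \<gamma> x)"
    and "\<rho> \<one>\<^bsub>G\<^esub> x = x"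
proof -
  have car: "\<rho> \<gamma> \<in> carrier (homeo_group unit_interval)" if "\<gamma> \<in> carrier G" for \<gamma>
    using \<rho> that by (rule hom_in_carrier)
  show "\<rho> \<gamma> x \<in> {0..1}" using homeo_group_apply(1)[OF car[OF assms(1)], of x] assms by simp
  show "\<rho> (\<delta> \<otimes>\<^bsub>G\<^esub> \<gamma>) x = \<rho> \<delta> (\<rho> \<gamma> x)" if "\<delta> \<in> carrier G"
    using homeo_group_apply(2)[OF car[OF assms(1)], of x "\<rho> \<delta>"] car[OF that] assms
      hom_mult[OF \<rho> that assms(1)] by simp
  have "\<rho> \<one>\<^bsub>G\<^esub> = \<one>\<^bsub>homeo_group unit_interval\<^esub>"
    using hom_one[OF \<rho> group_G group_homeo_group] .
  then show "\<rho> \<one>\<^bsub>G\<^esub> x = x" using homeo_group_apply(3)[OF car[OF assms(1)], of x] assms by simp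
qed

lemma G_apply:
  assumes "\<gamma> \<in> carrier G" "z \<in> C"
  shows "\<gamma> z \<in> C"
    and "\<delta> \<in> carrier G \<Longrightarrow> (\<delta> \<otimes>\<^bsub>G\<^esub> \<gamma>) z = \<delta> (\<gamma> z)"
    and "\<one>\<^bsub>G\<^esub> z = z"
  using homeo_group_apply[where X = "top_of_set C", OF deck_group_facts(2)[OF assms(1)], of z] assms
    deck_group_facts(2,4,5)[of _ C p] by simp_all

lemma q_orbit:
  assumes \<gamma>: "\<gamma> \<in> carrier G" and z: "z \<in> C" and x: "x \<in> {0..1}"
  shows "q (\<gamma> z, \<rho> \<gamma> x) = q (z, x)"
proof -
  interpret group G by (rule group_G)
  have sub: "q (\<gamma> z, \<rho> \<gamma> x) \<subseteq> q (z, x)" if "\<gamma> \<in> carrier G" "z \<in> C" "x \<in> {0..1}" for \<gamma> z x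
  proof
    fix w assume "w \<in> q (\<gamma> z, \<rho> \<gamma> x)"
    then obtain \<delta> where \<delta>: "\<delta> \<in> carrier G" "w = (\<delta> (\<gamma> z), \<rho> \<delta> (\<rho> \<gamma> x))"
      unfolding suspension_proj_def by auto
    then have "w = ((\<delta> \<otimes>\<^bsub>G\<^esub> \<gamma>) z, \<rho> (\<delta> \<otimes>\<^bsub>G\<^esub> \<gamma>) x)" using that by (simp add: G_apply \<rho>_apply)
    moreover have "\<delta> \<otimes>\<^bsub>G\<^esub> \<gamma> \<in> carrier G" using \<delta> that by simp
    ultimately show "w \<in> q (z, x)" unfolding suspension_proj_def by blast
  qed
  let ?\<delta> = "inv\<^bsub>G\<^esub> \<gamma>"
  have \<delta>: "?\<delta> \<in> carrier G" using \<gamma> by simp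
  have "?\<delta> (\<gamma> z) = z" "\<rho> ?\<delta> (\<rho> \<gamma> x) = x"
    using G_apply(2)[OF \<gamma> z \<delta>] \<rho>_apply(2)[OF \<gamma> x \<delta>] G_apply(3)[OF \<gamma> z] \<rho>_apply(3)[OF \<gamma> x] \<gamma>
    by (simp_all add: l_inv)
  then have "q (z, x) \<subseteq> q (\<gamma> z, \<rho> \<gamma> x)"
    using sub[OF \<delta> G_apply(1)[OF \<gamma> z] \<rho>_apply(1)[OF \<gamma> x]] by simp
  then show ?thesis using sub[OF \<gamma> z x] by blast
qed

lemma q_eqD:
  assumes "q (z, x) = q (z', x')" "z' \<in> C" "x' \<in> {0..1}"
  shows "\<exists>\<gamma>\<in>carrier G. z' = \<gamma> z \<and> x' = \<rho> \<gamma> x"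
proof -
  interpret group G by (rule group_G)
  have "(z', x') \<in> q (z', x')"
    unfolding suspension_proj_def using assms(2,3) G_apply(3)[OF one_closed] \<rho>_apply(3)[OF one_closed]
    by (auto intro!: image_eqI[of _ _ "\<one>\<^bsub>G\<^esub>"])
  then have "(z', x') \<in> q (z, x)" unfolding assms(1) .
  then show ?thesis unfolding suspension_proj_def by auto
qed

text \<open>Together with \<open>trace\<close> this is the correspondence between invariant subsets
  of the interval and saturated subsets of the suspension; on these two classes the maps are
  mutually inverse.\<close>

definition lift :: "real set \<Rightarrow> ('a \<times> real) set set" where
  "lift A = q ` (C \<times> A)"

definition trace :: "('a \<times> real) set set \<Rightarrow> real set" where
  "trace S = {x \<in> {0..1}. \<forall>z\<in>C. q (z, x) \<in> S}"

lemma q_in_lift: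
  assumes A: "action_invariant \<Gamma> A" and z: "z \<in> C" and x: "x \<in> {0..1}"
  shows "q (z, x) \<in> lift A \<longleftrightarrow> x \<in> A"
proof
  assume "q (z, x) \<in> lift A"
  then obtain z' x' where zx': "z' \<in> C" "x' \<in> A" "q (z, x) = q (z', x')" unfolding lift_def by auto
  moreover have "x' \<in> {0..1}" using A zx'(2) unfolding action_invariant_def by blast
  ultimately obtain \<gamma> where "\<gamma> \<in> carrier G" "x' = \<rho> \<gamma> x" using q_eqD by metis
  then show "x \<in> A" using A zx'(2) x unfolding action_invariant_def by blast
qed (use z in \<open>auto simp: lift_def\<close>)

lemma trace_lift: "action_invariant \<Gamma> A \<Longrightarrow> trace (lift A) = A"
  using q_in_lift[of A] C_ne unfolding trace_def action_invariant_def by blast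

lemma saturated_lift:
  assumes "action_invariant \<Gamma> A"
  shows "saturated (suspension_leaves C G \<rho>) (lift A)"
proof -
  have "lift A = \<Union>((\<lambda>x. q ` (C \<times> {x})) ` A)" unfolding lift_def by blast
  moreover have "(\<lambda>x. q ` (C \<times> {x})) ` A \<subseteq> suspension_leaves C G \<rho>"
    using assms unfolding suspension_leaves_def action_invariant_def by blast
  ultimately show ?thesis unfolding saturated_def by blast
qed

text \<open>Moving \<open>x\<close> by \<open>\<rho> \<gamma>\<close> has the same effect on the
  orbit of \<open>(z, x)\<close> as moving \<open>z\<close> by the inverse of \<gamma>; since a
  trace quantifies over all \<open>z\<close>, it is invariant.\<close>

lemma saturated_trace:
  assumes "saturated (suspension_leaves C G \<rho>) S"
  shows "action_invariant \<Gamma> (trace S)" "lift (trace S) = S"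
proof -
  interpret group G by (rule group_G)
  obtain L where L: "L \<subseteq> suspension_leaves C G \<rho>" "S = \<Union>L" using assms unfolding saturated_def by blast
  have S: "\<exists>x\<in>trace S. \<exists>z\<in>C. w = q (z, x)" if w: "w \<in> S" for w
  proof -
    obtain l where l: "l \<in> L" "w \<in> l" using w L by blast
    then obtain x where x: "x \<in> {0..1}" "l = q ` (C \<times> {x})"
      using L(1) unfolding suspension_leaves_def by blast
    then have "x \<in> trace S" using l(1) L(2) unfolding trace_def by blast
    moreover obtain z where "z \<in> C" "w = q (z, x)" using l(2) x(2) by blast
    ultimately show ?thesis by blast
  qed
  show "lift (trace S) = S"
  proof
    show "lift (trace S) \<subseteq> S" unfolding lift_def trace_def by blast
    show "S \<subseteq> lift (trace S)" unfolding lift_def using S by blast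
  qed
  have fwd: "\<rho> \<gamma> x \<in> trace S" if \<gamma>: "\<gamma> \<in> carrier G" and x: "x \<in> trace S" for \<gamma> x
  proof -
    have x01: "x \<in> {0..1}" using x unfolding trace_def by blast
    have "q (z, \<rho> \<gamma> x) \<in> S" if z: "z \<in> C" for z
    proof -
      let ?\<delta> = "inv\<^bsub>G\<^esub> \<gamma>"
      have \<delta>: "?\<delta> \<in> carrier G" using \<gamma> by simp
      have "\<gamma> (?\<delta> z) = z" using G_apply(2)[OF \<delta> z \<gamma>] G_apply(3)[OF \<gamma> z] \<gamma> by (simp add: r_inv)
      then have "q (z, \<rho> \<gamma> x) = q (?\<delta> z, x)" using q_orbit[OF \<gamma> G_apply(1)[OF \<delta> z] x01] by simp
      then show ?thesis using x G_apply(1)[OF \<delta> z] unfolding trace_def by simp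
    qed
    then show ?thesis using \<rho>_apply(1)[OF \<gamma> x01] unfolding trace_def by blast
  qed
  show "action_invariant \<Gamma> (trace S)"
    unfolding action_invariant_def
  proof (intro conjI ballI iffI)
    show "trace S \<subseteq> {0..1}" unfolding trace_def by blast
  next
    fix h and x :: real assume h: "h \<in> \<Gamma>" and x: "x \<in> {0..1}" and hx: "h x \<in> trace S"
    obtain \<gamma> where \<gamma>: "\<gamma> \<in> carrier G" "h = \<rho> \<gamma>" using h by blast
    let ?\<delta> = "inv\<^bsub>G\<^esub> \<gamma>"
    have \<delta>: "?\<delta> \<in> carrier G" using \<gamma> by simp
    have "\<rho> ?\<delta> (\<rho> \<gamma> x) = x"
      using \<rho>_apply(2)[OF \<gamma>(1) x \<delta>] \<rho>_apply(3)[OF \<gamma>(1) x] \<gamma> by (simp add: l_inv)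
    then show "x \<in> trace S" using fwd[OF \<delta> hx] \<gamma>(2) by simp
  qed (use fwd in blast)
qed

lemma lift_mono_iff:
  assumes "action_invariant \<Gamma> A" "action_invariant \<Gamma> A'"
  shows "lift A \<subset> lift A' \<longleftrightarrow> A \<subset> A'"
proof -
  have 1: "lift A \<subseteq> lift A'" if "A \<subseteq> A'" for A A' using that unfolding lift_def by blast
  have 2: "A \<subseteq> A'" if "lift A \<subseteq> lift A'" "action_invariant \<Gamma> A" "action_invariant \<Gamma> A'" for A A'
  proof -
    have "trace (lift A) \<subseteq> trace (lift A')" using that(1) unfolding trace_def by blast
    then show ?thesis using that(2,3) by (simp add: trace_lift)
  qed
  have "lift A \<subseteq> lift A' \<longleftrightarrow> A \<subseteq> A'" "lift A' \<subseteq> lift A \<longleftrightarrow> A' \<subseteq> A"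
    using 1 2[OF _ assms] 2[OF _ assms(2,1)] by (intro iffI; simp)+
  then show ?thesis by (simp only: less_le_not_le)
qed

lemma topspace_suspension: "topspace (suspension C G \<rho>) = lift {0..1}"
  by (simp add: suspension_def lift_def)

text \<open>By invariance the full preimage of the lift is the product of \<open>C\<close> and
  \<open>A\<close>, which is open.\<close>

lemma open_lift:
  assumes A: "action_invariant \<Gamma> A" "openin unit_interval A"
  shows "openin (suspension C G \<rho>) (lift A)"
proof -
  have A01: "A \<subseteq> {0..1}" using A(1) unfolding action_invariant_def by blast
  have "{w \<in> C \<times> {0..1}. q w \<in> lift A} = C \<times> A"
    using q_in_lift[OF A(1)] A01 by auto
  moreover have "openin (prod_topology (top_of_set C) unit_interval) (C \<times> A)"
    unfolding openin_prod_Times_iff using A(2) by simp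
  moreover have "lift A \<subseteq> q ` (C \<times> {0..1})" using A01 unfolding lift_def by blast
  ultimately show ?thesis
    unfolding suspension_def openin_quotient_topology by simp
qed

text \<open>Restricting the projection to the fibre over one \<open>z\<close> gives a continuous map
  from the interval; saturation makes the preimage of \<open>K\<close> under it equal to the
  trace.\<close>

lemma closedin_trace:
  assumes W: "action_invariant \<Gamma> W"
    and K: "saturated (suspension_leaves C G \<rho>) K" "closedin (subtopology (suspension C G \<rho>) (lift W)) K"
  shows "closedin (top_of_set W) (trace K)"
proof -
  let ?X = "suspension C G \<rho>" and ?P = "prod_topology (top_of_set C) unit_interval"
  have W01: "W \<subseteq> {0..1}" using W unfolding action_invariant_def by blast
  obtain z where z: "z \<in> C" using C_ne by blast
  obtain T where T: "closedin ?X T" "K = T \<inter> lift W" using K(2) unfolding closedin_subtopology by blast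
  have "continuous_map ?P ?X q"
    unfolding suspension_def by (rule quotient_imp_continuous_map[OF quotient_map_quotient_topology])
  moreover have "continuous_map unit_interval ?P (\<lambda>x. (z, x))"
    using z by (intro continuous_map_pairedI) auto
  ultimately have "continuous_map unit_interval ?X (q \<circ> (\<lambda>x. (z, x)))"
    by (rule continuous_map_compose[rotated])
  from closedin_continuous_map_preimage[OF this T(1)]
  have cl: "closedin unit_interval {x \<in> {0..1}. q (z, x) \<in> T}" by simp
  have "trace K = {x \<in> {0..1}. q (z, x) \<in> T} \<inter> W"
  proof (intro equalityI subsetI)
    fix x assume x: "x \<in> trace K"
    then have "x \<in> {0..1}" "q (z, x) \<in> K" using z unfolding trace_def by auto
    then show "x \<in> {x \<in> {0..1}. q (z, x) \<in> T} \<inter> W"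
      using T(2) q_in_lift[OF W z] by auto
  next
    fix x assume x: "x \<in> {x \<in> {0..1}. q (z, x) \<in> T} \<inter> W"
    then have "q (z, x) \<in> lift (trace K)"
      using T(2) q_in_lift[OF W z] saturated_trace(2)[OF K(1)] by auto
    then show "x \<in> trace K" using x q_in_lift[OF saturated_trace(1)[OF K(1)] z] by auto
  qed
  then have "closedin (subtopology unit_interval W) (trace K)"
    using cl unfolding closedin_subtopology by blast
  then show ?thesis using W01 by (simp add: subtopology_subtopology inf_absorb2)
qed

text \<open>Lifting commutes with differences of invariant sets, so the claim reduces to
  \<open>open_lift\<close> for \<open>W - M\<close>, which is open in the interval because
  \<open>W\<close> is.\<close>

lemma closedin_lift:
  assumes W: "action_invariant \<Gamma> W" "openin unit_interval W"
    and M: "action_invariant \<Gamma> M" "closedin (top_of_set W) M"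
  shows "closedin (subtopology (suspension C G \<rho>) (lift W)) (lift M)"
proof -
  let ?X = "suspension C G \<rho>"
  have W01: "W \<subseteq> {0..1}" using W unfolding action_invariant_def by blast
  have MW: "M \<subseteq> W" using closedin_imp_subset[OF M(2)] .
  have "openin (top_of_set W) (W - M)" using M(2) by (simp add: closedin_def)
  then have "openin unit_interval (W - M)" using openin_trans W(2) by blast
  then have op: "openin ?X (lift (W - M))" by (intro open_lift action_invariant_Diff W M)
  have diff: "lift W - lift M = lift (W - M)"
  proof (intro equalityI subsetI)
    fix w assume w: "w \<in> lift W - lift M"
    then obtain z x where zx: "z \<in> C" "x \<in> W" "w = q (z, x)" unfolding lift_def by blast
    then have "x \<notin> M" using w unfolding lift_def by blast
    then show "w \<in> lift (W - M)" using zx unfolding lift_def by blast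
  next
    fix w assume "w \<in> lift (W - M)"
    then obtain z x where zx: "z \<in> C" "x \<in> W" "x \<notin> M" "w = q (z, x)" unfolding lift_def by blast
    then have "w \<notin> lift M" using q_in_lift[OF M(1) zx(1)] W01 by blast
    then show "w \<in> lift W - lift M" using zx unfolding lift_def by blast
  qed
  have "lift W \<subseteq> topspace ?X" using W01 unfolding topspace_suspension lift_def by blast
  then have top: "topspace (subtopology ?X (lift W)) = lift W" by auto
  have "lift (W - M) = lift (W - M) \<inter> lift W" unfolding diff[symmetric] by blast
  then have "openin (subtopology ?X (lift W)) (lift W - lift M)"
    unfolding diff openin_subtopology using op by blast
  moreover have "lift M \<subseteq> lift W" using MW unfolding lift_def by blast
  ultimately show ?thesis unfolding closedin_def top by blast
qed

lemma not_LMS_suspension: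
  assumes W: "no_local_minimal_set \<Gamma> W"
  shows "\<not> LMS_property (suspension C G \<rho>) (suspension_leaves C G \<rho>)"
proof
  assume LMS: "LMS_property (suspension C G \<rho>) (suspension_leaves C G \<rho>)"
  have W': "W \<noteq> {}" "action_invariant \<Gamma> W" "openin unit_interval W" and W01: "W \<subseteq> {0..1}"
    using W unfolding no_local_minimal_set_def action_invariant_def by auto
  obtain x where x: "x \<in> W" using W'(1) by blast
  then have x01: "x \<in> {0..1}" using W01 by blast
  have "q ` (C \<times> {x}) \<in> suspension_leaves C G \<rho>" "q ` (C \<times> {x}) \<subseteq> lift W"
    using x x01 unfolding suspension_leaves_def lift_def by auto
  moreover have "openin (suspension C G \<rho>) (lift W) \<and> saturated (suspension_leaves C G \<rho>) (lift W)"
    using open_lift saturated_lift W'(2,3) by blast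
  ultimately obtain K where K: "minimal_set_in (suspension C G \<rho>) (suspension_leaves C G \<rho>) (lift W) K"
    using LMS unfolding LMS_property_def by metis
  then have K': "K \<noteq> {}" "saturated (suspension_leaves C G \<rho>) K"
      "closedin (subtopology (suspension C G \<rho>) (lift W)) K"
    unfolding minimal_set_in_def closed_saturated_in_def by auto
  note inv = saturated_trace(1)[OF K'(2)] and KK = saturated_trace(2)[OF K'(2)]
  have "trace K \<noteq> {}" using K'(1) KK unfolding lift_def by auto
  then obtain M where M: "M \<subset> trace K" "M \<noteq> {}" "action_invariant \<Gamma> M" "closedin (top_of_set W) M"
    using W inv closedin_trace[OF W'(2) K'(2,3)] unfolding no_local_minimal_set_def by metis
  have "lift M \<subset> K" using lift_mono_iff[OF M(3) inv] M(1) unfolding KK by blast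
  moreover have "lift M \<noteq> {}" using M(2) C_ne unfolding lift_def by blast
  ultimately show False
    using K saturated_lift[OF M(3)] closedin_lift[OF W'(2,3) M(3,4)]
    unfolding minimal_set_in_def closed_saturated_in_def by blast
qed

end

section \<open>The theorem\<close>

lemma C1_on_imp_continuous_on:
  assumes "C1_on S f"
  shows "continuous_on S f"
  unfolding continuous_on_eq_continuous_within
proof
  obtain f' where f': "\<forall>x\<in>S. (f has_real_derivative f' x) (at x within S)"
    using assms unfolding C1_on_def by (elim exE conjE)
  fix x assume "x \<in> S"
  with f' have "(f has_real_derivative f' x) (at x within S)" by (rule bspec)
  then show "continuous (at x within S) f" by (rule DERIV_continuous)
qed

lemma C1_diffeo_on_restrict_homeo:
  assumes "C1_diffeo_on {0..1} f"
  shows "restrict f {0..1} \<in> carrier (homeo_group unit_interval)"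
proof -
  let ?S = "{0..1::real}" and ?g = "inv_into {0..1} f"
  have bij: "bij_betw f ?S ?S" and C1: "C1_on ?S f" "C1_on ?S ?g"
    using assms unfolding C1_diffeo_on_def by simp_all
  note cont = C1[THEN C1_on_imp_continuous_on]
  have img: "f ` ?S \<subseteq> ?S" "?g ` ?S \<subseteq> ?S"
    using bij bij_betw_inv_into[OF bij] unfolding bij_betw_def by simp_all
  have "continuous_map unit_interval unit_interval f" "continuous_map unit_interval unit_interval ?g"
    using cont img by (simp_all add: continuous_map_in_subtopology image_subset_iff_funcset)
  then have maps: "homeomorphic_maps unit_interval unit_interval f ?g"
    unfolding homeomorphic_maps_def
    using bij_betw_inv_into_left[OF bij] bij_betw_inv_into_right[OF bij] by simp
  then have "homeomorphic_map unit_interval unit_interval f" by (auto simp: homeomorphic_map_maps)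
  then have "homeomorphic_map unit_interval unit_interval (restrict f ?S)"
    by (rule homeomorphic_map_eq) auto
  moreover have "restrict f ?S \<in> Bij ?S" using bij by (simp add: Bij_def)
  ultimately show ?thesis by (simp add: homeo_group_simps)
qed

lemma action_invariant_generate:
  assumes f: "restrict f {0..1} \<in> carrier (homeo_group unit_interval)"
    and g: "restrict g {0..1} \<in> carrier (homeo_group unit_interval)"
  shows "action_invariant (generate (homeo_group unit_interval) {restrict f {0..1}, restrict g {0..1}}) A
    \<longleftrightarrow> A \<subseteq> {0..1} \<and> (\<forall>x\<in>{0..1}. (f x \<in> A \<longleftrightarrow> x \<in> A) \<and> (g x \<in> A \<longleftrightarrow> x \<in> A))"
proof -
  let ?H = "homeo_group unit_interval" and ?R = "{restrict f {0..1}, restrict g {0..1}}"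
  interpret group ?H by (rule group_homeo_group)
  have R: "?R \<subseteq> carrier ?H" using f g by simp
  note app = homeo_group_apply[where X = unit_interval, simplified]
  show ?thesis
  proof
    assume inv: "action_invariant (generate ?H ?R) A"
    have fg: "restrict f {0..1} \<in> generate ?H ?R" "restrict g {0..1} \<in> generate ?H ?R"
      by (auto intro: generate.incl)
    have *: "h x \<in> A \<longleftrightarrow> x \<in> A" if "h \<in> generate ?H ?R" "x \<in> {0..1}" for h x
      using inv that unfolding action_invariant_def by simp
    have "f x \<in> A \<longleftrightarrow> x \<in> A" "g x \<in> A \<longleftrightarrow> x \<in> A" if x: "x \<in> {0..1}" for x
      using *[OF fg(1) x] *[OF fg(2) x] x by simp_all
    then show "A \<subseteq> {0..1} \<and> (\<forall>x\<in>{0..1}. (f x \<in> A \<longleftrightarrow> x \<in> A) \<and> (g x \<in> A \<longleftrightarrow> x \<in> A))"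
      using inv unfolding action_invariant_def by simp
  next
    assume A: "A \<subseteq> {0..1} \<and> (\<forall>x\<in>{0..1}. (f x \<in> A \<longleftrightarrow> x \<in> A) \<and> (g x \<in> A \<longleftrightarrow> x \<in> A))"
    have gen: "h x \<in> A \<longleftrightarrow> x \<in> A" if h: "h \<in> ?R" and x: "x \<in> {0..1}" for h x
    proof -
      have "f x \<in> A \<longleftrightarrow> x \<in> A" "g x \<in> A \<longleftrightarrow> x \<in> A" using A x by simp_all
      moreover have "h x = f x \<or> h x = g x" using h x by auto
      ultimately show ?thesis by metis
    qed
    have "\<forall>x\<in>{0..1}. h x \<in> A \<longleftrightarrow> x \<in> A" if "h \<in> generate ?H ?R" for h
      using that
    proof induction
      case one
      then show ?case using app(3)[OF one_closed] by simp
    next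
      case (incl h)
      then show ?case using gen by blast
    next
      \<comment> \<open>Because \<open>gen\<close> is an equivalence, evaluating it at the preimage
        of \<open>x\<close> under \<open>h\<close> settles the inverse.\<close>
      case (inv h)
      then have h: "h \<in> carrier ?H" using R by blast
      show ?case
      proof
        fix x :: real assume x: "x \<in> {0..1}"
        then have "(inv\<^bsub>?H\<^esub> h) x \<in> {0..1}" using app(1)[OF inv_closed[OF h]] by simp
        from gen[OF inv this] show "(inv\<^bsub>?H\<^esub> h) x \<in> A \<longleftrightarrow> x \<in> A" using app(5)[OF h, of x] x by simp
      qed
    next
      case (eng h k)
      then have hk: "h \<in> carrier ?H" "k \<in> carrier ?H" using generate_in_carrier[OF R] by auto
      show ?case
      proof
        fix x :: real assume x: "x \<in> {0..1}"
        have "k x \<in> {0..1}" using app(1)[OF hk(2), of x] x by simp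
        then show "(h \<otimes>\<^bsub>?H\<^esub> k) x \<in> A \<longleftrightarrow> x \<in> A"
          using app(2)[OF hk(2) _ hk(1), of x] x eng.IH by simp
      qed
    qed
    then show "action_invariant (generate ?H ?R) A" using A unfolding action_invariant_def by blast
  qed
qed

text \<open>Extension by the identity gives the homeomorphisms of the line that
  \<open>nested_action\<close> requires; the points added are all fixed and impose no condition of
  invariance.\<close>

definition extend :: "(real \<Rightarrow> real) \<Rightarrow> real \<Rightarrow> real" where
  "extend f x = (if x \<in> {0..1} then f x else x)"

lemma extend_strict_mono_surj:
  assumes "bij_betw f {0..1} {0..1}" "strict_mono_on {0..1} f"
  shows "strict_mono (extend f)" "surj (extend f)"
proof -
  have img: "f x \<in> {0..1}" if "x \<in> {0..1}" for x using assms(1) that by (rule bij_betw_apply)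
  show "strict_mono (extend f)"
  proof (rule strict_monoI)
    fix x y :: real assume "x < y"
    then show "extend f x < extend f y"
      using img[of x] img[of y] strict_mono_onD[OF assms(2), of x y] unfolding extend_def by auto
  qed
  have "\<exists>x. y = extend f x" for y
  proof (cases "y \<in> {0..1}")
    case True
    then obtain x where "x \<in> {0..1}" "y = f x" using assms(1) unfolding bij_betw_def by blast
    then show ?thesis unfolding extend_def by (intro exI[of _ x]) simp
  next
    case False
    then have "extend f y = y" unfolding extend_def by (rule if_not_P)
    then show ?thesis by (intro exI[of _ y]) simp
  qed
  then show "surj (extend f)" unfolding surj_def by blast
qed

lemma extend_funpow:
  assumes "bij_betw f {0..1} {0..1}" "x \<in> {0..1}"
  shows "(extend f ^^ i) x = (f ^^ i) x"
proof -
  have "(extend f ^^ i) x = (f ^^ i) x \<and> (f ^^ i) x \<in> {0..1}"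
    using assms(2) bij_betw_apply[OF assms(1)] by (induction i) (simp_all add: extend_def)
  then show ?thesis by blast
qed

context bump_radii
begin

lemma f_map_bij: "bij_betw f_map {0..1} {0..1}" and g_map_bij: "bij_betw g_map {0..1} {0..1}"
  using f_map_diffeo(1) g_map_diffeo(1) unfolding C1_holder_diffeo_on_def C1_diffeo_on_def by auto

lemma pt_bounds: "\<bar>s\<bar> \<le> 1/2 \<Longrightarrow> pt k s \<in> {0<..<1}"
proof -
  assume s: "\<bar>s\<bar> \<le> 1/2"
  have "(2::real) ^ k > 0" by simp
  then have "1 < 2 ^ k + 5/2 + s" using s by linarith
  then show ?thesis by (simp add: pt_def)
qed

lemma f_map_u_v:
  assumes "k \<ge> 1"
  shows "(f_map ^^ (2 ^ Suc k - 2 ^ k)) (pt (Suc k) (r' (Suc k))) = pt k (r k)"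
    and "(f_map ^^ (2 ^ Suc k - 2 ^ k)) (pt (Suc k) (- r' (Suc k))) = pt k (- r k)"
proof -
  have e: "2 ^ Suc k - 2 ^ k = (2 ^ k :: nat)" by simp
  show "(f_map ^^ (2 ^ Suc k - 2 ^ k)) (pt (Suc k) (r' (Suc k))) = pt k (r k)"
    "(f_map ^^ (2 ^ Suc k - 2 ^ k)) (pt (Suc k) (- r' (Suc k))) = pt k (- r k)"
    unfolding e using f_map_iterate_pt[OF assms, of "r' (Suc k)"] f_map_iterate_pt[OF assms, of "- r' (Suc k)"]
      r'_pos[of "Suc k"] r'_Suc[OF assms] by simp_all
qed

lemma nested_action_extend:
  "nested_action (extend f_map) (extend g_map) a_seq (\<lambda>k. pt k (r k)) (\<lambda>k. pt k (r' k))
     (\<lambda>k. pt k (- r' k)) (\<lambda>k. pt k (- r k)) (\<lambda>k. 2 ^ k)"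
proof
  note ext = extend_strict_mono_surj[OF f_map_bij f_map_diffeo(2)]
    extend_strict_mono_surj[OF g_map_bij g_map_diffeo(2)]
  show "strict_mono (extend f_map)" "surj (extend f_map)" "strict_mono (extend g_map)" "surj (extend g_map)"
    using ext by simp_all
  show "a_seq (m + 1) < a_seq m" for m by (rule a_seq_less)
  show "extend f_map (a_seq (m + 1)) = a_seq m" for m
    using a_seq_bounds[of "m + 1"] by (simp add: extend_def f_map_a_seq)
  show "extend g_map x = x" if "m \<notin> {int (2 ^ k) |k. k \<ge> 1}" "x \<in> {a_seq (m + 1)..a_seq m}" for m x
    using g_map_id_off_levels[of m x] that by (simp add: extend_def)
  fix k :: nat assume k: "k \<ge> 1"
  show "2 ^ k < (2 ^ Suc k :: nat)" by simp
  show "a_seq (int (2 ^ k) + 1) < pt k (r k) \<and> pt k (r k) < pt k (r' k) \<and> pt k (r' k) < pt k (- r' k)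
      \<and> pt k (- r' k) < pt k (- r k) \<and> pt k (- r k) < a_seq (int (2 ^ k))"
    using pt_order[OF k] by (simp add: a_seq_pt)
  show "extend g_map x = x" if "x \<in> {a_seq (int (2 ^ k) + 1)..pt k (r k)} \<union> {pt k (- r k)..a_seq (int (2 ^ k))}" for x
    using g_map_fixed[OF k, of x] that by (simp add: extend_def a_seq_pt)
  have small: "\<bar>r' j\<bar> \<le> 1/2" "\<bar>r j\<bar> \<le> 1/2" if "j \<ge> 1" for j
    using r'_pos[OF that] r'_le[OF that] r_le[OF that] by simp_all
  show "extend g_map (pt k (r' k)) = pt k (- r' k)"
    using pt_bounds[of "r' k" k] small[OF k] g_map_center[OF k] by (simp add: extend_def)
  show "extend g_map x \<noteq> x" if "x \<in> {pt k (r k)<..<pt k (- r k)}" for x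
  proof -
    have "x \<in> {0..1}" using that pt_bounds[of "r k" k] pt_bounds[of "- r k" k] small[OF k] by simp
    then show ?thesis using g_map_moves[OF k that] by (simp add: extend_def)
  qed
  have "pt (Suc k) (r' (Suc k)) \<in> {0..1}" "pt (Suc k) (- r' (Suc k)) \<in> {0..1}"
    using pt_bounds[of "r' (Suc k)" "Suc k"] pt_bounds[of "- r' (Suc k)" "Suc k"] small[of "Suc k"] by simp_all
  from this[THEN extend_funpow[OF f_map_bij]]
  show "(extend f_map ^^ (2 ^ Suc k - 2 ^ k)) (pt (Suc k) (r' (Suc k))) = pt k (r k)"
    "(extend f_map ^^ (2 ^ Suc k - 2 ^ k)) (pt (Suc k) (- r' (Suc k))) = pt k (- r k)"
    by (simp_all only: f_map_u_v[OF k])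
qed

lemma no_local_minimal_set_generated:
  "\<exists>W. no_local_minimal_set
     (generate (homeo_group unit_interval) {restrict f_map {0..1}, restrict g_map {0..1}}) W"
proof -
  interpret N: nested_action "extend f_map" "extend g_map" a_seq "\<lambda>k. pt k (r k)" "\<lambda>k. pt k (r' k)"
     "\<lambda>k. pt k (- r' k)" "\<lambda>k. pt k (- r k)" "\<lambda>k. 2 ^ k"
    by (rule nested_action_extend)
  let ?\<Gamma> = "generate (homeo_group unit_interval) {restrict f_map {0..1}, restrict g_map {0..1}}"
  have car: "restrict f_map {0..1} \<in> carrier (homeo_group unit_interval)"
    "restrict g_map {0..1} \<in> carrier (homeo_group unit_interval)"
    using f_map_diffeo(1) g_map_diffeo(1) unfolding C1_holder_diffeo_on_def
    by (auto intro: C1_diffeo_on_restrict_homeo)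
  have inv: "action_invariant ?\<Gamma> A \<longleftrightarrow> A \<subseteq> {0..1} \<and> N.invariant A" for A
  proof -
    have "extend h x = h x" if "x \<in> {0..1}" for h x using that by (simp add: extend_def)
    moreover have "extend h x = x" if "x \<notin> {0..1}" for h x
      using that unfolding extend_def by (rule if_not_P)
    ultimately have "N.invariant A \<longleftrightarrow> (\<forall>x\<in>{0..1}. (f_map x \<in> A \<longleftrightarrow> x \<in> A) \<and> (g_map x \<in> A \<longleftrightarrow> x \<in> A))"
      unfolding N.invariant_def by metis
    then show ?thesis unfolding action_invariant_generate[OF car] by simp
  qed
  have W01: "N.W \<subseteq> {0..1}"
  proof
    fix x assume "x \<in> N.W"
    then obtain m where "a_seq (m + 1) < x" "x < a_seq m" using N.W_bounds by blast
    then show "x \<in> {0..1}" using a_seq_bounds[of m] a_seq_bounds[of "m + 1"] by simp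
  qed
  have "no_local_minimal_set ?\<Gamma> N.W"
    unfolding no_local_minimal_set_def inv
  proof (intro conjI allI impI)
    show "N.W \<noteq> {}" using N.D_in_W[of 1] by auto
    show "openin unit_interval N.W" using open_subset[OF W01 N.W_open] .
    fix M assume M: "M \<subseteq> {0..1} \<and> N.invariant M" "closedin (top_of_set N.W) M" "M \<noteq> {}"
    then obtain M' where M': "M' \<subset> M" "M' \<noteq> {}" "N.invariant M'" "closedin (top_of_set N.W) M'"
      using N.no_minimal_subset[of M] by auto
    moreover have "M' \<subseteq> {0..1}" using M'(1) M(1) by auto
    ultimately show "\<exists>M'. M' \<subset> M \<and> M' \<noteq> {} \<and> (M' \<subseteq> {0..1} \<and> N.invariant M') \<and> closedin (top_of_set N.W) M'"
      by blast
  qed (use W01 N.W_invariant in auto)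
  then show ?thesis by blast
qed

end

lemma not_LMS_suspension_of_free_quotient:
  fixes \<Sigma> :: "'b::topological_space set" and C :: "'a::topological_space set" and F :: "'c monoid"
  assumes \<Sigma>: "closed_orientable_genus2 \<Sigma>" and C: "universal_cover C p \<Sigma>"
    and F: "free_group_on F s t" and \<phi>: "\<phi> \<in> epi (deck_group C p) F"
    and \<psi>: "\<psi> \<in> hom F (homeo_group unit_interval)"
    and W: "no_local_minimal_set (generate (homeo_group unit_interval) {\<psi> s, \<psi> t}) W"
  shows "\<not> LMS_property (suspension C (deck_group C p) (\<psi> \<circ> \<phi>))
           (suspension_leaves C (deck_group C p) (\<psi> \<circ> \<phi>))"
proof -
  obtain q where "quotient_map (top_of_set (cball (0::complex) 1)) (top_of_set \<Sigma>) q"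
    using \<Sigma> unfolding closed_orientable_genus2_def by blast
  then have "q ` cball 0 1 = \<Sigma>" by (simp add: quotient_map_def)
  moreover have "p ` C = \<Sigma>" using C unfolding universal_cover_def covering_space_def by blast
  \<comment> \<open>The disc is nonempty, hence so are the surface and its cover; this guarantees
    that lifts of nonempty sets are nonempty.\<close>
  ultimately have "C \<noteq> {}" by auto
  have \<phi>': "\<phi> \<in> hom (deck_group C p) F" "\<phi> ` carrier (deck_group C p) = carrier F"
    using \<phi> unfolding epi_def by auto
  have F': "group F" "{s, t} \<subseteq> carrier F" "generate F {s, t} = carrier F"
    using F unfolding free_group_on_def by auto
  interpret suspended_action C p "\<psi> \<circ> \<phi>"
    by unfold_locales (fact \<open>C \<noteq> {}\<close>, rule hom_compose[OF \<phi>'(1) \<psi>])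
  have "group_hom F (homeo_group unit_interval) \<psi>"
    using F'(1) group_homeo_group \<psi> by (simp add: group_hom_def group_hom_axioms_def)
  from group_hom.generate_img[OF this F'(2)]
  \<comment> \<open>Surjectivity of \<phi> and generation of \<open>F\<close> by \<open>s\<close>
    and \<open>t\<close> identify the holonomy group with the one generated by the images of
    \<open>s\<close> and \<open>t\<close>.\<close>
  have "(\<psi> \<circ> \<phi>) ` carrier (deck_group C p) = generate (homeo_group unit_interval) {\<psi> s, \<psi> t}"
    unfolding image_comp[symmetric] \<phi>'(2) F'(3)[symmetric] by simp
  then show ?thesis using W not_LMS_suspension by metis
qed

text \<open>The last clause ranges over all realisations of the surface, its universal cover and the
  free group in the given types; the clause before it states the failure directly for the orbits in
  the interval, independently of any such realisation.\<close>

theorem mainTheorem1: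
  fixes \<alpha> :: real and n :: "nat \<Rightarrow> nat"
  assumes "0 < \<alpha>" and "\<alpha> < (sqrt 5 - 1) / 2"
    and "\<And>k. k \<ge> 1 \<Longrightarrow> n k = 2 ^ k"
  shows "\<exists>(a :: int \<Rightarrow> real) (b :: nat \<Rightarrow> real) (u :: nat \<Rightarrow> real) (v :: nat \<Rightarrow> real)
      (c :: nat \<Rightarrow> real) (f :: real \<Rightarrow> real) (g :: real \<Rightarrow> real).
    (\<forall>m. 0 < a m \<and> a m < 1) \<and> (\<forall>m. a (m + 1) < a m) \<and>
    (a \<longlongrightarrow> 0) at_top \<and> (a \<longlongrightarrow> 1) at_bot \<and>
    (\<forall>k\<ge>1. a (int (n k) + 1) < b k \<and> b k < u k \<and> u k < v k \<and> v k < c k \<and> c k < a (int (n k))) \<and>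
    C1_holder_diffeo_on \<alpha> {0..1} f \<and> C1_holder_diffeo_on \<alpha> {0..1} g \<and>
    (\<forall>m. f (a (m + 1)) = a m) \<and>
    (\<forall>m. m \<notin> {int (n k) |k. k \<ge> 1} \<longrightarrow> (\<forall>x\<in>{a (m + 1)..a m}. g x = x)) \<and>
    (\<forall>k\<ge>1. (\<forall>x\<in>{a (int (n k) + 1)..b k} \<union> {c k..a (int (n k))}. g x = x) \<and>
       g (u k) = v k \<and> (\<forall>x\<in>{b k<..<c k}. g x \<noteq> x)) \<and>
    (\<forall>k\<ge>1. (f ^^ (n (k + 1) - n k)) (u (k + 1)) = b k \<and>
       (f ^^ (n (k + 1) - n k)) (v (k + 1)) = c k) \<and>
    \<not> LMS_property unit_interval
        (orbits (generate (homeo_group unit_interval) {restrict f {0..1}, restrict g {0..1}}) {0..1}) \<and>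
    (\<forall>(\<Sigma> :: 'b::topological_space set) (C :: 'a::topological_space set) (p :: 'a \<Rightarrow> 'b)
       (F :: 'c monoid) s t \<phi> \<psi>.
       closed_orientable_genus2 \<Sigma> \<and> universal_cover C p \<Sigma> \<and> free_group_on F s t \<and>
       \<phi> \<in> epi (deck_group C p) F \<and>
       \<psi> \<in> hom F (homeo_group unit_interval) \<and>
       \<psi> s = restrict f {0..1} \<and> \<psi> t = restrict g {0..1} \<longrightarrow>
       \<not> LMS_property (suspension C (deck_group C p) (\<psi> \<circ> \<phi>))
           (suspension_leaves C (deck_group C p) (\<psi> \<circ> \<phi>)))"
proof -
  obtain r r' K where "bump_radii r r' K" using bump_radii_exist by blast
  then interpret bump_radii r r' K .
  \<comment> \<open>This gives \<open>(sqrt 5 - 1) / 2 \<le> 5/8\<close>, the exponent for which the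
    maps were built.\<close>
  have "sqrt 5 \<le> 9/4" by (rule real_le_lsqrt) (auto simp: power2_eq_square)
  then have \<alpha>: "\<alpha> \<le> 5/8" using assms(2) by simp
  note n = assms(3)
  have levels: "{int (n k) |k. k \<ge> 1} = {2 ^ k |k. k \<ge> 1}" using n by force
  have diffeo: "C1_holder_diffeo_on \<alpha> {0..1} f_map" "C1_holder_diffeo_on \<alpha> {0..1} g_map"
    using C1_holder_diffeo_on_mono_exponent[OF _ \<alpha>] f_map_diffeo(1) g_map_diffeo(1) by auto
  let ?R = "{restrict f_map {0..1}, restrict g_map {0..1}}"
  obtain W where W: "no_local_minimal_set (generate (homeo_group unit_interval) ?R) W"
    using no_local_minimal_set_generated by blast
  have "?R \<subseteq> carrier (homeo_group unit_interval)"
    using f_map_diffeo(1) g_map_diffeo(1) unfolding C1_holder_diffeo_on_def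
    by (auto intro: C1_diffeo_on_restrict_homeo)
  then have "subgroup (generate (homeo_group unit_interval) ?R) (homeo_group unit_interval)"
    by (rule group.generate_is_subgroup[OF group_homeo_group])
  note not_LMS = not_LMS_action[OF this W]
  show ?thesis
  proof (rule exI[of _ a_seq], rule exI[of _ "\<lambda>k. pt k (r k)"], rule exI[of _ "\<lambda>k. pt k (r' k)"],
      rule exI[of _ "\<lambda>k. pt k (- r' k)"], rule exI[of _ "\<lambda>k. pt k (- r k)"],
      rule exI[of _ f_map], rule exI[of _ g_map], intro conjI)
    show "\<forall>m. 0 < a_seq m \<and> a_seq m < 1" using a_seq_bounds by blast
    show "\<forall>m. a_seq (m + 1) < a_seq m" using a_seq_less by blast
    show "\<forall>k\<ge>1. a_seq (int (n k) + 1) < pt k (r k) \<and> pt k (r k) < pt k (r' k) \<and> pt k (r' k) < pt k (- r' k) \<and>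
        pt k (- r' k) < pt k (- r k) \<and> pt k (- r k) < a_seq (int (n k))"
      using pt_order by (simp add: n a_seq_pt)
    show "\<forall>m. f_map (a_seq (m + 1)) = a_seq m" using f_map_a_seq by blast
    show "\<forall>m. m \<notin> {int (n k) |k. k \<ge> 1} \<longrightarrow> (\<forall>x\<in>{a_seq (m + 1)..a_seq m}. g_map x = x)"
      unfolding levels using g_map_id_off_levels by blast
    show "\<forall>k\<ge>1. (\<forall>x\<in>{a_seq (int (n k) + 1)..pt k (r k)} \<union> {pt k (- r k)..a_seq (int (n k))}. g_map x = x) \<and>
        g_map (pt k (r' k)) = pt k (- r' k) \<and> (\<forall>x\<in>{pt k (r k)<..<pt k (- r k)}. g_map x \<noteq> x)"
    proof (intro allI impI)
      fix k :: nat assume k: "1 \<le> k"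
      have e: "a_seq (int (n k) + 1) = pt k (1/2)" "a_seq (int (n k)) = pt k (-1/2)"
        using n[OF k] by (simp_all add: a_seq_pt)
      show "(\<forall>x\<in>{a_seq (int (n k) + 1)..pt k (r k)} \<union> {pt k (- r k)..a_seq (int (n k))}. g_map x = x) \<and>
          g_map (pt k (r' k)) = pt k (- r' k) \<and> (\<forall>x\<in>{pt k (r k)<..<pt k (- r k)}. g_map x \<noteq> x)"
        unfolding e using g_map_fixed[OF k] g_map_center[OF k] g_map_moves[OF k] by (intro conjI ballI)
    qed
    show "\<forall>k\<ge>1. (f_map ^^ (n (k + 1) - n k)) (pt (k + 1) (r' (k + 1))) = pt k (r k) \<and>
        (f_map ^^ (n (k + 1) - n k)) (pt (k + 1) (- r' (k + 1))) = pt k (- r k)"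
    proof (intro allI impI)
      fix k :: nat assume k: "1 \<le> k"
      have e: "n (k + 1) - n k = 2 ^ Suc k - 2 ^ k" using n[OF k] n[of "k + 1"] by simp
      show "(f_map ^^ (n (k + 1) - n k)) (pt (k + 1) (r' (k + 1))) = pt k (r k) \<and>
          (f_map ^^ (n (k + 1) - n k)) (pt (k + 1) (- r' (k + 1))) = pt k (- r k)"
        unfolding e unfolding Suc_eq_plus1[symmetric] using f_map_u_v[OF k] by (intro conjI)
    qed
    show "\<forall>(\<Sigma> :: 'b set) (C :: 'a set) (p :: 'a \<Rightarrow> 'b) (F :: 'c monoid) s t \<phi> \<psi>.
       closed_orientable_genus2 \<Sigma> \<and> universal_cover C p \<Sigma> \<and> free_group_on F s t \<and>
       \<phi> \<in> epi (deck_group C p) F \<and> \<psi> \<in> hom F (homeo_group unit_interval) \<and>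
       \<psi> s = restrict f_map {0..1} \<and> \<psi> t = restrict g_map {0..1} \<longrightarrow>
       \<not> LMS_property (suspension C (deck_group C p) (\<psi> \<circ> \<phi>))
           (suspension_leaves C (deck_group C p) (\<psi> \<circ> \<phi>))"
    proof (intro allI impI, elim conjE)
      fix \<Sigma> :: "'b set" and C :: "'a set" and p :: "'a \<Rightarrow> 'b" and F :: "'c monoid" and s t \<phi> \<psi>
      assume hyps: "closed_orientable_genus2 \<Sigma>" "universal_cover C p \<Sigma>" "free_group_on F s t"
        "\<phi> \<in> epi (deck_group C p) F" "\<psi> \<in> hom F (homeo_group unit_interval)"
        and st: "\<psi> s = restrict f_map {0..1}" "\<psi> t = restrict g_map {0..1}"
      show "\<not> LMS_property (suspension C (deck_group C p) (\<psi> \<circ> \<phi>))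
           (suspension_leaves C (deck_group C p) (\<psi> \<circ> \<phi>))"
        by (rule not_LMS_suspension_of_free_quotient[OF hyps]) (unfold st, rule W)
    qed
    show "(a_seq \<longlongrightarrow> 0) at_top" "(a_seq \<longlongrightarrow> 1) at_bot" by (rule a_seq_at_top a_seq_at_bot)+
    show "C1_holder_diffeo_on \<alpha> {0..1} f_map" "C1_holder_diffeo_on \<alpha> {0..1} g_map"
      by (rule diffeo)+
    show "\<not> LMS_property unit_interval (orbits (generate (homeo_group unit_interval) ?R) {0..1})"
      by (rule not_LMS)
  qed
qed

end
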